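(* Let $\delta\in(0,1)$. If $f$ is holomorphic on $G_\delta$ with $\|f\|_{\mathrm{bfd}}\le1$, then $f$ has a $G_\delta$-model, that is, there exist a Hilbert space $\mathcal{M}$, a unitary operator $U$ on $\mathcal{M}$ and a holomorphic map $u:G_\delta\to\mathcal{M}$ such that for all $\lambda,\mu\in G_\delta$, $$1-\overline{f(\mu)}f(\lambda)=\big\langle\big(2-2\delta^2-(\bar\mu-\delta\lambda)U-(\lambda-\delta\bar\mu)U^*\big)u(\lambda),u(\mu)\big\rangle_{\mathcal{M}}.$$
   Context: $G_\delta=\{x+iy: x,y\in\mathbb{R},\ \frac{x^2}{(1+\delta)^2}+\frac{y^2}{(1-\delta)^2}<1\}$. For a bounded operator $T$ on a Hilbert space, $W(T)=\{\langle Tx,x\rangle:\|x\|=1\}$. $\mathcal{F}_{\mathrm{bfd}}(G_\delta)$ is the class of bounded Hilbert space operators $T$ with $\overline{W(T)}\subseteq G_\delta$, and for holomorphic $\phi$ on $G_\delta$, $\|\phi\|_{\mathrm{bfd}}=\sup_{T\in\mathcal{F}_{\mathrm{bfd}}(G_\delta)}\|\phi(T)\|$, with $\phi(T)$ given by the Riesz–Dunford functional calculus. *)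

theory Defs
  imports "HOL-Complex_Analysis.Complex_Analysis"
begin

class chilbert = banach +
  fixes scaleC :: "complex \<Rightarrow> 'a \<Rightarrow> 'a"
    and cinner :: "'a \<Rightarrow> 'a \<Rightarrow> complex"
  assumes scaleC_add_right: "scaleC a (x + y) = scaleC a x + scaleC a y"
    and scaleC_add_left: "scaleC (a + b) x = scaleC a x + scaleC b x"
    and scaleC_scaleC: "scaleC a (scaleC b x) = scaleC (a * b) x"
    and scaleC_one: "scaleC 1 x = x"
    and scaleR_scaleC: "scaleR r x = scaleC (of_real r) x"
    and cinner_add_left: "cinner (x + y) z = cinner x z + cinner y z"
    and cinner_scaleC_left: "cinner (scaleC a x) y = a * cinner x y"
    and cinner_commute: "cinner y x = cnj (cinner x y)"
    and cinner_self_norm: "cinner x x = of_real ((norm x)\<^sup>2)"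

definition infinite_dim_chilbert :: "'h::chilbert itself \<Rightarrow> bool" where
  "infinite_dim_chilbert _ \<longleftrightarrow>
     (\<forall>n::nat. \<exists>e::nat \<Rightarrow> 'h. \<forall>i<n. \<forall>j<n. cinner (e i) (e j) = (if i = j then 1 else 0))"

definition bounded_clinear_op :: "('h::chilbert \<Rightarrow> 'h) \<Rightarrow> bool" where
  "bounded_clinear_op T \<longleftrightarrow> bounded_linear T \<and> (\<forall>c x. T (scaleC c x) = scaleC c (T x))"

definition cadjoint :: "('h::chilbert \<Rightarrow> 'h) \<Rightarrow> ('h \<Rightarrow> 'h)" where
  "cadjoint T = (THE S. \<forall>x y. cinner (T x) y = cinner x (S y))"

definition unitary_op :: "('h::chilbert \<Rightarrow> 'h) \<Rightarrow> bool" where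
  "unitary_op U \<longleftrightarrow> bounded_clinear_op U \<and>
     U \<circ> cadjoint U = id \<and> cadjoint U \<circ> U = id"

definition numerical_range :: "('h::chilbert \<Rightarrow> 'h) \<Rightarrow> complex set" where
  "numerical_range T = {cinner (T x) x | x. norm x = 1}"

definition op_spectrum :: "('h::chilbert \<Rightarrow> 'h) \<Rightarrow> complex set" where
  "op_spectrum T = {z. \<not> (\<exists>R. bounded_clinear_op R \<and>
       (\<forall>x. R (scaleC z x - T x) = x \<and> scaleC z (R x) - T (R x) = x))}"

definition resolvent :: "('h::chilbert \<Rightarrow> 'h) \<Rightarrow> complex \<Rightarrow> 'h \<Rightarrow> 'h" where
  "resolvent T z = (THE R. bounded_clinear_op R \<and>
       (\<forall>x. R (scaleC z x - T x) = x \<and> scaleC z (R x) - T (R x) = x))"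

definition has_vcontour_integral ::
    "(complex \<Rightarrow> 'h::chilbert) \<Rightarrow> 'h \<Rightarrow> (real \<Rightarrow> complex) \<Rightarrow> bool" where
  "has_vcontour_integral g I \<gamma> \<longleftrightarrow>
     ((\<lambda>t. scaleC (vector_derivative \<gamma> (at t within {0..1})) (g (\<gamma> t))) has_integral I) {0..1}"

definition admissible_contour ::
    "complex set \<Rightarrow> ('h::chilbert \<Rightarrow> 'h) \<Rightarrow> (real \<Rightarrow> complex) \<Rightarrow> bool" where
  "admissible_contour S T \<gamma> \<longleftrightarrow> valid_path \<gamma> \<and> pathfinish \<gamma> = pathstart \<gamma> \<and>
     path_image \<gamma> \<subseteq> S - op_spectrum T \<and>
     (\<forall>w\<in>op_spectrum T. winding_number \<gamma> w = 1) \<and>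
     (\<forall>w. w \<notin> S \<longrightarrow> winding_number \<gamma> w = 0)"

definition dunford :: "(complex \<Rightarrow> complex) \<Rightarrow> complex set \<Rightarrow> ('h::chilbert \<Rightarrow> 'h) \<Rightarrow> ('h \<Rightarrow> 'h)" where
  "dunford f S T = (THE A. \<forall>\<gamma>. admissible_contour S T \<gamma> \<longrightarrow>
      (\<forall>x. has_vcontour_integral (\<lambda>z. scaleC (f z / (2 * of_real pi * \<i>)) (resolvent T z x)) (A x) \<gamma>))"

definition G_delta :: "real \<Rightarrow> complex set" where
  "G_delta \<delta> = {z. (Re z)\<^sup>2 / (1 + \<delta>)\<^sup>2 + (Im z)\<^sup>2 / (1 - \<delta>)\<^sup>2 < 1}"

definition vholomorphic_on :: "(complex \<Rightarrow> 'h::chilbert) \<Rightarrow> complex set \<Rightarrow> bool" where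
  "vholomorphic_on u S \<longleftrightarrow> (\<forall>z\<in>S. \<exists>v. (u has_derivative (\<lambda>h. scaleC h v)) (at z within S))"

end

theory Submission
  imports Defs
begin

text \<open>
  Put \<open>\<kappa> = 1 - \<delta>\<^sup>2\<close> and \<open>s(\<lambda>) = cnj \<lambda> - \<delta> \<lambda>\<close>; then \<open>G_\<delta>\<close> is \<open>{\<lambda>. \<bar>s(\<lambda>)\<bar> < \<kappa>}\<close>, so the numerical range of \<open>T\<close> lies in
  the closed ellipse iff \<open>2\<kappa> - 2 Re (\<omega> s(\<langle>Tx,x\<rangle>)) \<ge> 0\<close> for all unit vectors \<open>x\<close> and unimodular \<open>\<omega>\<close>.
  On finitely many points, the kernel \<open>1 - f(\<lambda>) cnj (f(\<mu>))\<close> lies in the closure of the cone of kernels with a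
  model: otherwise a separating functional is a Gram matrix, which makes the diagonal operator
  with these points as eigenvalues an element of the class on which \<open>f\<close> is contractive, a contradiction.
  A model is encoded by the Toeplitz-positive kernel \<open>\<langle>U^k u(\<lambda>), u(\<mu>)\<rangle>\<close>, whose entries are bounded a priori, so
  approximate models on finite sets converge to an exact model on a countable dense set. Finally the
  coercivity \<open>Re (2\<kappa> - s(\<lambda>)U - cnj (s(\<lambda>))U*) \<ge> 2(\<kappa> - \<bar>s(\<lambda>)\<bar>)\<close>, applied to first differences and to
  differences of difference quotients of \<open>u\<close>, extends \<open>u\<close> to a holomorphic function on \<open>G_\<delta>\<close>.
\<close>

section \<open>Complex Hilbert spaces\<close>

text \<open>A single type \<open>'h\<close> has to carry both the test operators and the model, so
  everything is built inside it. Gram matrices are realized by triangular combinations of one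
  orthonormal sequence. Matrices are stored as vectors of \<open>'h\<close>, so that Hilbert space
  projection provides the separation. Test operators and \<open>U\<close> are determined on a closed
  span and continued to its orthogonal complement: by a scalar that is already an eigenvalue, and by
  the identity. The separation controls only the closure of the cone, which is why the finite models
  carry an error. The unitaries of these models have no evident limit, whereas Toeplitz positivity
  is a family of closed conditions on finitely many entries each and survives pointwise limits.
  Indexing the powers by all integers makes the shift a bijection, hence unitary. A separating Gram
  matrix may be singular, and the numerical range it yields may touch the boundary of the open
  ellipse. Adding a small multiple of the identity cures both, because the eigenvalues lie strictly
  inside.\<close>

lemma scaleC_zero_left [simp]: "scaleC 0 (x::'h::chilbert) = 0"
  using scaleC_add_left[of 0 0 x] by simp

lemma scaleC_zero_right [simp]: "scaleC c (0::'h::chilbert) = 0"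
  using scaleC_add_right[of c 0 "0::'h"] by simp

lemma cinner_add_right: "cinner (x::'h::chilbert) (y + z) = cinner x y + cinner x z"
  by (metis cinner_add_left cinner_commute complex_cnj_add)

lemma cinner_scaleC_right: "cinner (x::'h::chilbert) (scaleC c y) = cnj c * cinner x y"
  by (metis cinner_commute cinner_scaleC_left complex_cnj_mult)

lemma norm_scaleC: "norm (scaleC c (x::'h::chilbert)) = cmod c * norm x"
proof -
  have "complex_of_real ((norm (scaleC c x))\<^sup>2) = c * cnj c * cinner x x"
    by (simp add: cinner_self_norm[symmetric] cinner_scaleC_left cinner_scaleC_right del: of_real_power)
  also have "\<dots> = of_real ((cmod c * norm x)\<^sup>2)"
    by (simp only: cinner_self_norm complex_norm_square[symmetric] power_mult_distrib of_real_mult)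
  finally have "complex_of_real ((norm (scaleC c x))\<^sup>2) = of_real ((cmod c * norm x)\<^sup>2)" .
  then show ?thesis
    by (metis abs_norm_cancel mult_nonneg_nonneg norm_ge_zero of_real_eq_iff power2_eq_iff_nonneg)
qed

interpretation scaleC: bounded_bilinear "scaleC :: complex \<Rightarrow> 'h \<Rightarrow> 'h::chilbert"
proof
  show "\<exists>K. \<forall>a (b::'h). norm (scaleC a b) \<le> norm a * norm b * K"
    by (rule exI[of _ 1]) (simp add: norm_scaleC)
qed (simp_all add: scaleC_add_left scaleC_add_right scaleR_scaleC scaleC_scaleC scaleR_conv_of_real
      mult.commute)

lemma cinner_zero_left': "cinner (0::'h::chilbert) y = 0"
  using cinner_scaleC_left[of 0 "0::'h" y] by simp

lemma cinner_cauchy_schwarz: "cmod (cinner (x::'h::chilbert) y) \<le> norm x * norm y"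
proof (cases "y = 0")
  case True
  then show ?thesis using cinner_commute[of "0::'h" x] by (simp add: cinner_zero_left')
next
  case False
  define t where "t = cinner x y / of_real ((norm y)\<^sup>2)"
  define z where "z = x + scaleC (- t) y"
  have "cinner z z = cinner x x - t * cnj (cinner x y) - cnj t * cinner x y + t * cnj t * cinner y y"
    using cinner_commute[of y x]
    by (simp add: z_def cinner_add_left cinner_add_right cinner_scaleC_left cinner_scaleC_right algebra_simps)
  also have "\<dots> = of_real ((norm x)\<^sup>2) - cinner x y * cnj (cinner x y) / of_real ((norm y)\<^sup>2)"
    using False by (simp add: t_def cinner_self_norm power2_eq_square)
  also have "\<dots> = of_real ((norm x)\<^sup>2 - (cmod (cinner x y))\<^sup>2 / (norm y)\<^sup>2)"
    by (simp only: complex_norm_square of_real_diff of_real_divide)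
  finally have "(norm x)\<^sup>2 - (cmod (cinner x y))\<^sup>2 / (norm y)\<^sup>2 = (norm z)\<^sup>2"
    by (metis cinner_self_norm of_real_eq_iff)
  then have "(cmod (cinner x y))\<^sup>2 / (norm y)\<^sup>2 \<le> (norm x)\<^sup>2"
    by (smt (verit) zero_le_power2)
  then have "(cmod (cinner x y))\<^sup>2 \<le> (norm x * norm y)\<^sup>2"
    using False by (simp add: divide_le_eq power_mult_distrib)
  then show ?thesis
    by (rule power2_le_imp_le) simp
qed

interpretation cinner: bounded_bilinear "cinner :: 'h::chilbert \<Rightarrow> 'h \<Rightarrow> complex"
proof
  show "\<exists>K. \<forall>(a::'h) b. norm (cinner a b) \<le> norm a * norm b * K"
    by (rule exI[of _ 1]) (simp add: cinner_cauchy_schwarz)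
qed (simp_all add: cinner_add_left cinner_add_right scaleR_scaleC cinner_scaleC_left
      cinner_scaleC_right scaleR_conv_of_real)

lemma Re_cinner_self: "Re (cinner x x) = (norm (x::'h::chilbert))\<^sup>2"
  by (simp add: cinner_self_norm)

lemma Re_cinner_commute: "Re (cinner y (x::'h::chilbert)) = Re (cinner x y)"
  by (simp add: cinner_commute[of x y])

lemma norm_add_sq:
  "(norm (x + y))\<^sup>2 = (norm x)\<^sup>2 + 2 * Re (cinner x (y::'h::chilbert)) + (norm y)\<^sup>2"
  by (simp add: Re_cinner_self[symmetric] cinner_add_left cinner_add_right Re_cinner_commute[of y x])

lemma norm_diff_sq:
  "(norm (x - y))\<^sup>2 = (norm x)\<^sup>2 - 2 * Re (cinner x (y::'h::chilbert)) + (norm y)\<^sup>2"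
  using norm_add_sq[of x "- y"] by (simp add: cinner.minus_right)

lemma cinner_eq_zero_all: "(\<And>y. cinner x y = 0) \<Longrightarrow> x = (0::'h::chilbert)"
  using cinner_self_norm[of x] by simp

lemma cinner_eqI: "(\<And>z. cinner z x = cinner z y) \<Longrightarrow> x = (y::'h::chilbert)"
  by (metis cinner.diff_right cinner_eq_zero_all cinner_commute complex_cnj_zero_iff right_minus_eq)

text \<open>By the parallelogram law a minimizing sequence is Cauchy.\<close>

lemma closest_point_chilbert:
  fixes K :: "'h::chilbert set"
  assumes "closed K" "convex K" "K \<noteq> {}"
  obtains p where "p \<in> K" "\<And>y. y \<in> K \<Longrightarrow> Re (cinner (b - p) (y - p)) \<le> 0"
proof -
  define m where "m = infdist b K"
  have m0: "0 \<le> m" by (simp add: m_def infdist_nonneg)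
  have mle: "m \<le> norm (b - y)" if "y \<in> K" for y
    using infdist_le[OF that, of b] by (simp add: m_def dist_norm)
  have "\<exists>y\<in>K. norm (b - y) < m + 1 / Suc n" for n
  proof -
    have "infdist b K < m + 1 / Suc n" by (simp add: m_def)
    moreover have "infdist b K = (INF y\<in>K. norm (b - y))"
      using assms(3) by (simp add: infdist_def dist_norm)
    moreover have "bdd_below ((\<lambda>y. norm (b - y)) ` K)" by (rule bdd_belowI[of _ 0]) auto
    ultimately show ?thesis using cINF_less_iff[OF assms(3), of "\<lambda>y. norm (b - y)"] by simp
  qed
  then obtain y where y: "\<And>n. y n \<in> K" "\<And>n. norm (b - y n) < m + 1 / Suc n" by metis
  have lim: "(\<lambda>n. norm (b - y n)) \<longlonglongrightarrow> m"
  proof (rule tendsto_sandwich[of "\<lambda>_. m" _ _ "\<lambda>n. m + 1 / Suc n"])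
    have "(\<lambda>n. m + 1 / real (Suc n)) \<longlonglongrightarrow> m + 0"
      by (intro tendsto_intros LIMSEQ_Suc lim_1_over_n)
    then show "(\<lambda>n. m + 1 / real (Suc n)) \<longlonglongrightarrow> m" by simp
    show "\<forall>\<^sub>F n in sequentially. norm (b - y n) \<le> m + 1 / real (Suc n)"
      using y(2) by (auto intro!: always_eventually less_imp_le)
  qed (auto simp: mle y(1))
  have par: "(norm (y i - y j))\<^sup>2 \<le> 2 * ((norm (b - y i))\<^sup>2 - m\<^sup>2) + 2 * ((norm (b - y j))\<^sup>2 - m\<^sup>2)" for i j
  proof -
    have "(1/2) *\<^sub>R y i + (1/2) *\<^sub>R y j \<in> K"
      using assms(2) y(1) by (simp add: convexD)
    then have "m \<le> norm (b - ((1/2) *\<^sub>R y i + (1/2) *\<^sub>R y j))" by (rule mle)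
    also have "b - ((1/2) *\<^sub>R y i + (1/2) *\<^sub>R y j) = (1/2) *\<^sub>R ((b - y i) + (b - y j))"
      using scaleR_half_double[of b] by (simp add: scaleR_add_right scaleR_diff_right)
    finally have "2 * m \<le> norm ((b - y i) + (b - y j))" by simp
    then have "(2 * m)\<^sup>2 \<le> (norm ((b - y i) + (b - y j)))\<^sup>2"
      using m0 by (intro power_mono) auto
    moreover have "norm (y i - y j) = norm ((b - y j) - (b - y i))" by simp
    then have "(norm (y i - y j))\<^sup>2 = (norm (b - y j))\<^sup>2 - 2 * Re (cinner (b - y i) (b - y j)) + (norm (b - y i))\<^sup>2"
      by (simp only: norm_diff_sq[of "b - y j" "b - y i"] Re_cinner_commute[of "b - y j" "b - y i"])
    ultimately show ?thesis
      by (simp add: norm_add_sq power_mult_distrib)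
  qed
  have "Cauchy y"
  proof (rule metric_CauchyI)
    fix e :: real assume "e > 0"
    have "(\<lambda>n. (norm (b - y n))\<^sup>2 - m\<^sup>2) \<longlonglongrightarrow> m\<^sup>2 - m\<^sup>2"
      by (intro tendsto_intros lim)
    then have "\<forall>\<^sub>F n in sequentially. (norm (b - y n))\<^sup>2 - m\<^sup>2 < e\<^sup>2 / 4"
      using \<open>e > 0\<close> by (intro order_tendstoD(2)) auto
    then obtain M where M: "\<And>n. n \<ge> M \<Longrightarrow> (norm (b - y n))\<^sup>2 - m\<^sup>2 < e\<^sup>2 / 4"
      by (auto simp: eventually_sequentially)
    have "dist (y i) (y j) < e" if "i \<ge> M" "j \<ge> M" for i j
    proof -
      have "(norm (y i - y j))\<^sup>2 < e\<^sup>2"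
        using par[of i j] M[OF that(1)] M[OF that(2)] by simp
      then show ?thesis using \<open>e > 0\<close> by (simp add: dist_norm power2_less_imp_less)
    qed
    then show "\<exists>M. \<forall>i\<ge>M. \<forall>j\<ge>M. dist (y i) (y j) < e" by blast
  qed
  then obtain p where p: "y \<longlonglongrightarrow> p" using Cauchy_convergent convergent_def by blast
  have pK: "p \<in> K" using closed_sequentially[OF assms(1)] y(1) p by blast
  have "(\<lambda>n. norm (b - y n)) \<longlonglongrightarrow> norm (b - p)" by (intro tendsto_intros p)
  then have pm: "norm (b - p) = m" using lim LIMSEQ_unique by blast
  have "Re (cinner (b - p) (z - p)) \<le> 0" if z: "z \<in> K" for z
  proof (rule ccontr)
    assume neg: "\<not> ?thesis"
    define a where "a = Re (cinner (b - p) (z - p))"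
    define q where "q = (norm (z - p))\<^sup>2"
    have a: "a > 0" using neg by (simp add: a_def)
    have q: "q \<ge> 0" by (simp add: q_def)
    \<comment> \<open>Small enough for the linear gain 2ta to beat the quadratic loss t^2 q;
      \<open>min 1\<close> keeps the moved point in \<open>K\<close>, and \<open>q + 1\<close>
      avoids a zero denominator.\<close>
    define t where "t = min 1 (a / (q + 1))"
    have t: "0 < t" "t \<le> 1" "t * q < 2 * a"
    proof -
      have "t * q \<le> a / (q + 1) * q" using q by (intro mult_right_mono) (auto simp: t_def)
      also have "\<dots> \<le> a" using q a by (simp add: field_simps)
      finally show "t * q < 2 * a" using a by simp
    qed (use a q in \<open>auto simp: t_def\<close>)
    have "(1 - t) *\<^sub>R p + t *\<^sub>R z \<in> K"
      using assms(2) pK z t by (simp add: convexD)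
    from mle[OF this] have "m\<^sup>2 \<le> (norm (b - ((1 - t) *\<^sub>R p + t *\<^sub>R z)))\<^sup>2"
      using m0 by (simp add: power_mono)
    also have "b - ((1 - t) *\<^sub>R p + t *\<^sub>R z) = (b - p) - t *\<^sub>R (z - p)"
      by (simp add: algebra_simps)
    also have "(norm \<dots>)\<^sup>2 = m\<^sup>2 - 2 * t * a + t\<^sup>2 * q"
      by (simp add: norm_diff_sq pm a_def q_def cinner.scaleR_right power_mult_distrib)
    finally have "t * (2 * a) \<le> t * (t * q)" by (simp add: power2_eq_square algebra_simps)
    then show False using t by simp
  qed
  then show ?thesis using that pK by blast
qed

section \<open>Complex subspaces and orthogonal projection\<close>

definition csubspace :: "'h::chilbert set \<Rightarrow> bool" where
  "csubspace M \<longleftrightarrow> subspace M \<and> (\<forall>c. \<forall>x\<in>M. scaleC c x \<in> M)"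

text \<open>The library \<open>span\<close> uses real scalars. Closing the generators under complex
  multiples first turns it into the complex linear span while keeping its lemmas available.\<close>

definition cspan :: "'h::chilbert set \<Rightarrow> 'h set" where
  "cspan S = span {scaleC c x |c x. x \<in> S}"

lemma bounded_linear_scaleC: "bounded_linear (scaleC c :: 'h \<Rightarrow> 'h::chilbert)"
  by (rule scaleC.bounded_linear_right)

lemma csubspace_cspan: "csubspace (cspan S)"
proof -
  have "scaleC c ` span {scaleC c x |c x. x \<in> S} \<subseteq> span {scaleC c x |c x. x \<in> S}" for c
  proof -
    have "scaleC c ` span {scaleC c x |c x. x \<in> S} = span (scaleC c ` {scaleC c x |c x. x \<in> S})"
      by (rule linear_span_image[symmetric]) (rule bounded_linear.linear[OF bounded_linear_scaleC])
    also have "\<dots> \<subseteq> span {scaleC c x |c x. x \<in> S}"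
      by (rule span_mono) (clarsimp simp: scaleC_scaleC, blast)
    finally show ?thesis .
  qed
  then show ?thesis by (auto simp: csubspace_def cspan_def image_subset_iff)
qed

lemma cspan_superset: "x \<in> S \<Longrightarrow> x \<in> cspan S"
  unfolding cspan_def by (rule span_base) (auto intro!: exI[of _ 1] exI[of _ x] simp: scaleC_one)

lemma subspace_closure:
  assumes M: "subspace (M :: 'a::real_normed_vector set)" shows "subspace (closure M)"
proof -
  have "x + y \<in> closure M" if "x \<in> closure M" "y \<in> closure M" for x y
  proof -
    have "(\<lambda>(x, y). x + y) ` closure (M \<times> M) \<subseteq> closure M"
    proof (rule image_closure_subset)
      show "continuous_on (closure (M \<times> M)) (\<lambda>(x, y). x + y)"
        unfolding case_prod_unfold by (intro continuous_intros)
      show "(\<lambda>(x, y). x + y) ` (M \<times> M) \<subseteq> closure M"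
        using subspace_add[OF M(1)] closure_subset[of M] by auto
    qed auto
    then show ?thesis using that unfolding closure_Times by (auto simp: image_subset_iff)
  qed
  moreover have "(\<lambda>x. c *\<^sub>R x) ` closure M \<subseteq> closure M" for c
    using subspace_scale[OF M] closure_subset[of M]
    by (intro image_closure_subset continuous_intros) auto
  moreover have "0 \<in> closure M" using M closure_subset subspace_0 by blast
  ultimately show ?thesis
    unfolding subspace_def image_subset_iff by blast
qed

lemma csubspace_closure:
  assumes "csubspace M" shows "csubspace (closure M)"
proof -
  have M: "subspace M" "\<And>c. scaleC c ` M \<subseteq> M"
    using assms by (auto simp: csubspace_def)
  have "scaleC c ` closure M \<subseteq> closure M" for c
    using M(2)[of c] closure_subset[of M]
    by (intro image_closure_subset linear_continuous_on bounded_linear_scaleC) auto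
  then show ?thesis
    using subspace_closure[OF M(1)] unfolding csubspace_def image_subset_iff by blast
qed

text \<open>On a subspace the variational inequality of the nearest point can be tested at both
  \<open>p + y\<close> and \<open>p - y\<close>, which makes it an equality of real parts; testing
  at \<i> y as well removes the imaginary part.\<close>

lemma orthogonal_decomposition:
  assumes "csubspace M" "closed M"
  obtains p where "p \<in> M" "\<And>y. y \<in> M \<Longrightarrow> cinner (x - p) y = 0"
proof -
  have sub: "subspace M" using assms by (simp add: csubspace_def)
  obtain p where p: "p \<in> M" "\<And>y. y \<in> M \<Longrightarrow> Re (cinner (x - p) (y - p)) \<le> 0"
    by (rule closest_point_chilbert[OF assms(2) subspace_imp_convex[OF sub], of x]) (use subspace_0[OF sub] in auto)
  have re: "Re (cinner (x - p) y) = 0" if "y \<in> M" for y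
  proof -
    have "y + p \<in> M" "- y + p \<in> M"
      using that p(1) sub by (simp_all only: subspace_add subspace_neg)
    from this[THEN p(2)] show ?thesis by (simp add: cinner.minus_right)
  qed
  have "cinner (x - p) y = 0" if "y \<in> M" for y
  proof -
    have "scaleC \<i> y \<in> M" using assms that by (auto simp: csubspace_def)
    from re[OF this] re[OF that] show ?thesis
      by (simp add: cinner_scaleC_right complex_eq_iff)
  qed
  then show ?thesis using that p(1) by blast
qed

section \<open>Orthonormal sequences and positive kernels\<close>

definition orthonormal :: "(nat \<Rightarrow> 'h::chilbert) \<Rightarrow> bool" where
  "orthonormal e \<longleftrightarrow> (\<forall>i j. cinner (e i) (e j) = (if i = j then 1 else 0))"

lemma norm_eq_1_chilbert: "cinner x x = 1 \<Longrightarrow> norm (x::'h::chilbert) = 1"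
  using Re_cinner_self[of x] by (simp add: power2_eq_1_iff) (use norm_ge_zero[of x] in linarith)

text \<open>Serves two purposes: Bessel's inequality, and a vector orthogonal to the system whose
  length is known.\<close>

lemma bessel_residual:
  fixes e :: "nat \<Rightarrow> 'h::chilbert" and x :: 'h
  assumes on: "\<And>i j. i < n \<Longrightarrow> j < n \<Longrightarrow> cinner (e i) (e j) = (if i = j then 1 else 0)"
  defines "y \<equiv> x - (\<Sum>i<n. scaleC (cinner x (e i)) (e i))"
  shows "j < n \<Longrightarrow> cinner y (e j) = 0"
    and "(norm y)\<^sup>2 = (norm x)\<^sup>2 - (\<Sum>i<n. (cmod (cinner x (e i)))\<^sup>2)"
proof -
  show orth: "cinner y (e j) = 0" if "j < n" for j
  proof -
    have "cinner y (e j) = cinner x (e j) - (\<Sum>i<n. cinner x (e i) * cinner (e i) (e j))"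
      by (simp add: y_def cinner.diff_left cinner.sum_left cinner_scaleC_left)
    also have "(\<Sum>i<n. cinner x (e i) * cinner (e i) (e j)) = (\<Sum>i<n. if i = j then cinner x (e i) else 0)"
      using that by (intro sum.cong) (auto simp: on)
    finally show ?thesis using that by simp
  qed
  have "cinner y y = cinner y x"
  proof -
    have "cinner y (\<Sum>i<n. scaleC (cinner x (e i)) (e i)) = 0"
      by (simp add: cinner.sum_right cinner_scaleC_right orth)
    then have "cinner y (x - (\<Sum>i<n. scaleC (cinner x (e i)) (e i))) = cinner y x"
      by (simp add: cinner.diff_right)
    then show ?thesis by (simp add: y_def)
  qed
  also have "\<dots> = cinner x x - (\<Sum>i<n. cinner x (e i) * cnj (cinner x (e i)))"
    by (simp add: y_def cinner.diff_left cinner.sum_left cinner_scaleC_left cinner_commute[of "e i" x for i])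
  also have "\<dots> = of_real ((norm x)\<^sup>2 - (\<Sum>i<n. (cmod (cinner x (e i)))\<^sup>2))"
    by (simp only: cinner_self_norm complex_norm_square of_real_diff of_real_sum)
  finally show "(norm y)\<^sup>2 = (norm x)\<^sup>2 - (\<Sum>i<n. (cmod (cinner x (e i)))\<^sup>2)"
    by (metis cinner_self_norm of_real_eq_iff)
qed

text \<open>The hypothesis offers orthonormal systems of every finite size that are unrelated to
  each other, so an exchange argument is needed. Among n+1 orthonormal vectors \<open>f j\<close>,
  Bessel's inequality for each \<open>e i\<close> bounds the total of the squared coefficients by n;
  hence some \<open>f j\<close> has coefficient sum below 1 and leaves a nonzero residual.\<close>

lemma extend_orthonormal:
  fixes e :: "nat \<Rightarrow> 'h::chilbert"
  assumes "infinite_dim_chilbert TYPE('h)"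
    and on: "\<And>i j. i < n \<Longrightarrow> j < n \<Longrightarrow> cinner (e i) (e j) = (if i = j then 1 else 0)"
  obtains r where "norm r = 1" "\<And>i. i < n \<Longrightarrow> cinner r (e i) = 0"
proof -
  obtain f :: "nat \<Rightarrow> 'h" where
    f: "\<And>i j. i < Suc n \<Longrightarrow> j < Suc n \<Longrightarrow> cinner (f i) (f j) = (if i = j then 1 else 0)"
    using assms(1) unfolding infinite_dim_chilbert_def by metis
  have nf: "norm (f j) = 1" if "j < Suc n" for j
    using f[OF that that] by (intro norm_eq_1_chilbert) auto
  have ne: "norm (e j) = 1" if "j < n" for j
    using on[OF that that] by (intro norm_eq_1_chilbert) auto
  have "\<exists>j<Suc n. (\<Sum>i<n. (cmod (cinner (f j) (e i)))\<^sup>2) < 1"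
  proof (rule ccontr)
    assume "\<not> ?thesis"
    then have "(\<Sum>j<Suc n. 1) \<le> (\<Sum>j<Suc n. \<Sum>i<n. (cmod (cinner (f j) (e i)))\<^sup>2)"
      by (intro sum_mono) force
    also have "\<dots> = (\<Sum>i<n. \<Sum>j<Suc n. (cmod (cinner (e i) (f j)))\<^sup>2)"
      by (subst sum.swap) (simp only: cinner_commute[of "e i" "f j" for i j] complex_mod_cnj)
    also have "\<dots> \<le> (\<Sum>i<n. 1)"
    proof (rule sum_mono)
      fix i assume "i \<in> {..<n}"
      then have "0 \<le> 1 - (\<Sum>j<Suc n. (cmod (cinner (e i) (f j)))\<^sup>2)"
        using bessel_residual(2)[OF f, of "Suc n" "e i"] ne[of i]
          zero_le_power2[of "norm (e i - (\<Sum>j<Suc n. scaleC (cinner (e i) (f j)) (f j)))"]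
        by (simp del: sum.lessThan_Suc)
      then show "(\<Sum>j<Suc n. (cmod (cinner (e i) (f j)))\<^sup>2) \<le> 1" by simp
    qed
    finally show False by simp
  qed
  then obtain j where j: "j < Suc n" "(\<Sum>i<n. (cmod (cinner (f j) (e i)))\<^sup>2) < 1" by blast
  define y where "y = f j - (\<Sum>i<n. scaleC (cinner (f j) (e i)) (e i))"
  have y: "(norm y)\<^sup>2 = 1 - (\<Sum>i<n. (cmod (cinner (f j) (e i)))\<^sup>2)" "\<And>i. i < n \<Longrightarrow> cinner y (e i) = 0"
    unfolding y_def using bessel_residual[OF on, where x = "f j"] nf[OF j(1)] by auto
  then have "norm y > 0" using j(2) by auto
  then show ?thesis using y(2)
    by (intro that[of "(1 / norm y) *\<^sub>R y"]) (auto simp: cinner.scaleR_left)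
qed

lemma orthonormal_sequence:
  assumes "infinite_dim_chilbert TYPE('h::chilbert)"
  obtains e :: "nat \<Rightarrow> 'h::chilbert" where "orthonormal e"
proof -
  define P where "P f n r \<longleftrightarrow> norm r = 1 \<and> (\<forall>i<n. cinner r (f i) = 0)"
    for f :: "nat \<Rightarrow> 'h" and n :: nat and r
  \<comment> \<open>\<open>P f n r\<close> looks at \<open>f\<close> only below \<open>n\<close>,
    which is what choice along a well-order requires.\<close>
  have "\<exists>f. \<forall>n. P f n (f n)"
  proof (rule dependent_wellorder_choice)
    show "P f x r = P g x r" if "\<And>y. y < x \<Longrightarrow> f y = g y" for r f g x
      using that by (auto simp: P_def)
    show "\<exists>r. P f x r" if h: "\<And>y. y < x \<Longrightarrow> P f y (f y)" for x f
    proof -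
      have "cinner (f i) (f j) = (if i = j then 1 else 0)" if "i < x" "j < x" for i j
      proof (cases i j rule: linorder_cases)
        case less
        have "cinner (f j) (f i) = 0" using h[OF that(2)] less by (simp add: P_def)
        then show ?thesis using less cinner_commute[of "f j" "f i"] by simp
      qed (use h[OF that(1)] that in \<open>auto simp: P_def cinner_self_norm\<close>)
      then show ?thesis unfolding P_def using extend_orthonormal[OF assms, of x f] by metis
    qed
  qed
  then obtain f where f: "\<And>n. P f n (f n)" by blast
  have "cinner (f i) (f j) = (if i = j then 1 else 0)" for i j
  proof (cases i j rule: linorder_cases)
    case less
    have "cinner (f j) (f i) = 0" using f[of j] less by (simp add: P_def)
    then show ?thesis using less cinner_commute[of "f j" "f i"] by simp
  qed (use f[of i] in \<open>auto simp: P_def cinner_self_norm\<close>)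
  then show ?thesis by (intro that[of f]) (simp add: orthonormal_def)
qed

text \<open>Testing against finite sequences, rather than finite sets, of points makes positivity
  stable under pullback along arbitrary maps.\<close>

definition psd :: "('i \<Rightarrow> 'i \<Rightarrow> complex) \<Rightarrow> bool" where
  "psd A \<longleftrightarrow> (\<forall>p q. A q p = cnj (A p q)) \<and>
     (\<forall>(n::nat) p z. 0 \<le> Re (\<Sum>a<n. \<Sum>b<n. z a * cnj (z b) * A (p a) (p b)))"

lemma psd_herm: "psd A \<Longrightarrow> A q p = cnj (A p q)"
  unfolding psd_def by blast

lemma psd_pos: "psd A \<Longrightarrow> 0 \<le> Re (\<Sum>a<n. \<Sum>b<n. z a * cnj (z b) * A (p a) (p b))"
  for n :: nat
  unfolding psd_def by blast

lemma psd_pullback: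
  assumes "psd A" shows "psd (\<lambda>x y. A (h x) (h y))"
  unfolding psd_def
proof (intro conjI allI)
  show "A (h q) (h p) = cnj (A (h p) (h q))" for p q using assms by (rule psd_herm)
  show "0 \<le> Re (\<Sum>a<n. \<Sum>b<n. z a * cnj (z b) * A (h (p a)) (h (p b)))" for n :: nat and p z
    by (rule psd_pos[OF assms, where p = "\<lambda>a. h (p a)"])
qed

lemma psd_diag:
  assumes "psd A" shows "A p p = of_real (Re (A p p))" "0 \<le> Re (A p p)"
proof -
  show "A p p = of_real (Re (A p p))" using arg_cong[OF psd_herm[OF assms, of p p], of Im] by (simp add: complex_eq_iff)
  show "0 \<le> Re (A p p)" using psd_pos[OF assms, where n = 1 and z = "\<lambda>_. 1" and p = "\<lambda>_. p"] by simp
qed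

lemma psd_cauchy_schwarz:
  fixes n :: nat
  assumes "psd A"
  shows "(cmod (\<Sum>a<n. z a * A (p a) r))\<^sup>2
    \<le> Re (\<Sum>a<n. \<Sum>b<n. z a * cnj (z b) * A (p a) (p b)) * Re (A r r)"
proof -
  define S where "S = (\<Sum>a<n. z a * A (p a) r)"
  define Q where "Q = Re (\<Sum>a<n. \<Sum>b<n. z a * cnj (z b) * A (p a) (p b))"
  define d where "d = Re (A r r)"
  have d: "A r r = of_real d" "d \<ge> 0" using psd_diag[OF assms, of r] by (auto simp: d_def)
  have Q0: "Q \<ge> 0" unfolding Q_def using assms by (rule psd_pos)
  have main: "0 \<le> Q + 2 * Re (cnj t * S) + (cmod t)\<^sup>2 * d" for t
  proof -
    have S': "cnj S = (\<Sum>b<n. cnj (z b) * A r (p b))"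
      unfolding S_def by (simp add: psd_herm[OF assms, of r])
    \<comment> \<open>Positivity is tested with \<open>r\<close> appended as an extra point of
      weight \<open>t\<close>; this gives a nonnegative real quadratic in the complex variable
      \<open>t\<close>.\<close>
    have "0 \<le> Re (\<Sum>a<Suc n. \<Sum>b<Suc n. (z(n := t)) a * cnj ((z(n := t)) b) * A ((p(n := r)) a) ((p(n := r)) b))"
      using assms by (rule psd_pos)
    also have "(\<Sum>a<Suc n. \<Sum>b<Suc n. (z(n := t)) a * cnj ((z(n := t)) b) * A ((p(n := r)) a) ((p(n := r)) b))
       = (\<Sum>a<n. \<Sum>b<n. z a * cnj (z b) * A (p a) (p b)) + cnj t * S + t * cnj S + t * cnj t * A r r"
    proof -
      have "(\<Sum>a<Suc n. \<Sum>b<Suc n. (z(n := t)) a * cnj ((z(n := t)) b) * A ((p(n := r)) a) ((p(n := r)) b))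
        = (\<Sum>a<n. (\<Sum>b<n. z a * cnj (z b) * A (p a) (p b)) + cnj t * (z a * A (p a) r))
          + ((\<Sum>b<n. t * (cnj (z b) * A r (p b))) + t * cnj t * A r r)"
        by (simp add: mult.assoc mult.left_commute[of _ "cnj t"])
      then show ?thesis
        unfolding S' unfolding S_def sum.distrib sum_distrib_left by simp
    qed
    also have "Re \<dots> = Q + 2 * Re (cnj t * S) + (cmod t)\<^sup>2 * d"
      by (simp add: Q_def d(1) complex_norm_square[symmetric] del: of_real_power)
    finally show ?thesis .
  qed
  have "(cmod S)\<^sup>2 \<le> Q * d"
  proof (cases "d = 0")
    case True
    have "(cmod S)\<^sup>2 \<le> 0"
    proof (rule ccontr)
      assume "\<not> ?thesis"
      then have pos: "(cmod S)\<^sup>2 > 0" by simp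
      \<comment> \<open>For \<open>d = 0\<close> the quadratic degenerates to an affine function of
        \<open>t\<close>, and this multiple drives it down to Q - 2(Q + 1) < 0.\<close>
      define s where "s = (Q + 1) / (cmod S)\<^sup>2"
      have "cnj (- of_real s * S) * S = - of_real (s * (cmod S)\<^sup>2)"
        using complex_norm_square[of S] by (simp add: mult.commute[of S] mult.assoc)
      then have "0 \<le> Q - 2 * (s * (cmod S)\<^sup>2)"
        using main[of "- of_real s * S"] True by (simp del: of_real_mult of_real_power)
      also have "s * (cmod S)\<^sup>2 = Q + 1" using pos by (simp add: s_def)
      finally show False using Q0 by simp
    qed
    then show ?thesis using True by simp
  next
    case False
    then have dp: "d > 0" using d by simp
    \<comment> \<open>The weight -S/d is the minimizer of the quadratic.\<close>
    have "cnj (- S / of_real d) * S = - of_real ((cmod S)\<^sup>2 / d)"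
      using complex_norm_square[of S] by (simp add: mult.commute[of S])
    then have "0 \<le> Q - 2 * ((cmod S)\<^sup>2 / d) + (cmod S)\<^sup>2 / d"
      using main[of "- S / of_real d"] dp by (simp add: norm_divide power_divide power2_eq_square del: of_real_divide)
    then show ?thesis using dp by (simp add: field_simps)
  qed
  then show ?thesis by (simp add: S_def Q_def d_def)
qed

lemma psd_entry_bound: "psd A \<Longrightarrow> (cmod (A p q))\<^sup>2 \<le> Re (A p p) * Re (A q q)"
  using psd_cauchy_schwarz[of A, where n = 1 and z = "\<lambda>_. 1" and p = "\<lambda>_. p" and r = q] by simp

text \<open>The junk value x/0 = 0 is harmless in the Schur complement, since a vanishing diagonal entry
  of a positive kernel forces its row to vanish.\<close>

definition schur :: "('i \<Rightarrow> 'i \<Rightarrow> complex) \<Rightarrow> 'i \<Rightarrow> 'i \<Rightarrow> 'i \<Rightarrow> complex" where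
  "schur A r p q = A p q - A p r * A r q / A r r"

text \<open>The subtracted rank-one form takes the value |S|^2/d, and
  \<open>psd_cauchy_schwarz\<close> says exactly that this does not exceed the original
  form.\<close>

lemma psd_schur:
  assumes "psd A" shows "psd (schur A r)"
  unfolding psd_def
proof (intro conjI allI)
  show "schur A r q p = cnj (schur A r p q)" for p q
    unfolding schur_def
    using psd_herm[OF assms, of q p] psd_herm[OF assms, of q r] psd_herm[OF assms, of r p] psd_herm[OF assms, of r r]
    by (simp add: mult_ac)
  fix n :: nat and p z
  define S where "S = (\<Sum>a<n. z a * A (p a) r)"
  define Q where "Q = (\<Sum>a<n. \<Sum>b<n. z a * cnj (z b) * A (p a) (p b))"
  define d where "d = Re (A r r)"
  have d: "A r r = of_real d" "d \<ge> 0" using psd_diag[OF assms, of r] by (auto simp: d_def)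
  have S': "cnj S = (\<Sum>b<n. cnj (z b) * A r (p b))"
    unfolding S_def by (simp add: psd_herm[OF assms, of r])
  have "(\<Sum>a<n. \<Sum>b<n. z a * cnj (z b) * schur A r (p a) (p b))
     = Q - (\<Sum>a<n. \<Sum>b<n. (z a * A (p a) r) * (cnj (z b) * A r (p b))) / A r r"
    by (simp add: Q_def schur_def algebra_simps sum_subtractf sum_divide_distrib)
  also have "\<dots> = Q - of_real ((cmod S)\<^sup>2 / d)"
    unfolding d(1) of_real_divide complex_norm_square S' by (simp only: S_def sum_product)
  finally have eq: "Re (\<Sum>a<n. \<Sum>b<n. z a * cnj (z b) * schur A r (p a) (p b)) = Re Q - (cmod S)\<^sup>2 / d"
    by simp
  have cs: "(cmod S)\<^sup>2 \<le> Re Q * d"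
    unfolding S_def Q_def d_def by (rule psd_cauchy_schwarz[OF assms])
  have "0 \<le> Re Q" unfolding Q_def by (rule psd_pos[OF assms])
  then have "(cmod S)\<^sup>2 / d \<le> Re Q" using cs d(2) by (cases "d = 0") (auto simp: divide_le_eq)
  then show "0 \<le> Re (\<Sum>a<n. \<Sum>b<n. z a * cnj (z b) * schur A r (p a) (p b))"
    using eq by simp
qed

lemma schur_row:
  assumes "psd A" shows "schur A r r q = 0" "schur A r p r = 0"
proof -
  have "A r q = 0 \<and> A p r = 0" if "A r r = 0"
    using psd_entry_bound[OF assms, of r q] psd_entry_bound[OF assms, of p r] that by simp
  then show "schur A r r q = 0" "schur A r p r = 0" by (auto simp: schur_def)
qed

text \<open>Cholesky elimination of the points 0, ..., n-1 one after another.\<close>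

primrec schur_iter :: "(nat \<Rightarrow> nat \<Rightarrow> complex) \<Rightarrow> nat \<Rightarrow> nat \<Rightarrow> nat \<Rightarrow> complex" where
  "schur_iter A 0 = A"
| "schur_iter A (Suc n) = schur (schur_iter A n) n"

lemma psd_schur_iter: "psd A \<Longrightarrow> psd (schur_iter A n)"
  by (induction n) (auto intro: psd_schur)

lemma schur_iter_zero: "psd A \<Longrightarrow> p < n \<or> q < n \<Longrightarrow> schur_iter A n p q = 0"
proof (induction n arbitrary: p q)
  case (Suc n)
  show ?case
  proof (cases "p = n \<or> q = n")
    case True
    then show ?thesis using schur_row[OF psd_schur_iter[OF Suc.prems(1)]] by auto
  next
    case False
    then have "p < n \<or> q < n" using Suc.prems by auto
    then show ?thesis using Suc.IH[OF Suc.prems(1)] by (auto simp: schur_def)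
  qed
qed simp

text \<open>Cholesky factorization: \<open>L\<close> is lower triangular, so each \<open>v p\<close>
  is a finite combination of the \<open>e n\<close> and no question of convergence arises. The Gram
  entries come out as a telescoping sum of elimination steps that has reached 0 once both indices
  are eliminated.\<close>

lemma psd_realization_nat:
  assumes e: "orthonormal (e :: nat \<Rightarrow> 'h::chilbert)" and A: "psd (A :: nat \<Rightarrow> nat \<Rightarrow> complex)"
  obtains v :: "nat \<Rightarrow> 'h::chilbert" where "\<And>p q. cinner (v p) (v q) = A p q"
proof -
  define L where "L p n = schur_iter A n p n / of_real (sqrt (Re (schur_iter A n n n)))" for p n
  have L0: "L p n = 0" if "p < n" for p n
    using schur_iter_zero[OF A, of p n n] that by (simp add: L_def)
  \<comment> \<open>One elimination step removes exactly the n-th rank-one term; with a vanishing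
    pivot both sides are 0 because x/0 = 0.\<close>
  have LL: "L p n * cnj (L q n) = schur_iter A n p q - schur_iter A (Suc n) p q" for p q n
  proof -
    note P = psd_schur_iter[OF A, of n]
    have "of_real (sqrt (Re (schur_iter A n n n))) * of_real (sqrt (Re (schur_iter A n n n))) = schur_iter A n n n"
      using psd_diag[OF P, of n] by (simp flip: of_real_mult)
    then show ?thesis
      using psd_herm[OF P, of q n] by (simp add: L_def schur_def)
  qed
  define v where "v p = (\<Sum>n\<le>p. scaleC (L p n) (e n))" for p
  have v: "v p = (\<Sum>n\<le>N. scaleC (L p n) (e n))" if "p \<le> N" for p N
    unfolding v_def using that by (intro sum.mono_neutral_left) (auto simp: L0)
  have "cinner (v p) (v q) = A p q" for p q
  proof -
    define N where "N = max p q"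
    have "cinner (v p) (v q) = (\<Sum>n\<le>N. \<Sum>m\<le>N. L p n * cnj (L q m) * cinner (e n) (e m))"
    proof -
      have "p \<le> N" "q \<le> N" by (auto simp: N_def)
      from this[THEN v] show ?thesis
        by (simp only: cinner.sum_left cinner.sum_right cinner_scaleC_left cinner_scaleC_right sum_distrib_left)
          (subst sum.swap, simp add: mult_ac)
    qed
    also have "\<dots> = (\<Sum>n\<le>N. \<Sum>m\<le>N. if m = n then L p n * cnj (L q m) else 0)"
      using e by (intro sum.cong) (auto simp: orthonormal_def)
    also have "\<dots> = (\<Sum>n\<le>N. L p n * cnj (L q n))"
      by (intro sum.cong) auto
    also have "\<dots> = (\<Sum>n<Suc N. schur_iter A n p q - schur_iter A (Suc n) p q)"
      by (simp only: LL lessThan_Suc_atMost)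
    also have "\<dots> = A p q - schur_iter A (Suc N) p q"
      by (subst sum_lessThan_telescope') simp
    also have "schur_iter A (Suc N) p q = 0"
      by (rule schur_iter_zero[OF A]) (auto simp: N_def)
    finally show ?thesis by simp
  qed
  then show ?thesis using that by blast
qed

text \<open>The decoding \<open>from_nat\<close> need not be injective; stability of
  \<open>psd\<close> under arbitrary pullbacks takes care of repeated points.\<close>

lemma psd_realization:
  assumes e: "orthonormal (e :: nat \<Rightarrow> 'h::chilbert)" and A: "psd (A :: 'i::countable \<Rightarrow> 'i \<Rightarrow> complex)"
  obtains v :: "'i::countable \<Rightarrow> 'h::chilbert" where "\<And>p q. cinner (v p) (v q) = A p q"
proof -
  obtain w :: "nat \<Rightarrow> 'h" where "\<And>p q. cinner (w p) (w q) = A (from_nat p) (from_nat q)"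
    using psd_realization_nat[OF e psd_pullback[OF A, of from_nat]] by blast
  then show ?thesis by (intro that[of "\<lambda>p. w (to_nat p)"]) simp
qed

section \<open>Unitary extension of Gram-preserving maps\<close>

text \<open>Values of \<open>U\<close> are determined by their inner products with the range of
  \<open>U\<close>, which is the whole space; this already forces linearity. The adjoint is a
  definite description, so it has to be identified with \<open>inv U\<close> by uniqueness before
  anything can be said about \<open>cadjoint U\<close>.\<close>

lemma surjective_isometry:
  fixes U :: "'h::chilbert \<Rightarrow> 'h"
  assumes iso: "\<And>x y. cinner (U x) (U y) = cinner x y" and surj: "surj U"
  shows "bounded_clinear_op U" and "unitary_op U"
    and "cadjoint U (U x) = x" and "U (cadjoint U x) = x"
proof -
  have eqI: "x = y" if "\<And>z. cinner x (U z) = cinner y (U z)" for x y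
    by (rule cinner_eqI) (metis that surj cinner_commute surjD)
  have norm: "norm (U x) = norm x" for x
    using iso[of x x] Re_cinner_self[of x] Re_cinner_self[of "U x"] by simp
  have lin: "U (x + y) = U x + U y" "U (scaleC c x) = scaleC c (U x)" for x y c
    by (rule eqI; simp add: iso cinner_add_left cinner_scaleC_left)+
  show U: "bounded_clinear_op U"
    unfolding bounded_clinear_op_def
    by (intro conjI allI bounded_linear_intro[of _ 1]) (auto simp: lin norm scaleR_scaleC)
  have inj: "inj U"
    by (rule injI) (metis iso cinner_eqI)
  have adj: "cinner (U x) y = cinner x (inv U y)" for x y
    using iso[of x "inv U y"] surj_f_inv_f[OF surj, of y] by simp
  have cadj: "cadjoint U = inv U"
    unfolding cadjoint_def
  proof (rule the_equality)
    fix S assume "\<forall>x y. cinner (U x) y = cinner x (S y)"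
    then have "cinner x (S y) = cinner x (inv U y)" for x y using adj by simp
    then show "S = inv U" by (intro ext cinner_eqI)
  qed (simp add: adj)
  show "cadjoint U (U x) = x" "U (cadjoint U x) = x" for x
    using inj surj by (simp_all add: cadj surj_f_inv_f)
  then show "unitary_op U" using U by (simp add: unitary_op_def fun_eq_iff)
qed

text \<open>Equal norms make the second components Cauchy whenever the first ones are. The statement
  is symmetric in \<open>f\<close> and \<open>g\<close>, so it yields totality as well as
  surjectivity of a closed isometric relation.\<close>

lemma isometric_relation_limit:
  fixes f g :: "'z::real_vector \<Rightarrow> 'h::banach"
  assumes S: "subspace S" "linear f" "linear g" "\<And>z. z \<in> S \<Longrightarrow> norm (f z) = norm (g z)"
    and x: "x \<in> closure (f ` S)"
  obtains Z y where "\<And>n. Z n \<in> S" "(\<lambda>n. f (Z n)) \<longlonglongrightarrow> x" "(\<lambda>n. g (Z n)) \<longlonglongrightarrow> y"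
proof -
  obtain X where X: "\<And>n. X n \<in> f ` S" "X \<longlonglongrightarrow> x" using x unfolding closure_sequential by blast
  then have "\<forall>n. \<exists>z. z \<in> S \<and> X n = f z" by blast
  then obtain Z where Z: "\<And>n. Z n \<in> S" "\<And>n. X n = f (Z n)" by metis
  have "dist (g (Z m)) (g (Z n)) = dist (f (Z m)) (f (Z n))" for m n
    using S(4)[OF subspace_diff[OF S(1) Z(1) Z(1)], of m n]
    by (simp add: dist_norm linear_diff[OF S(2)] linear_diff[OF S(3)])
  moreover have fX: "(\<lambda>n. f (Z n)) \<longlonglongrightarrow> x" using X(2) Z(2) by (simp add: LIMSEQ_def)
  then have "Cauchy (\<lambda>n. f (Z n))" by (rule LIMSEQ_imp_Cauchy)
  ultimately have "Cauchy (\<lambda>n. g (Z n))" by (simp add: Cauchy_def)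
  then show ?thesis using that[OF Z(1) fX] Cauchy_convergent convergent_def by blast
qed

text \<open>The operator is obtained as a graph, the closed linear hull \<open>R\<close> of the
  prescribed pairs. Equality of inner products is additive and continuous in each argument, so it
  passes to \<open>R\<close>; it makes \<open>R\<close> single-valued, and density of domain and
  range makes it total and onto. No well-definedness check on linear combinations is
  required.\<close>

lemma gram_relation_unitary:
  fixes \<Gamma> :: "('h::chilbert \<times> 'h) set"
  assumes gram: "\<And>x y x' y'. (x, y) \<in> \<Gamma> \<Longrightarrow> (x', y') \<in> \<Gamma> \<Longrightarrow> cinner x x' = cinner y y'"
    and dom: "closure (span (fst ` \<Gamma>)) = UNIV" and ran: "closure (span (snd ` \<Gamma>)) = UNIV"
  obtains U where "unitary_op U" "\<And>x. U (cadjoint U x) = x" "\<And>x. cadjoint U (U x) = x"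
    "\<And>x y. cinner (U x) (U y) = cinner x y" "\<And>x y. (x, y) \<in> \<Gamma> \<Longrightarrow> U x = y"
proof -
  define R where "R = closure (span \<Gamma>)"
  \<comment> \<open>The pairs compatible with \<open>z\<close> form a closed subspace. The hull is
    therefore reached one argument at a time: first \<Gamma> against \<open>R\<close>, then, by
    symmetry, \<open>R\<close> against \<open>R\<close>.\<close>
  define G where "G z = {z' :: 'h \<times> 'h. cinner (fst z) (fst z') = cinner (snd z) (snd z')}" for z
  have subG: "subspace (G z)" "closed (G z)" for z
  proof -
    show "subspace (G z)"
      by (auto simp: G_def subspace_def cinner_add_right cinner.scaleR_right cinner.zero_right)
    show "closed (G z)" unfolding G_def
      by (intro closed_Collect_eq continuous_intros cinner.continuous_on)
  qed
  have Gsym: "z' \<in> G z \<longleftrightarrow> z \<in> G z'" for z z'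
    unfolding G_def by (metis (mono_tags, lifting) cinner_commute mem_Collect_eq)
  have "R \<subseteq> G z" if "z \<in> \<Gamma>" for z
  proof -
    have "\<Gamma> \<subseteq> G z" using gram that by (auto simp: G_def)
    then show ?thesis unfolding R_def using subG[of z] by (intro closure_minimal span_minimal)
  qed
  then have "\<Gamma> \<subseteq> G z" if "z \<in> R" for z using Gsym that by blast
  then have R: "R \<subseteq> G z" if "z \<in> R" for z
    unfolding R_def using subG[of z] that by (intro closure_minimal span_minimal) (auto simp: R_def)
  have gramR: "cinner x x' = cinner y y'" if "(x, y) \<in> R" "(x', y') \<in> R" for x y x' y'
    using R[OF that(1)] that(2) by (auto simp: G_def)
  have nrm: "norm (fst z) = norm (snd z)" if "z \<in> span \<Gamma>" for z
  proof -
    have "z \<in> R" using that closure_subset by (auto simp: R_def)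
    then show ?thesis
      using gramR[of "fst z" "snd z" "fst z" "snd z"] Re_cinner_self[of "fst z"] Re_cinner_self[of "snd z"] by simp
  qed
  have lin: "linear (fst :: 'h \<times> 'h \<Rightarrow> 'h)" "linear (snd :: 'h \<times> 'h \<Rightarrow> 'h)"
    by (auto intro: bounded_linear.linear bounded_linear_fst bounded_linear_snd)
  have lim: "(x, y) \<in> R" if "\<And>n. Z n \<in> span \<Gamma>" "(\<lambda>n. fst (Z n)) \<longlonglongrightarrow> x" "(\<lambda>n. snd (Z n)) \<longlonglongrightarrow> y" for Z x y
    unfolding R_def closure_sequential
    by (rule exI[of _ Z]) (use that tendsto_Pair[OF that(2,3)] in auto)
  have ex: "\<exists>y. (x, y) \<in> R" for x
  proof -
    have "x \<in> closure (fst ` span \<Gamma>)" using dom by (simp add: linear_span_image[OF lin(1)])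
    from isometric_relation_limit[OF subspace_span lin nrm this] show ?thesis
      using lim by metis
  qed
  have ex2: "\<exists>x. (x, y) \<in> R" for y
  proof -
    have "y \<in> closure (snd ` span \<Gamma>)" using ran by (simp add: linear_span_image[OF lin(2)])
    from isometric_relation_limit[OF subspace_span lin(2,1) nrm[symmetric] this] show ?thesis
      using lim by metis
  qed
  have uniq: "y = y'" if "(x, y) \<in> R" "(x, y') \<in> R" for x y y'
  proof -
    \<comment> \<open>Expanded, this is a combination of Gram entries that equals the squared norm
      of x - x.\<close>
    have "(norm (y - y'))\<^sup>2 = 0"
      using gramR[OF that(1,1)] gramR[OF that(1,2)] gramR[OF that(2,1)] gramR[OF that(2,2)]
      by (simp add: Re_cinner_self[symmetric] cinner.diff_left cinner.diff_right)
    then show ?thesis by simp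
  qed
  obtain U where U: "\<And>x. (x, U x) \<in> R" using ex by metis
  have iso: "cinner (U x) (U y) = cinner x y" for x y using gramR[OF U U] by simp
  have surj: "surj U"
  proof (rule surjI)
    show "U (SOME x. (x, y) \<in> R) = y" for y
      using uniq[OF U] someI_ex[OF ex2[of y]] by blast
  qed
  have "\<Gamma> \<subseteq> R" unfolding R_def by (rule order_trans[OF span_superset closure_subset])
  then have "U x = y" if "(x, y) \<in> \<Gamma>" for x y using uniq[OF U] that by blast
  then show ?thesis
    using that[OF surjective_isometry(2)[OF iso surj] surjective_isometry(4,3)[OF iso surj] iso] by blast
qed

text \<open>Equal Gram matrices alone give an isometry between two closed spans, whose complements
  might have different dimensions. With equal ranges the two spans coincide, and the identity on the
  common complement completes the map to a unitary.\<close>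

lemma unitary_of_equal_gram:
  fixes v w :: "'i \<Rightarrow> 'h::chilbert"
  assumes gram: "\<And>p q. cinner (v p) (v q) = cinner (w p) (w q)" and ran: "range v = range w"
  obtains U where "unitary_op U" "\<And>x. U (cadjoint U x) = x" "\<And>x. cadjoint U (U x) = x"
    "\<And>x y. cinner (U x) (U y) = cinner x y" "\<And>p. U (v p) = w p"
proof -
  \<comment> \<open>Complex multiples are included because \<open>span\<close> is real; the second
    part is the identity on the orthogonal complement.\<close>
  define \<Gamma> where "\<Gamma> = {(scaleC c (v p), scaleC c (w p)) |c p. True} \<union> {(q, q) |q. \<forall>p. cinner q (v p) = 0}"
  have img: "fst ` \<Gamma> = {scaleC c x |c x. x \<in> range v} \<union> {q. \<forall>p. cinner q (v p) = 0}"
       "snd ` \<Gamma> = fst ` \<Gamma>"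
  proof -
    show 1: "fst ` \<Gamma> = {scaleC c x |c x. x \<in> range v} \<union> {q. \<forall>p. cinner q (v p) = 0}"
      unfolding \<Gamma>_def by (force simp: image_iff)
    have "snd ` \<Gamma> = {scaleC c x |c x. x \<in> range w} \<union> {q. \<forall>p. cinner q (v p) = 0}"
      unfolding \<Gamma>_def by (force simp: image_iff)
    then show "snd ` \<Gamma> = fst ` \<Gamma>" using 1 ran by simp
  qed
  have dense: "closure (span (fst ` \<Gamma>)) = UNIV"
  proof (intro equalityI subsetI UNIV_I)
    fix x :: 'h
    define M where "M = closure (cspan (range v))"
    have "csubspace M" "closed M" by (auto simp: M_def csubspace_closure csubspace_cspan)
    from orthogonal_decomposition[OF this, of x] obtain p where
      p: "p \<in> M" "\<And>y. y \<in> M \<Longrightarrow> cinner (x - p) y = 0" by blast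
    have "v i \<in> M" for i
      using closure_subset cspan_superset[of "v i" "range v"] by (auto simp: M_def)
    then have "x - p \<in> fst ` \<Gamma>" using p(2) unfolding img(1) by blast
    then have "x - p \<in> closure (span (fst ` \<Gamma>))" by (intro subsetD[OF closure_subset] span_base)
    moreover have "M \<subseteq> closure (span (fst ` \<Gamma>))"
      unfolding M_def cspan_def by (intro closure_mono span_mono) (auto simp: img(1))
    then have "p \<in> closure (span (fst ` \<Gamma>))" using p(1) by blast
    ultimately show "x \<in> closure (span (fst ` \<Gamma>))"
      using subspace_add[OF subspace_closure[OF subspace_span], of "x - p" "fst ` \<Gamma>" p] by simp
  qed
  have w0: "(\<forall>p. cinner q (v p) = 0) \<Longrightarrow> cinner q (w p) = 0 \<and> cinner (w p) q = 0" for q p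
    by (metis cinner_commute complex_cnj_zero ran rangeE rangeI)
  have v0: "(\<forall>p. cinner q (v p) = 0) \<Longrightarrow> cinner (v p) q = 0" for q p
    by (metis cinner_commute complex_cnj_zero)
  have "cinner x x' = cinner y y'" if h: "(x, y) \<in> \<Gamma>" "(x', y') \<in> \<Gamma>" for x y x' y'
  proof -
    have *: "(\<exists>c p. x = scaleC c (v p) \<and> y = scaleC c (w p)) \<or> x = y \<and> (\<forall>p. cinner x (v p) = 0)"
      if "(x, y) \<in> \<Gamma>" for x y
      using that unfolding \<Gamma>_def by blast
    from *[OF h(1)] *[OF h(2)] show ?thesis
    proof (elim disjE exE conjE)
      fix c p d q
      assume "x = scaleC c (v p)" "y = scaleC c (w p)" "x' = scaleC d (v q)" "y' = scaleC d (w q)"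
      then show ?thesis by (simp only: cinner_scaleC_left cinner_scaleC_right gram)
    next
      fix c p
      assume "x = scaleC c (v p)" "y = scaleC c (w p)" "x' = y'" "\<forall>p. cinner x' (v p) = 0"
      then show ?thesis by (simp add: cinner_scaleC_left v0 w0)
    next
      fix c p
      assume "x = y" "\<forall>p. cinner x (v p) = 0" "x' = scaleC c (v p)" "y' = scaleC c (w p)"
      then show ?thesis by (simp add: cinner_scaleC_right w0)
    qed simp
  qed
  from gram_relation_unitary[OF this dense dense[folded img(2)]]
  obtain U where U: "unitary_op U" "\<And>x. U (cadjoint U x) = x" "\<And>x. cadjoint U (U x) = x"
    "\<And>x y. cinner (U x) (U y) = cinner x y" "\<And>x y. (x, y) \<in> \<Gamma> \<Longrightarrow> U x = y" by blast
  have "(v p, w p) \<in> \<Gamma>" for p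
    unfolding \<Gamma>_def by (rule UnI1) (force intro: exI[of _ 1] simp: scaleC_one)
  then show ?thesis using that[OF U(1-4)] U(5) by blast
qed

section \<open>The ellipse and the functional calculus of diagonalizable operators\<close>

definition skew :: "real \<Rightarrow> complex \<Rightarrow> complex" where
  "skew \<delta> z = cnj z - of_real \<delta> * z"

text \<open>In coordinates, \<open>skew\<close> has real part (1-\<delta>)x and imaginary part
  -(1+\<delta>)y, and 1-\<delta>^2 is the product of the two factors. The ellipse becomes the
  preimage of a disc under a real-linear map, which gives convexity and a linear gauge for distances
  to the boundary.\<close>

lemma G_delta_iff:
  assumes "0 < \<delta>" "\<delta> < 1"
  shows "z \<in> G_delta \<delta> \<longleftrightarrow> cmod (skew \<delta> z) < 1 - \<delta>\<^sup>2"
proof -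
  have pos: "1 - \<delta>\<^sup>2 > 0" using assms by (simp add: power_less_one_iff)
  have "(cmod (skew \<delta> z))\<^sup>2 = ((1 - \<delta>) * Re z)\<^sup>2 + ((1 + \<delta>) * Im z)\<^sup>2"
    unfolding cmod_power2 skew_def by (simp add: algebra_simps power2_eq_square)
  moreover have "(Re z)\<^sup>2 / (1 + \<delta>)\<^sup>2 + (Im z)\<^sup>2 / (1 - \<delta>)\<^sup>2
      = (((1 - \<delta>) * Re z)\<^sup>2 + ((1 + \<delta>) * Im z)\<^sup>2) / (1 - \<delta>\<^sup>2)\<^sup>2"
  proof -
    have *: "1 - \<delta>\<^sup>2 = (1 + \<delta>) * (1 - \<delta>)" by (simp add: algebra_simps power2_eq_square)
    show ?thesis using assms
      unfolding * power_mult_distrib by (simp add: add_divide_distrib)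
  qed
  ultimately have "(Re z)\<^sup>2 / (1 + \<delta>)\<^sup>2 + (Im z)\<^sup>2 / (1 - \<delta>)\<^sup>2 = (cmod (skew \<delta> z))\<^sup>2 / (1 - \<delta>\<^sup>2)\<^sup>2"
    by simp
  moreover have "(cmod (skew \<delta> z))\<^sup>2 / (1 - \<delta>\<^sup>2)\<^sup>2 < 1 \<longleftrightarrow> cmod (skew \<delta> z) < 1 - \<delta>\<^sup>2"
    using pos power_mono_iff[of "1 - \<delta>\<^sup>2" "cmod (skew \<delta> z)" 2]
    by (simp add: divide_less_eq not_le[symmetric])
  ultimately show ?thesis by (simp add: G_delta_def)
qed

lemma bounded_linear_skew: "bounded_linear (skew \<delta>)"
  unfolding skew_def
  by (intro bounded_linear_sub bounded_linear_cnj bounded_linear_mult_right)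

lemma convex_skew_ball: "convex {z. cmod (skew \<delta> z) < r}"
proof -
  have "{z. cmod (skew \<delta> z) < r} = skew \<delta> -` ball 0 r" by auto
  then show ?thesis
    using convex_linear_vimage[OF bounded_linear.linear[OF bounded_linear_skew] convex_ball] by simp
qed

lemma convex_G_delta:
  assumes "0 < \<delta>" "\<delta> < 1" shows "convex (G_delta \<delta>)"
proof -
  have "G_delta \<delta> = {z. cmod (skew \<delta> z) < 1 - \<delta>\<^sup>2}" using G_delta_iff[OF assms] by blast
  then show ?thesis by (simp add: convex_skew_ball)
qed

lemma open_G_delta: "open (G_delta \<delta>)"
  unfolding G_delta_def divide_inverse by (intro open_Collect_less continuous_intros)

text \<open>The Dunford operator is described through all admissible contours, so one must exist
  before the description determines anything. The contour is a level curve of |skew|, close enough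
  to the boundary to enclose \<open>K\<close>.\<close>

lemma ellipse_contour:
  assumes \<delta>: "0 < \<delta>" "\<delta> < 1" and K: "finite K" "K \<subseteq> G_delta \<delta>"
  obtains \<gamma> where "valid_path \<gamma>" "pathfinish \<gamma> = pathstart \<gamma>" "path_image \<gamma> \<subseteq> G_delta \<delta> - K"
    "\<And>w. w \<in> K \<Longrightarrow> winding_number \<gamma> w = 1" "\<And>w. w \<notin> G_delta \<delta> \<Longrightarrow> winding_number \<gamma> w = 0"
proof -
  define \<kappa> where "\<kappa> = 1 - \<delta>\<^sup>2"
  have \<kappa>: "\<kappa> > 0" using \<delta> by (simp add: \<kappa>_def power_less_one_iff)
  \<comment> \<open>The extra 0 covers empty \<open>K\<close> and forces the intermediate value
    \<open>m\<close>, hence the radius, to be positive.\<close>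
  have "Max (insert 0 ((\<lambda>w. cmod (skew \<delta> w)) ` K)) < \<kappa>"
    using K \<kappa> G_delta_iff[OF \<delta>] by (auto simp: \<kappa>_def)
  then obtain m where m: "Max (insert 0 ((\<lambda>w. cmod (skew \<delta> w)) ` K)) < m" "m < \<kappa>"
    using dense by blast
  define r where "r = m / \<kappa>"
  have r: "0 < r" "r < 1" "\<And>w. w \<in> K \<Longrightarrow> cmod (skew \<delta> w) < r * \<kappa>"
    using m K(1) \<kappa> by (auto simp: r_def)
  define c where "c = circlepath 0 r"
  have cr: "cmod (c t) = r" for t using r by (simp add: c_def circlepath norm_mult)
  \<comment> \<open>A Joukowski map: on the circle of radius \<open>r\<close> it equals z + \<delta>
    cnj z, whose \<open>skew\<close> is \<kappa> cnj z of constant modulus. The rational form is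
    holomorphic off 0, which makes the image a valid path.\<close>
  define \<phi> where "\<phi> = (\<lambda>z::complex. z + of_real (\<delta> * r\<^sup>2) / z)"
  define \<gamma> where "\<gamma> = \<phi> \<circ> c"
  have \<gamma>: "\<gamma> t = c t + of_real \<delta> * cnj (c t)" for t
  proof -
    have "c t \<noteq> 0" using cr[of t] r by auto
    moreover have "of_real (r\<^sup>2) = c t * cnj (c t)" using complex_norm_square[of "c t"] cr[of t] by simp
    ultimately show ?thesis by (simp add: \<gamma>_def \<phi>_def)
  qed
  have skew: "cmod (skew \<delta> (\<gamma> t)) = r * \<kappa>" for t
  proof -
    have "skew \<delta> (\<gamma> t) = of_real \<kappa> * cnj (c t)"
      by (simp add: skew_def \<gamma> \<kappa>_def algebra_simps power2_eq_square)
    then show ?thesis using cr[of t] \<kappa> by (simp add: norm_mult)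
  qed
  have c: "valid_path c" "path_image c \<subseteq> - {0}" "pathfinish c = pathstart c"
    using r by (auto simp: c_def)
  have vp: "valid_path \<gamma>"
    unfolding \<gamma>_def
    by (rule valid_path_compose_holomorphic[OF c(1) _ _ c(2)]) (auto simp: \<phi>_def intro!: holomorphic_intros)
  have loop: "pathfinish \<gamma> = pathstart \<gamma>" using c(3) by (simp add: \<gamma>_def pathfinish_def pathstart_def)
  define S where "S = {z. cmod (skew \<delta> z) < r * \<kappa>}"
  have conn: "connected S" unfolding S_def by (rule convex_connected[OF convex_skew_ball])
  have disj: "S \<inter> path_image \<gamma> = {}" by (auto simp: S_def path_image_def skew)
  \<comment> \<open>The segment from c to c + \<delta> cnj c consists of points c + u\<delta> cnj c
    with u\<delta> < 1, so it misses 0 and the winding number of the circle carries over.\<close>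
  have "homotopic_loops (-{0}) c \<gamma>"
  proof (rule homotopic_loops_linear)
    show "closed_segment (c t) (\<gamma> t) \<subseteq> - {0}" for t
    proof
      fix z assume "z \<in> closed_segment (c t) (\<gamma> t)"
      then obtain u where u: "0 \<le> u" "u \<le> 1" "z = (1 - u) *\<^sub>R c t + u *\<^sub>R \<gamma> t"
        by (auto simp: in_segment)
      have "u * \<delta> \<le> \<delta>" using u \<delta> mult_left_le_one_le[of \<delta> u] by simp
      then have "u * \<delta> < 1" using \<delta> by linarith
      then have "cmod (of_real (u * \<delta>) * cnj (c t)) < cmod (c t)"
        using cr[of t] r \<delta> u by (simp add: norm_mult abs_mult)
      moreover have "z = c t + of_real (u * \<delta>) * cnj (c t)"
        by (simp add: u \<gamma> scaleR_conv_of_real algebra_simps)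
      ultimately show "z \<in> - {0}"
        using norm_diff_ineq[of "c t" "of_real (u * \<delta>) * cnj (c t)"] by auto
    qed
  qed (use c vp loop valid_path_imp_path in auto)
  then have "winding_number \<gamma> 0 = winding_number c 0"
    by (metis winding_number_homotopic_loops)
  also have "\<dots> = 1" unfolding c_def using r(1) by (rule winding_number_circlepath_centre)
  finally have w0: "winding_number \<gamma> 0 = 1" .
  have w1: "winding_number \<gamma> w = 1" if "w \<in> S" for w
  proof -
    have "0 \<in> S" using r \<kappa> by (simp add: S_def skew_def)
    then have "winding_number \<gamma> w = winding_number \<gamma> 0"
      using winding_number_eq[OF valid_path_imp_path[OF vp] loop that _ conn disj] by blast
    then show ?thesis using w0 by simp
  qed
  have KS: "K \<subseteq> S" using r by (auto simp: S_def)
  have im: "path_image \<gamma> \<subseteq> G_delta \<delta>"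
    using \<kappa> r by (auto simp: path_image_def G_delta_iff[OF \<delta>] skew simp flip: \<kappa>_def)
  show ?thesis
  proof (rule that[OF vp loop])
    show "path_image \<gamma> \<subseteq> G_delta \<delta> - K" using im KS disj by blast
    show "winding_number \<gamma> w = 1" if "w \<in> K" for w using w1 KS that by blast
    show "winding_number \<gamma> w = 0" if "w \<notin> G_delta \<delta>" for w
      by (rule winding_number_zero_outside[OF valid_path_imp_path[OF vp] convex_G_delta[OF \<delta>] loop that im])
  qed
qed

section \<open>Vector-valued contour integrals and diagonalizable operators\<close>

lemma has_vcontour_integral_scaleC:
  assumes "(h has_contour_integral I) \<gamma>"
  shows "has_vcontour_integral (\<lambda>z. scaleC (h z) (x::'h::chilbert)) (scaleC I x) \<gamma>"
  using has_integral_linear[OF assms[unfolded has_contour_integral_def] scaleC.bounded_linear_left[of x]]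
  unfolding has_vcontour_integral_def by (simp add: o_def scaleC_scaleC mult.commute)

lemma has_vcontour_integral_cong:
  "has_vcontour_integral g I \<gamma> \<Longrightarrow> (\<And>z. z \<in> path_image \<gamma> \<Longrightarrow> h z = g z) \<Longrightarrow>
    has_vcontour_integral h I \<gamma>"
  unfolding has_vcontour_integral_def path_image_def by (elim has_integral_eq[rotated]) simp

lemma has_vcontour_integral_add:
  "has_vcontour_integral g I \<gamma> \<Longrightarrow> has_vcontour_integral h J \<gamma> \<Longrightarrow>
    has_vcontour_integral (\<lambda>z. g z + h z) (I + J) \<gamma>"
  unfolding has_vcontour_integral_def by (simp add: scaleC_add_right has_integral_add)

lemma has_vcontour_integral_sum:
  "finite K \<Longrightarrow> (\<And>i. i \<in> K \<Longrightarrow> has_vcontour_integral (g i) (I i) \<gamma>) \<Longrightarrow>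
    has_vcontour_integral (\<lambda>z. \<Sum>i\<in>K. g i z) (\<Sum>i\<in>K. I i) \<gamma>"
  unfolding has_vcontour_integral_def by (simp add: scaleC.sum_right has_integral_sum)

text \<open>For a biorthogonal system, \<open>diag_op n v d a\<close> has eigenvalue \<open>a i\<close> at \<open>v i\<close> and equals
  \<open>a 0\<close> on the complement, so that its spectrum consists of the values of \<open>a\<close> only.\<close>

definition diag_op :: "nat \<Rightarrow> (nat \<Rightarrow> 'h) \<Rightarrow> (nat \<Rightarrow> 'h) \<Rightarrow> (nat \<Rightarrow> complex) \<Rightarrow> 'h \<Rightarrow> 'h::chilbert" where
  "diag_op n v d a x = scaleC (a 0) x + (\<Sum>i\<le>n. scaleC ((a i - a 0) * cinner x (d i)) (v i))"

locale biorthogonal =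
  fixes n :: nat and v d :: "nat \<Rightarrow> 'h::chilbert"
  assumes biorth: "i \<le> n \<Longrightarrow> j \<le> n \<Longrightarrow> cinner (v i) (d j) = (if i = j then 1 else 0)"
begin

lemma bounded_clinear_diag_op: "bounded_clinear_op (diag_op n v d a)"
  unfolding bounded_clinear_op_def
proof (intro conjI allI)
  show "bounded_linear (diag_op n v d a)"
    unfolding diag_op_def
    by (intro bounded_linear_add bounded_linear_scaleC bounded_linear_sum
        bounded_linear_compose[OF scaleC.bounded_linear_left]
        bounded_linear_compose[OF bounded_linear_mult_right] cinner.bounded_linear_left)
  show "diag_op n v d a (scaleC c x) = scaleC c (diag_op n v d a x)" for c x
    by (simp add: diag_op_def scaleC_scaleC cinner_scaleC_left scaleC_add_right scaleC.sum_right mult_ac)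
qed

lemma diag_op_eigen:
  assumes j: "j \<le> n" shows "diag_op n v d a (v j) = scaleC (a j) (v j)"
proof -
  have "(\<Sum>i\<le>n. scaleC ((a i - a 0) * cinner (v j) (d i)) (v i)) = (\<Sum>i\<le>n. if i = j then scaleC (a j - a 0) (v j) else 0)"
    using j by (intro sum.cong) (auto simp: biorth)
  also have "\<dots> = scaleC (a j - a 0) (v j)" using j by simp
  finally show ?thesis by (simp add: diag_op_def flip: scaleC_add_left)
qed

lemma cinner_diag_op:
  assumes j: "j \<le> n" shows "cinner (diag_op n v d a x) (d j) = a j * cinner x (d j)"
proof -
  have "(\<Sum>i\<le>n. (a i - a 0) * cinner x (d i) * cinner (v i) (d j)) = (\<Sum>i\<le>n. if i = j then (a j - a 0) * cinner x (d j) else 0)"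
    using j by (intro sum.cong) (auto simp: biorth)
  also have "\<dots> = (a j - a 0) * cinner x (d j)" using j by simp
  finally show ?thesis
    by (simp add: diag_op_def cinner_add_left cinner.sum_left cinner_scaleC_left algebra_simps)
qed

text \<open>Biorthogonality makes the passage from \<open>a\<close> to
  \<open>diag_op n v d a\<close> multiplicative, so inverses and resolvents can be computed
  entrywise on \<open>a\<close>.\<close>

lemma diag_op_compose: "diag_op n v d a (diag_op n v d b x) = diag_op n v d (\<lambda>i. a i * b i) x"
proof -
  have "diag_op n v d a (diag_op n v d b x) =
      scaleC (a 0) (diag_op n v d b x) + (\<Sum>i\<le>n. scaleC ((a i - a 0) * (b i * cinner x (d i))) (v i))"
    by (subst diag_op_def) (simp add: cinner_diag_op)
  also have "\<dots> = scaleC (a 0 * b 0) x +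
     ((\<Sum>i\<le>n. scaleC (a 0 * ((b i - b 0) * cinner x (d i))) (v i)) + (\<Sum>i\<le>n. scaleC ((a i - a 0) * (b i * cinner x (d i))) (v i)))"
    by (simp add: diag_op_def scaleC_add_right scaleC.sum_right scaleC_scaleC add.assoc)
  also have "\<dots> = scaleC (a 0 * b 0) x +
     (\<Sum>i\<le>n. scaleC (a 0 * ((b i - b 0) * cinner x (d i)) + (a i - a 0) * (b i * cinner x (d i))) (v i))"
    by (simp only: sum.distrib scaleC_add_left)
  also have "\<dots> = diag_op n v d (\<lambda>i. a i * b i) x"
    unfolding diag_op_def by (simp add: algebra_simps)
  finally show ?thesis .
qed

lemma diag_op_const: "diag_op n v d (\<lambda>_. c) x = scaleC c x"
  by (simp add: diag_op_def)

lemma scaleC_minus_diag_op: "scaleC z x - diag_op n v d a x = diag_op n v d (\<lambda>i. z - a i) x"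
proof -
  have "(\<Sum>i\<le>n. scaleC ((z - a i - (z - a 0)) * cinner x (d i)) (v i)) = - (\<Sum>i\<le>n. scaleC ((a i - a 0) * cinner x (d i)) (v i))"
    by (simp add: sum_negf[symmetric] algebra_simps flip: scaleC.minus_left)
  then show ?thesis by (simp add: diag_op_def scaleC.diff_left)
qed

lemma diag_op_cong: "(\<And>i. i \<le> n \<Longrightarrow> a i = b i) \<Longrightarrow> diag_op n v d a x = diag_op n v d b x"
  by (simp add: diag_op_def)

lemma diag_op_resolvent_id:
  assumes "z \<notin> a ` {..n}"
  shows "diag_op n v d (\<lambda>i. 1 / (z - a i)) (scaleC z x - diag_op n v d a x) = x"
    and "scaleC z (diag_op n v d (\<lambda>i. 1 / (z - a i)) x) - diag_op n v d a (diag_op n v d (\<lambda>i. 1 / (z - a i)) x) = x"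
proof -
  have "z \<noteq> a i" if "i \<le> n" for i using assms that by auto
  then have "diag_op n v d (\<lambda>i. 1 / (z - a i) * (z - a i)) x = diag_op n v d (\<lambda>_. 1) x"
    "diag_op n v d (\<lambda>i. (z - a i) * (1 / (z - a i))) x = diag_op n v d (\<lambda>_. 1) x"
    by (intro diag_op_cong; simp)+
  then have eq: "diag_op n v d (\<lambda>i. 1 / (z - a i) * (z - a i)) x = x"
    "diag_op n v d (\<lambda>i. (z - a i) * (1 / (z - a i))) x = x"
    by (simp_all only: diag_op_const scaleC_one)
  show "diag_op n v d (\<lambda>i. 1 / (z - a i)) (scaleC z x - diag_op n v d a x) = x"
    unfolding scaleC_minus_diag_op diag_op_compose by (rule eq(1))
  show "scaleC z (diag_op n v d (\<lambda>i. 1 / (z - a i)) x) - diag_op n v d a (diag_op n v d (\<lambda>i. 1 / (z - a i)) x) = x"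
    unfolding scaleC_minus_diag_op[of z "diag_op n v d (\<lambda>i. 1 / (z - a i)) x"]
    unfolding diag_op_compose by (rule eq(2))
qed

lemma op_spectrum_diag_op: "op_spectrum (diag_op n v d a) = a ` {..n}"
proof (intro equalityI subsetI)
  fix z assume z: "z \<in> op_spectrum (diag_op n v d a)"
  show "z \<in> a ` {..n}"
  proof (rule ccontr)
    assume "z \<notin> a ` {..n}"
    then have "bounded_clinear_op (diag_op n v d (\<lambda>i. 1 / (z - a i))) \<and>
      (\<forall>x. diag_op n v d (\<lambda>i. 1 / (z - a i)) (scaleC z x - diag_op n v d a x) = x \<and>
        scaleC z (diag_op n v d (\<lambda>i. 1 / (z - a i)) x) - diag_op n v d a (diag_op n v d (\<lambda>i. 1 / (z - a i)) x) = x)"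
      by (simp add: diag_op_resolvent_id bounded_clinear_diag_op)
    then show False using z unfolding op_spectrum_def by blast
  qed
next
  fix z assume "z \<in> a ` {..n}"
  then obtain j where j: "j \<le> n" "z = a j" by auto
  have "v j \<noteq> 0" using biorth[OF j(1) j(1)] by (auto simp: cinner.zero_left)
  moreover have "v j = 0" if "bounded_clinear_op R" "\<And>x. R (scaleC z x - diag_op n v d a x) = x" for R
  proof -
    have "R 0 = 0" using that(1) by (simp add: bounded_clinear_op_def linear_simps)
    then show ?thesis using that(2)[of "v j"] diag_op_eigen[OF j(1), of a] j(2) by simp
  qed
  ultimately show "z \<in> op_spectrum (diag_op n v d a)" unfolding op_spectrum_def by blast
qed

lemma resolvent_diag_op:
  assumes "z \<notin> a ` {..n}"
  shows "resolvent (diag_op n v d a) z = diag_op n v d (\<lambda>i. 1 / (z - a i))"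
  unfolding resolvent_def
proof (rule the_equality)
  fix R assume "bounded_clinear_op R \<and> (\<forall>x. R (scaleC z x - diag_op n v d a x) = x \<and> scaleC z (R x) - diag_op n v d a (R x) = x)"
  then have "R (scaleC z x - diag_op n v d a x) = x" for x by blast
  then show "R = diag_op n v d (\<lambda>i. 1 / (z - a i))"
    using diag_op_resolvent_id(2)[OF assms] by (metis ext)
qed (simp add: diag_op_resolvent_id[OF assms] bounded_clinear_diag_op)

text \<open>The resolvent is a combination of fixed vectors with the scalar coefficients 1/(z - a
  i), so the vector integral reduces to Cauchy's formula at each eigenvalue, where the winding
  number is 1.\<close>

lemma dunford_diag_op:
  assumes S: "convex S" "open S" "f holomorphic_on S" "a ` {..n} \<subseteq> S"
    and ex: "\<exists>\<gamma>. admissible_contour S (diag_op n v d a) \<gamma>"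
  shows "dunford f S (diag_op n v d a) = diag_op n v d (\<lambda>i. f (a i))"
proof -
  let ?T = "diag_op n v d a"
  have int: "has_vcontour_integral (\<lambda>z. scaleC (f z / (2 * of_real pi * \<i>)) (resolvent ?T z x))
      (diag_op n v d (\<lambda>i. f (a i)) x) \<gamma>" if \<gamma>: "admissible_contour S ?T \<gamma>" for \<gamma> x
  proof -
    have \<gamma>': "valid_path \<gamma>" "pathfinish \<gamma> = pathstart \<gamma>" "path_image \<gamma> \<subseteq> S - a ` {..n}"
       "\<And>i. i \<le> n \<Longrightarrow> winding_number \<gamma> (a i) = 1"
      using \<gamma> by (auto simp: admissible_contour_def op_spectrum_diag_op)
    define g where "g z = f z / (2 * of_real pi * \<i>)" for z
    have cauchy: "((\<lambda>z. g z / (z - a i)) has_contour_integral f (a i)) \<gamma>" if "i \<le> n" for i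
    proof -
      have "((\<lambda>z. f z / (z - a i)) has_contour_integral (of_real (2 * pi) * \<i> * winding_number \<gamma> (a i) * f (a i))) \<gamma>"
        by (rule Cauchy_integral_formula_convex_simple[OF S(1,3)])
          (use that S \<gamma>' interior_open[OF S(2)] in auto)
      from has_contour_integral_div[OF this, of "of_real (2 * pi) * \<i>"] show ?thesis
        using \<gamma>'(4)[OF that] by (simp add: g_def divide_divide_eq_left mult.commute)
    qed
    have "has_vcontour_integral (\<lambda>z. scaleC (g z / (z - a 0)) x +
        (\<Sum>i\<le>n. scaleC (g z / (z - a i) - g z / (z - a 0)) (scaleC (cinner x (d i)) (v i))))
      (scaleC (f (a 0)) x + (\<Sum>i\<le>n. scaleC (f (a i) - f (a 0)) (scaleC (cinner x (d i)) (v i)))) \<gamma>"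
      by (intro has_vcontour_integral_add has_vcontour_integral_sum has_vcontour_integral_scaleC
          has_contour_integral_diff cauchy) auto
    moreover have "scaleC (g z) (resolvent ?T z x) =
        scaleC (g z / (z - a 0)) x +
        (\<Sum>i\<le>n. scaleC (g z / (z - a i) - g z / (z - a 0)) (scaleC (cinner x (d i)) (v i)))"
      if "z \<in> path_image \<gamma>" for z
    proof -
      have "z \<notin> a ` {..n}" using that \<gamma>'(3) by blast
      then show ?thesis
        by (simp add: resolvent_diag_op diag_op_def scaleC_add_right scaleC_scaleC scaleC.sum_right right_diff_distrib mult.assoc[symmetric])
    qed
    ultimately have "has_vcontour_integral (\<lambda>z. scaleC (g z) (resolvent ?T z x)) (diag_op n v d (\<lambda>i. f (a i)) x) \<gamma>"
      unfolding diag_op_def[of n v d "\<lambda>i. f (a i)"] scaleC_scaleC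
      by (rule has_vcontour_integral_cong)
    then show ?thesis unfolding g_def .
  qed
  \<comment> \<open>One contour suffices for uniqueness; without any, every \<open>A\<close> would
    satisfy the description vacuously.\<close>
  obtain \<gamma>0 where \<gamma>0: "admissible_contour S ?T \<gamma>0" using ex by blast
  show ?thesis
    unfolding dunford_def
  proof (rule the_equality)
    fix A assume "\<forall>\<gamma>. admissible_contour S ?T \<gamma> \<longrightarrow>
      (\<forall>x. has_vcontour_integral (\<lambda>z. scaleC (f z / (2 * of_real pi * \<i>)) (resolvent ?T z x)) (A x) \<gamma>)"
    then have "has_vcontour_integral (\<lambda>z. scaleC (f z / (2 * of_real pi * \<i>)) (resolvent ?T z x)) (A x) \<gamma>0" for x
      using \<gamma>0 by blast
    then show "A = diag_op n v d (\<lambda>i. f (a i))"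
      using int[OF \<gamma>0] unfolding has_vcontour_integral_def by (intro ext has_integral_unique)
  qed (simp add: int)
qed

lemma dunford_diag_op_G_delta:
  assumes \<delta>: "0 < \<delta>" "\<delta> < 1" and f: "f holomorphic_on G_delta \<delta>" "a ` {..n} \<subseteq> G_delta \<delta>"
  shows "dunford f (G_delta \<delta>) (diag_op n v d a) = diag_op n v d (\<lambda>i. f (a i))"
proof (rule dunford_diag_op[OF convex_G_delta[OF \<delta>] open_G_delta f])
  obtain \<gamma> where "valid_path \<gamma>" "pathfinish \<gamma> = pathstart \<gamma>" "path_image \<gamma> \<subseteq> G_delta \<delta> - a ` {..n}"
    "\<And>w. w \<in> a ` {..n} \<Longrightarrow> winding_number \<gamma> w = 1" "\<And>w. w \<notin> G_delta \<delta> \<Longrightarrow> winding_number \<gamma> w = 0"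
    using ellipse_contour[OF \<delta> _ f(2)] by blast
  then show "\<exists>\<gamma>. admissible_contour (G_delta \<delta>) (diag_op n v d a) \<gamma>"
    unfolding admissible_contour_def op_spectrum_diag_op by blast
qed

end

section \<open>Holomorphic solutions of the model equation\<close>

text \<open>\<open>V\<close> stands for the adjoint of \<open>U\<close> but enters as the inverse,
  which keeps the definite description \<open>cadjoint\<close> out of the calculations.\<close>

locale unitary_pencil =
  fixes \<delta> :: real and U V :: "'h::chilbert \<Rightarrow> 'h"
  assumes delta: "0 < \<delta>" "\<delta> < 1"
    and iso: "cinner (U x) (U y) = cinner x y"
    and UV: "U (V x) = x" and VU: "V (U x) = x"
begin

lemma adj: "cinner (U x) y = cinner x (V y)"
  by (metis iso UV)

lemma adj': "cinner (V x) y = cinner x (U y)"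
  by (metis iso UV)

lemma surj_U: "surj U"
  by (rule surjI[of _ V]) (rule UV)

lemma norm_U: "norm (U x) = norm x"
  using iso[of x x] Re_cinner_self[of x] Re_cinner_self[of "U x"] by simp

lemma norm_V: "norm (V x) = norm x"
  using norm_U[of "V x"] by (simp add: UV)

lemma linear_U: "U (x + y) = U x + U y" "U (scaleC c x) = scaleC c (U x)"
  "U (x - y) = U x - U y"
proof -
  have "bounded_clinear_op U" by (rule surjective_isometry(1)[OF iso surj_U])
  then show "U (x + y) = U x + U y" "U (scaleC c x) = scaleC c (U x)" "U (x - y) = U x - U y"
    by (auto simp: bounded_clinear_op_def linear_simps)
qed

lemma linear_V: "V (x + y) = V x + V y" "V (scaleC c x) = scaleC c (V x)"
  using linear_U(1)[of "V x" "V y"] linear_U(2)[of c "V x"] by (metis UV VU)+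

definition \<kappa> :: real where "\<kappa> = 1 - \<delta>\<^sup>2"

definition pencil :: "complex \<Rightarrow> complex \<Rightarrow> 'h \<Rightarrow> 'h" where
  "pencil l m x = scaleC (2 - 2 * (of_real \<delta>)\<^sup>2) x - scaleC (cnj m - of_real \<delta> * l) (U x)
      - scaleC (l - of_real \<delta> * cnj m) (V x)"

text \<open>Minus the coefficient of \<open>l\<close> in the pencil, which reads 2\<kappa> - l N -
  cnj m N* with N* = U - \<delta> V. Being affine in \<open>l\<close> and in \<open>cnj m\<close> is
  what lets the nodes be moved to a common point.\<close>

definition N :: "'h \<Rightarrow> 'h" where "N x = V x - scaleC (of_real \<delta>) (U x)"

lemma linear_N: "N (x + y) = N x + N y" "N (scaleC c x) = scaleC c (N x)"
  by (simp_all add: N_def linear_U linear_V scaleC_add_right scaleC.diff_right scaleC_scaleC mult.commute)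

lemma N_sum: "N (\<Sum>i\<in>I. scaleC (c i) (a i)) = (\<Sum>i\<in>I. scaleC (c i) (N (a i)))"
proof -
  have "N 0 = 0" using linear_N(2)[of 0 0] by simp
  then show ?thesis
    by (induction I rule: infinite_finite_induct) (simp_all add: linear_N)
qed

lemma norm_N: "norm (N x) \<le> 2 * norm x"
proof -
  have "norm (N x) \<le> norm x + \<delta> * norm x"
    unfolding N_def using norm_triangle_ineq4[of "V x" "scaleC (of_real \<delta>) (U x)"] delta
    by (simp add: norm_V norm_U norm_scaleC)
  also have "\<dots> \<le> 2 * norm x" using delta by (simp add: mult_left_le_one_le)
  finally show ?thesis .
qed

lemma cinner_pencil_expand:
  "cinner (pencil l m a) b = (2 - 2 * (of_real \<delta>)\<^sup>2) * cinner a b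
    - (cnj m - of_real \<delta> * l) * cinner (U a) b - (l - of_real \<delta> * cnj m) * cinner (V a) b"
  by (simp only: pencil_def cinner.diff_left cinner_scaleC_left)

lemma cinner_pencil:
  "cinner (pencil l m a) b = 2 * of_real \<kappa> * cinner a b - l * cinner (N a) b - cnj m * cnj (cinner (N b) a)"
proof -
  have "cnj (cinner (N b) a) = cinner a (N b)" by (rule cinner_commute[symmetric])
  also have "\<dots> = cinner (U a) b - of_real \<delta> * cinner (V a) b"
    by (simp add: N_def cinner.diff_right cinner_scaleC_right adj adj')
  finally have eq: "cnj (cinner (N b) a) = cinner (U a) b - of_real \<delta> * cinner (V a) b" .
  have eq': "cinner (N a) b = cinner (V a) b - of_real \<delta> * cinner (U a) b"
    by (simp add: N_def cinner.diff_left cinner_scaleC_left)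
  show ?thesis
    unfolding cinner_pencil_expand eq eq' by (simp add: \<kappa>_def algebra_simps)
qed

lemma pencil_coercive: "Re (cinner (pencil l l w) w) \<ge> 2 * (\<kappa> - cmod (skew \<delta> l)) * (norm w)\<^sup>2"
proof -
  have "cinner (V w) w = cnj (cinner (U w) w)" using cinner_commute[of w "U w"] by (simp add: adj')
  moreover have "cinner (pencil l l w) w = 2 * of_real \<kappa> * cinner w w - skew \<delta> l * cinner (U w) w
      - cnj (skew \<delta> l) * cinner (V w) w"
    unfolding cinner_pencil_expand by (simp add: \<kappa>_def skew_def algebra_simps)
  ultimately have "Re (cinner (pencil l l w) w) = 2 * \<kappa> * (norm w)\<^sup>2 - 2 * Re (skew \<delta> l * cinner (U w) w)"
    by (simp add: Re_cinner_self cinner_self_norm flip: of_real_power)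
  moreover have "Re (skew \<delta> l * cinner (U w) w) \<le> cmod (skew \<delta> l) * (norm w)\<^sup>2"
  proof -
    have "Re (skew \<delta> l * cinner (U w) w) \<le> cmod (skew \<delta> l) * cmod (cinner (U w) w)"
      by (metis complex_Re_le_cmod norm_mult)
    also have "\<dots> \<le> cmod (skew \<delta> l) * (norm w)\<^sup>2"
      using cinner_cauchy_schwarz[of "U w" w] by (intro mult_left_mono) (auto simp: norm_U power2_eq_square)
    finally show ?thesis .
  qed
  ultimately show ?thesis by (simp add: algebra_simps)
qed

text \<open>The one estimate behind both continuity and differentiability of \<open>u\<close>: it is applied to
  first differences and to differences of difference quotients.\<close>

lemma difference_estimate:
  fixes F :: "'i \<Rightarrow> complex" and a :: "'i \<Rightarrow> 'h"
  assumes E: "\<And>i j. i \<in> I \<Longrightarrow> j \<in> I \<Longrightarrow> cinner (pencil (l i) (l j) (a i)) (a j) = 1 - cnj (F j) * F i"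
    and c: "sum c I = 0"
  defines "x \<equiv> \<Sum>i\<in>I. scaleC (c i) (a i)"
  shows "(\<kappa> - cmod (skew \<delta> \<mu>)) * norm x \<le> 2 * norm (\<Sum>i\<in>I. scaleC (c i * (l i - \<mu>)) (a i))"
proof -
  define y where "y = (\<Sum>i\<in>I. scaleC (c i * (l i - \<mu>)) (a i))"
  have cinner_sum2: "cinner (\<Sum>i\<in>I. scaleC (s i) (p i)) (\<Sum>j\<in>I. scaleC (t j) (q j))
      = (\<Sum>i\<in>I. \<Sum>j\<in>I. s i * cnj (t j) * cinner (p i) (q j))" for s t and p q :: "'i \<Rightarrow> 'h"
    by (simp only: cinner.sum_left cinner.sum_right cinner_scaleC_left cinner_scaleC_right sum_distrib_left)
      (subst sum.swap, simp add: mult_ac)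
  define p where "p = cinner (N x) x"
  define p' where "p' = cnj p"
  define q where "q = cinner (N y) x"
  define q' where "q' = cnj q"
  have Ny: "q = (\<Sum>i\<in>I. \<Sum>j\<in>I. c i * (l i - \<mu>) * cnj (c j) * cinner (N (a i)) (a j))"
    unfolding q_def y_def N_sum x_def cinner_sum2 ..
  have Ny': "q' = (\<Sum>i\<in>I. \<Sum>j\<in>I. c i * cnj (c j * (l j - \<mu>)) * cnj (cinner (N (a j)) (a i)))"
    unfolding q'_def Ny by (subst sum.swap) (simp add: mult_ac)
  have xx: "cinner x x = (\<Sum>i\<in>I. \<Sum>j\<in>I. c i * cnj (c j) * cinner (a i) (a j))"
    unfolding x_def cinner_sum2 ..
  have Nx: "p = (\<Sum>i\<in>I. \<Sum>j\<in>I. c i * cnj (c j) * cinner (N (a i)) (a j))"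
    unfolding p_def x_def N_sum cinner_sum2 ..
  have Nx': "p' = (\<Sum>i\<in>I. \<Sum>j\<in>I. c i * cnj (c j) * cnj (cinner (N (a j)) (a i)))"
    unfolding p'_def Nx by (subst sum.swap) (simp add: mult_ac)
  have "cinner (pencil \<mu> \<mu> x) x = 2 * of_real \<kappa> * cinner x x - \<mu> * p - cnj \<mu> * p'"
    unfolding cinner_pencil p_def p'_def ..
  \<comment> \<open>Moving every node \<open>l i\<close> to \<mu> costs exactly q and its conjugate.
    On the other side the constant 1 is killed by \<open>sum c I = 0\<close>, and what remains is
    -|sum c F|^2, which has the favourable sign.\<close>
  then have "cinner (pencil \<mu> \<mu> x) x - q - q' = 2 * of_real \<kappa> * cinner x x - \<mu> * p - cnj \<mu> * p' - q - q'"
    by simp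
  also have "\<dots> = (\<Sum>i\<in>I. \<Sum>j\<in>I. c i * cnj (c j) * cinner (pencil (l i) (l j) (a i)) (a j))"
    unfolding xx Nx' Nx Ny' Ny sum_distrib_left sum_subtractf[symmetric] cinner_pencil
    by (intro sum.cong refl) (simp add: algebra_simps)
  also have "\<dots> = (\<Sum>i\<in>I. \<Sum>j\<in>I. c i * cnj (c j) - (c i * F i) * cnj (c j * F j))"
    by (intro sum.cong refl) (simp add: E algebra_simps)
  also have "\<dots> = sum c I * cnj (sum c I) - (\<Sum>i\<in>I. c i * F i) * cnj (\<Sum>i\<in>I. c i * F i)"
    by (simp only: sum_subtractf sum_product cnj_sum)
  also have "\<dots> = - of_real ((cmod (\<Sum>i\<in>I. c i * F i))\<^sup>2)"
    by (simp only: c complex_norm_square) simp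
  finally have "Re (cinner (pencil \<mu> \<mu> x) x) - 2 * Re (cinner (N y) x) = - (cmod (\<Sum>i\<in>I. c i * F i))\<^sup>2"
    by (simp add: complex_eq_iff q'_def q_def)
  then have "Re (cinner (pencil \<mu> \<mu> x) x) - 2 * Re (cinner (N y) x) \<le> 0" by simp
  moreover have "Re (cinner (N y) x) \<le> 2 * norm y * norm x"
  proof -
    have "Re (cinner (N y) x) \<le> norm (N y) * norm x"
      using complex_Re_le_cmod cinner_cauchy_schwarz order_trans by blast
    also have "\<dots> \<le> 2 * norm y * norm x" using norm_N by (intro mult_right_mono) auto
    finally show ?thesis .
  qed
  ultimately have "(\<kappa> - cmod (skew \<delta> \<mu>)) * (norm x)\<^sup>2 \<le> 2 * norm y * norm x"
    using pencil_coercive[of \<mu> x] by (simp add: algebra_simps)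
  then have "norm x * ((\<kappa> - cmod (skew \<delta> \<mu>)) * norm x) \<le> norm x * (2 * norm y)"
    by (simp add: power2_eq_square mult_ac)
  then show ?thesis
    by (cases "x = 0") (auto simp: y_def)
qed

text \<open>The diagonal equation and coercivity bound the model vector by the gap of
  \<open>l\<close> to the boundary alone, independently of \<open>f\<close>.\<close>

lemma model_vector_bound:
  assumes E: "cinner (pencil l l a) a = 1 - cnj z * z" and l: "l \<in> G_delta \<delta>"
  shows "(norm a)\<^sup>2 \<le> 1 / (2 * (\<kappa> - cmod (skew \<delta> l)))"
proof -
  have "Re (1 - cnj z * z) \<le> 1" by simp
  then have "2 * (\<kappa> - cmod (skew \<delta> l)) * (norm a)\<^sup>2 \<le> 1"
    using pencil_coercive[of l a] unfolding E by linarith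
  moreover have "\<kappa> - cmod (skew \<delta> l) > 0" using l G_delta_iff[OF delta] by (simp add: \<kappa>_def)
  ultimately show ?thesis by (simp add: field_simps)
qed

text \<open>The weights are 1 at \<open>l\<close> and -1 at \<open>m\<close>; with \<mu> = m the
  right-hand sum keeps only the term (l - m) a.\<close>

lemma first_difference:
  assumes "cinner (pencil l l a) a = 1 - cnj z * z" "cinner (pencil m m b) b = 1 - cnj w * w"
    "cinner (pencil l m a) b = 1 - cnj w * z" "cinner (pencil m l b) a = 1 - cnj z * w"
  shows "(\<kappa> - cmod (skew \<delta> m)) * norm (a - b) \<le> 2 * cmod (l - m) * norm a"
proof -
  have "(\<kappa> - cmod (skew \<delta> m)) * norm (\<Sum>i\<in>UNIV. scaleC (if i then 1 else -1) (if i then a else b))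
    \<le> 2 * norm (\<Sum>i\<in>UNIV. scaleC ((if i then 1 else -1) * ((if i then l else m) - m)) (if i then a else b))"
    by (rule difference_estimate[where F = "\<lambda>i. if i then z else w"])
      (use assms in \<open>auto simp: UNIV_bool\<close>)
  then show ?thesis
    by (simp add: UNIV_bool scaleC_one scaleC.minus_left norm_scaleC add.commute)
qed

lemma continuous_solution:
  assumes E: "\<And>l m. l \<in> G_delta \<delta> \<Longrightarrow> m \<in> G_delta \<delta> \<Longrightarrow> cinner (pencil l m (u l)) (u m) = 1 - cnj (f m) * f l"
  shows "continuous_on (G_delta \<delta>) u"
  unfolding continuous_on_def
proof
  fix m assume m: "m \<in> G_delta \<delta>"
  define \<eta> where "\<eta> l = \<kappa> - cmod (skew \<delta> l)" for l
  have \<eta>: "\<eta> l > 0" if "l \<in> G_delta \<delta>" for l using that G_delta_iff[OF delta] by (simp add: \<kappa>_def \<eta>_def)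
  have bd: "norm (u l - u m) \<le> 2 * cmod (l - m) * sqrt (1 / (2 * \<eta> l)) / \<eta> m" if l: "l \<in> G_delta \<delta>" for l
  proof -
    have "norm (u l) \<le> sqrt (1 / (2 * \<eta> l))"
      using model_vector_bound[OF E[OF l l] l] by (simp add: \<eta>_def real_le_rsqrt)
    then have "2 * cmod (l - m) * norm (u l) \<le> 2 * cmod (l - m) * sqrt (1 / (2 * \<eta> l))"
      by (intro mult_left_mono) auto
    then have "norm (u l - u m) * \<eta> m \<le> 2 * cmod (l - m) * sqrt (1 / (2 * \<eta> l))"
      using first_difference[OF E[OF l l] E[OF m m] E[OF l m] E[OF m l]] by (simp add: \<eta>_def mult_ac)
    then show ?thesis using \<eta>[OF m] by (simp add: pos_le_divide_eq)
  qed
  have skew: "(skew \<delta> \<longlongrightarrow> skew \<delta> m) (at m within G_delta \<delta>)"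
    by (rule bounded_linear.tendsto[OF bounded_linear_skew]) (rule tendsto_ident_at)
  have "((\<lambda>l. 2 * cmod (l - m) * sqrt (1 / (2 * \<eta> l)) / \<eta> m) \<longlongrightarrow> 2 * cmod (m - m) * sqrt (1 / (2 * \<eta> m)) / \<eta> m)
      (at m within G_delta \<delta>)"
    unfolding \<eta>_def using \<eta>[OF m] by (intro tendsto_intros skew) (auto simp: \<eta>_def)
  then have "((\<lambda>l. 2 * cmod (l - m) * sqrt (1 / (2 * \<eta> l)) / \<eta> m) \<longlongrightarrow> 0) (at m within G_delta \<delta>)" by simp
  then have "((\<lambda>l. u l - u m) \<longlongrightarrow> 0) (at m within G_delta \<delta>)"
    by (rule Lim_null_comparison[rotated]) (auto simp: eventually_at_filter bd)
  then show "(u \<longlongrightarrow> u m) (at m within G_delta \<delta>)" by (simp add: LIM_zero_iff)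
qed

text \<open>A difference of two difference quotients at \<open>m\<close> is controlled by u(m+h) -
  u(m+k), which is small by continuity. The quotients are thus Cauchy, and completeness supplies the
  derivative.\<close>

lemma holomorphic_solution:
  assumes E: "\<And>l m. l \<in> G_delta \<delta> \<Longrightarrow> m \<in> G_delta \<delta> \<Longrightarrow> cinner (pencil l m (u l)) (u m) = 1 - cnj (f m) * f l"
  shows "vholomorphic_on u (G_delta \<delta>)"
  unfolding vholomorphic_on_def
proof
  fix m assume m: "m \<in> G_delta \<delta>"
  define \<eta> where "\<eta> = \<kappa> - cmod (skew \<delta> m)"
  have \<eta>: "\<eta> > 0" using m G_delta_iff[OF delta] by (simp add: \<kappa>_def \<eta>_def)
  define w where "w h = scaleC (1 / h) (u (m + h) - u m)" for h
  have est: "\<eta> * norm (w h - w k) \<le> 2 * norm (u (m + h) - u (m + k))"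
    if "h \<noteq> 0" "k \<noteq> 0" "m + h \<in> G_delta \<delta>" "m + k \<in> G_delta \<delta>" for h k
  proof -
    \<comment> \<open>The third weight makes the sum vanish. Multiplied by the distances h, k and 0
      of the nodes from \<open>m\<close>, the weights become 1, -1 and 0.\<close>
    define c where "c i = (if i = (0::nat) then 1 / h else if i = 1 then - 1 / k else 1 / k - 1 / h)" for i
    define l where "l i = (if i = (0::nat) then m + h else if i = 1 then m + k else m)" for i
    have "\<eta> * norm (\<Sum>i<3. scaleC (c i) (u (l i))) \<le> 2 * norm (\<Sum>i<3. scaleC (c i * (l i - m)) (u (l i)))"
      unfolding \<eta>_def
    proof (rule difference_estimate[where F = "\<lambda>i. f (l i)"])
      show "cinner (pencil (l i) (l j) (u (l i))) (u (l j)) = 1 - cnj (f (l j)) * f (l i)" for i j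
        by (rule E) (auto simp: l_def that m)
      show "sum c {..<3} = 0" by (simp add: c_def numeral_3_eq_3)
    qed
    moreover have "(\<Sum>i<3. scaleC (c i) (u (l i))) = w h - w k"
      by (simp add: c_def l_def w_def numeral_3_eq_3 scaleC.diff_left scaleC.diff_right scaleC.minus_left)
    moreover have "(\<Sum>i<3. scaleC (c i * (l i - m)) (u (l i))) = u (m + h) - u (m + k)"
      using that by (simp add: c_def l_def numeral_3_eq_3 scaleC_one scaleC.minus_left)
    ultimately show ?thesis by simp
  qed
  obtain r where r: "r > 0" "ball m r \<subseteq> G_delta \<delta>"
    using open_G_delta m open_contains_ball by blast
  have isc: "isCont u m"
    using continuous_solution[OF E] open_G_delta m continuous_on_eq_continuous_at by blast
  have cau: "\<exists>d>0. \<forall>h k. h \<noteq> 0 \<and> k \<noteq> 0 \<and> cmod h < d \<and> cmod k < d \<longrightarrow> norm (w h - w k) < e" if "e > 0" for e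
  proof -
    have "\<eta> * e / 4 > 0" using \<eta> that by simp
    then obtain d where d: "d > 0" "\<And>x. dist x m < d \<Longrightarrow> dist (u x) (u m) < \<eta> * e / 4"
      using isc unfolding continuous_at_eps_delta by blast
    have "norm (w h - w k) < e" if h: "h \<noteq> 0" "k \<noteq> 0" "cmod h < min d r" "cmod k < min d r" for h k
    proof -
      have "norm (u (m + h) - u m) < \<eta> * e / 4" "norm (u (m + k) - u m) < \<eta> * e / 4"
        using d(2)[of "m + h"] d(2)[of "m + k"] h by (auto simp: dist_norm)
      then have "norm (u (m + h) - u (m + k)) < \<eta> * e / 2"
        using norm_triangle_ineq4[of "u (m + h) - u m" "u (m + k) - u m"] by simp
      moreover have "m + h \<in> G_delta \<delta>" "m + k \<in> G_delta \<delta>"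
        using h r(2) by (auto simp: subset_iff dist_norm)
      ultimately have "\<eta> * norm (w h - w k) < \<eta> * e"
        using est[OF h(1,2)] by fastforce
      then show ?thesis using \<eta> by simp
    qed
    then show ?thesis using d(1) r(1) by (intro exI[of _ "min d r"]) auto
  qed
  \<comment> \<open>One concrete null sequence produces the candidate \<open>v\<close>; the Cauchy
    estimate then gives the full limit.\<close>
  define s where "s n = complex_of_real (1 / Suc n)" for n
  have s: "s n \<noteq> 0" "\<exists>n0. \<forall>n\<ge>n0. cmod (s n) < d" if "d > 0" for n d
  proof -
    show "s n \<noteq> 0" unfolding s_def of_real_eq_0_iff by simp
    have "(\<lambda>n. 1 / real (Suc n)) \<longlonglongrightarrow> 0" by (rule LIMSEQ_Suc[OF lim_1_over_n])
    then have "\<forall>\<^sub>F n in sequentially. 1 / real (Suc n) < d" using that by (rule order_tendstoD)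
    then show "\<exists>n0. \<forall>n\<ge>n0. cmod (s n) < d"
      unfolding eventually_sequentially s_def norm_of_real by simp
  qed
  have "Cauchy (\<lambda>n. w (s n))"
  proof (rule metric_CauchyI)
    fix e :: real assume "e > 0"
    from cau[OF this] obtain d where d: "d > 0"
      "\<And>h k. h \<noteq> 0 \<Longrightarrow> k \<noteq> 0 \<Longrightarrow> cmod h < d \<Longrightarrow> cmod k < d \<Longrightarrow> norm (w h - w k) < e" by blast
    then show "\<exists>M. \<forall>i\<ge>M. \<forall>j\<ge>M. dist (w (s i)) (w (s j)) < e"
      using s[OF d(1)] unfolding dist_norm by blast
  qed
  then obtain v where v: "(\<lambda>n. w (s n)) \<longlonglongrightarrow> v" using Cauchy_convergent convergent_def by blast
  have "(w \<longlongrightarrow> v) (at 0)"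
    unfolding LIM_eq
  proof (intro allI impI)
    fix e :: real assume e: "e > 0"
    then have "e / 2 > 0" by simp
    from cau[OF this] obtain d where d: "d > 0"
      "\<And>h k. h \<noteq> 0 \<Longrightarrow> k \<noteq> 0 \<Longrightarrow> cmod h < d \<Longrightarrow> cmod k < d \<Longrightarrow> norm (w h - w k) < e / 2" by blast
    have "norm (w h - v) < e" if "h \<noteq> 0" "cmod h < d" for h
    proof -
      obtain n0 where n0: "\<forall>n\<ge>n0. cmod (s n) < d" using s(2)[OF d(1)] by blast
      have "(\<lambda>n. norm (w h - w (s n))) \<longlonglongrightarrow> norm (w h - v)" by (intro tendsto_intros v)
      then have "norm (w h - v) \<le> e / 2"
        by (rule Lim_bounded[where M = n0]) (use d(2)[OF that(1) s(1)[OF d(1)]] that n0 in \<open>auto intro: less_imp_le\<close>)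
      then show ?thesis using e by simp
    qed
    then show "\<exists>s>0. \<forall>x. x \<noteq> 0 \<and> norm (x - 0) < s \<longrightarrow> norm (w x - v) < e"
      using d(1) by (intro exI[of _ d]) simp
  qed
  then have lim: "((\<lambda>h. norm (w h - v)) \<longlongrightarrow> 0) (at 0)" by (simp add: LIM_zero_iff tendsto_norm_zero)
  have "(u has_derivative (\<lambda>h. scaleC h v)) (at m)"
    unfolding has_derivative_at
  proof (intro conjI scaleC.bounded_linear_left)
    have "norm (w h - v) = norm (u (m + h) - u m - scaleC h v) / norm h" if "h \<noteq> 0" for h
    proof -
      have "w h - v = scaleC (1 / h) (u (m + h) - u m - scaleC h v)"
        using that by (simp add: w_def scaleC.diff_right scaleC_scaleC scaleC_one)
      then show ?thesis by (simp add: norm_scaleC norm_divide)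
    qed
    then show "(\<lambda>h. norm (u (m + h) - u m - scaleC h v) / norm h) \<midarrow>0\<rightarrow> 0"
      using lim by (subst LIM_equal[where g = "\<lambda>h. norm (w h - v)"]) auto
  qed
  then show "\<exists>v. (u has_derivative (\<lambda>h. scaleC h v)) (at m within G_delta \<delta>)"
    using has_derivative_at_withinI by blast
qed

text \<open>Along nodes converging to an interior point, \<open>model_vector_bound\<close> bounds
  the vectors uniformly and \<open>first_difference\<close> makes them Lipschitz in the nodes, with
  the constant \<open>C\<close>; hence they converge.\<close>

lemma solution_from_dense:
  assumes lam: "range lam \<subseteq> G_delta \<delta>" "G_delta \<delta> \<subseteq> closure (range lam)"
    and f: "continuous_on (G_delta \<delta>) f"
    and E: "\<And>i j :: nat. cinner (pencil (lam i) (lam j) (a i)) (a j) = 1 - cnj (f (lam j)) * f (lam i)"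
  obtains u where "\<And>l m. l \<in> G_delta \<delta> \<Longrightarrow> m \<in> G_delta \<delta> \<Longrightarrow>
    cinner (pencil l m (u l)) (u m) = 1 - cnj (f m) * f l"
proof -
  have "\<exists>I w. (\<lambda>n. lam (I n)) \<longlonglongrightarrow> m \<and> (\<lambda>n. a (I n)) \<longlonglongrightarrow> w" if m: "m \<in> G_delta \<delta>" for m
  proof -
    have "m \<in> closure (range lam)" using m lam by blast
    then obtain X where X: "\<And>n. X n \<in> range lam" "X \<longlonglongrightarrow> m" unfolding closure_sequential by blast
    then have "\<forall>n. \<exists>i. X n = lam i" by blast
    then obtain I where "\<And>n. X n = lam (I n)" by metis
    then have I: "(\<lambda>n. lam (I n)) \<longlonglongrightarrow> m" using X(2) by (simp add: LIMSEQ_def)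
    \<comment> \<open>Half of the gap at \<open>m\<close>, so that it is a uniform lower bound for
      the gaps at the late nodes.\<close>
    define \<eta> where "\<eta> = (\<kappa> - cmod (skew \<delta> m)) / 2"
    have \<eta>: "\<eta> > 0" using m G_delta_iff[OF delta] by (simp add: \<kappa>_def \<eta>_def)
    have "(\<lambda>n. cmod (skew \<delta> (lam (I n)))) \<longlonglongrightarrow> cmod (skew \<delta> m)"
      by (intro tendsto_norm bounded_linear.tendsto[OF bounded_linear_skew] I)
    moreover have "cmod (skew \<delta> m) < \<kappa> - \<eta>" using \<eta> unfolding \<eta>_def by (simp add: field_simps)
    ultimately have "\<forall>\<^sub>F n in sequentially. cmod (skew \<delta> (lam (I n))) < \<kappa> - \<eta>" by (rule order_tendstoD)
    then obtain n0 where n0: "\<And>n. n \<ge> n0 \<Longrightarrow> \<eta> < \<kappa> - cmod (skew \<delta> (lam (I n)))"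
      unfolding eventually_sequentially by force
    define C where "C = 2 * sqrt (1 / (2 * \<eta>)) / \<eta>"
    have C: "C \<ge> 0" using \<eta> by (simp add: C_def)
    have bd: "norm (a (I n) - a (I k)) \<le> cmod (lam (I n) - lam (I k)) * C" if "n \<ge> n0" "k \<ge> n0" for n k
    proof -
      have "(norm (a (I n)))\<^sup>2 \<le> 1 / (2 * (\<kappa> - cmod (skew \<delta> (lam (I n)))))"
        using lam(1) by (intro model_vector_bound[OF E]) auto
      also have "\<dots> \<le> 1 / (2 * \<eta>)" using n0[OF that(1)] \<eta> by (intro divide_left_mono) auto
      finally have "norm (a (I n)) \<le> sqrt (1 / (2 * \<eta>))" by (simp add: real_le_rsqrt)
      then have "2 * cmod (lam (I n) - lam (I k)) * norm (a (I n)) \<le> 2 * cmod (lam (I n) - lam (I k)) * sqrt (1 / (2 * \<eta>))"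
        by (intro mult_left_mono) auto
      moreover have "\<eta> * norm (a (I n) - a (I k)) \<le> (\<kappa> - cmod (skew \<delta> (lam (I k)))) * norm (a (I n) - a (I k))"
        using n0[OF that(2)] by (intro mult_right_mono) auto
      moreover have "(\<kappa> - cmod (skew \<delta> (lam (I k)))) * norm (a (I n) - a (I k)) \<le> 2 * cmod (lam (I n) - lam (I k)) * norm (a (I n))"
        by (rule first_difference[OF E E E E])
      ultimately have "\<eta> * norm (a (I n) - a (I k)) \<le> 2 * cmod (lam (I n) - lam (I k)) * sqrt (1 / (2 * \<eta>))" by linarith
      then show ?thesis using \<eta> unfolding C_def by (simp add: pos_le_divide_eq mult_ac)
    qed
    have "Cauchy (\<lambda>n. a (I n))"
    proof (rule metric_CauchyI)
      fix e :: real assume e: "e > 0"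
      have "Cauchy (\<lambda>n. lam (I n))" using I by (rule LIMSEQ_imp_Cauchy)
      moreover have "e / (C + 1) > 0" using e C by simp
      ultimately obtain M where M: "\<And>n k. n \<ge> M \<Longrightarrow> k \<ge> M \<Longrightarrow> dist (lam (I n)) (lam (I k)) < e / (C + 1)"
        by (metis metric_CauchyD)
      have "dist (a (I n)) (a (I k)) < e" if "n \<ge> max M n0" "k \<ge> max M n0" for n k
      proof -
        have "norm (a (I n) - a (I k)) \<le> cmod (lam (I n) - lam (I k)) * C" using that by (intro bd) auto
        also have "\<dots> \<le> e / (C + 1) * C" using M[of n k] that C by (intro mult_right_mono) (auto simp: dist_norm)
        also have "\<dots> < e" using e C by (simp add: field_simps)
        finally show ?thesis by (simp add: dist_norm)
      qed
      then show "\<exists>M. \<forall>n\<ge>M. \<forall>k\<ge>M. dist (a (I n)) (a (I k)) < e" by blast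
    qed
    then show ?thesis using I Cauchy_convergent convergent_def by blast
  qed
  \<comment> \<open>The sequences for different points are chosen independently: the equation passes
    to the limit whatever the choice, and continuity of \<open>u\<close> then follows from the
    equation.\<close>
  then have "\<forall>m. \<exists>I w. m \<in> G_delta \<delta> \<longrightarrow> (\<lambda>n. lam (I n)) \<longlonglongrightarrow> m \<and> (\<lambda>n. a (I n)) \<longlonglongrightarrow> w" by blast
  then obtain I u where I: "\<And>m. m \<in> G_delta \<delta> \<Longrightarrow> (\<lambda>n. lam (I m n)) \<longlonglongrightarrow> m"
    "\<And>m. m \<in> G_delta \<delta> \<Longrightarrow> (\<lambda>n. a (I m n)) \<longlonglongrightarrow> u m" by metis
  have fI: "(\<lambda>n. f (lam (I m n))) \<longlonglongrightarrow> f m" if "m \<in> G_delta \<delta>" for m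
    using continuous_on_tendsto_compose[OF f I(1)[OF that] that] lam(1)
    by (simp add: image_subset_iff)
  have bN: "bounded_linear N"
    by (rule bounded_linear_intro[of _ 2]) (auto simp: linear_N scaleR_scaleC norm_N mult.commute[of _ "2::real"])
  have "cinner (pencil l m (u l)) (u m) = 1 - cnj (f m) * f l" if lm: "l \<in> G_delta \<delta>" "m \<in> G_delta \<delta>" for l m
  proof (rule LIMSEQ_unique)
    show "(\<lambda>n. cinner (pencil (lam (I l n)) (lam (I m n)) (a (I l n))) (a (I m n))) \<longlonglongrightarrow> cinner (pencil l m (u l)) (u m)"
      unfolding cinner_pencil
      by (intro tendsto_intros cinner.tendsto bounded_linear.tendsto[OF bN] I lm)
    show "(\<lambda>n. cinner (pencil (lam (I l n)) (lam (I m n)) (a (I l n))) (a (I m n))) \<longlonglongrightarrow> 1 - cnj (f m) * f l"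
      unfolding E by (intro tendsto_intros fI lm)
  qed
  then show ?thesis using that by blast
qed

end

section \<open>Separation of cones and contractive Gram matrices\<close>

text \<open>The functional is p - b, with \<open>p\<close> the point of the closed cone nearest to
  \<open>b\<close>. Testing the variational inequality at 0 and at large multiples of
  \<open>y\<close> gives the two signs.\<close>

lemma separate_cone:
  fixes K :: "'h::chilbert set"
  assumes add: "\<And>x y. x \<in> K \<Longrightarrow> y \<in> K \<Longrightarrow> x + y \<in> K"
    and scale: "\<And>x s. x \<in> K \<Longrightarrow> s \<ge> 0 \<Longrightarrow> s *\<^sub>R x \<in> K" and zero: "0 \<in> K"
    and b: "b \<notin> closure K"
  obtains L where "\<And>y. y \<in> K \<Longrightarrow> 0 \<le> Re (cinner y L)" "Re (cinner b L) < 0"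
proof -
  have "convex K" using add scale by (intro convexI) auto
  then obtain p where p: "p \<in> closure K" "\<And>y. y \<in> closure K \<Longrightarrow> Re (cinner (b - p) (y - p)) \<le> 0"
    using closest_point_chilbert[of "closure K" b] zero closure_subset[of K] by (auto simp: convex_closure)
  define t where "t = Re (cinner (b - p) p)"
  have "0 \<in> closure K" using zero closure_subset[of K] by blast
  from p(2)[OF this] have t: "t \<ge> 0" by (simp add: t_def cinner.minus_right)
  have neg: "Re (cinner (b - p) y) \<le> 0" if y: "y \<in> K" for y
  proof (rule ccontr)
    \<comment> \<open>If \<open>a\<close> were positive, the multiple (t+1)/a of \<open>y\<close>
      would take the value t+1, exceeding the value \<open>t\<close> at \<open>p\<close>.\<close>
    define a where "a = Re (cinner (b - p) y)"
    assume "\<not> ?thesis"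
    then have a: "a > 0" by (simp add: a_def)
    have "((t + 1) / a) *\<^sub>R y \<in> closure K"
      using scale[OF y, of "(t + 1) / a"] a t closure_subset[of K] by auto
    from p(2)[OF this] have "(t + 1) / a * a \<le> t"
      by (simp add: cinner.diff_right[of "b - p"] cinner.scaleR_right t_def a_def)
    then show False using a by simp
  qed
  have "b \<noteq> p" using p(1) b by auto
  then have "0 < Re (cinner (b - p) (b - p))" by (simp add: Re_cinner_self)
  also have "\<dots> = Re (cinner (b - p) b) - t" by (simp add: t_def cinner.diff_right[of "b - p"])
  finally have pos: "Re (cinner (b - p) b) > 0" using t by simp
  show ?thesis
  proof (rule that[of "p - b"])
    have flip: "Re (cinner y (p - b)) = - Re (cinner (b - p) y)" for y
      using Re_cinner_commute[of y "b - p"] cinner.minus_right[of y "b - p"] by simp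
    show "0 \<le> Re (cinner y (p - b))" if "y \<in> K" for y using neg[OF that] flip by simp
    show "Re (cinner b (p - b)) < 0" using pos flip by simp
  qed
qed

text \<open>For the Gram matrix \<open>g\<close> of vectors \<open>v i\<close> this is the inner
  product of the combinations with coefficients \<open>c\<close> and \<open>c'\<close>.\<close>

definition quad :: "nat \<Rightarrow> (nat \<Rightarrow> nat \<Rightarrow> complex) \<Rightarrow> (nat \<Rightarrow> complex) \<Rightarrow> (nat \<Rightarrow> complex) \<Rightarrow> complex" where
  "quad n g c c' = (\<Sum>i\<le>n. \<Sum>j\<le>n. c i * cnj (c' j) * g i j)"

lemma cnj_quad:
  assumes "\<And>i j. g j i = cnj (g i j)"
  shows "cnj (quad n g c c') = quad n g c' c"
proof -
  have "cnj (quad n g c c') = (\<Sum>i\<le>n. \<Sum>j\<le>n. c' j * cnj (c i) * g j i)"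
    unfolding quad_def cnj_sum by (intro sum.cong refl) (simp add: assms[symmetric] mult_ac)
  also have "\<dots> = quad n g c' c" unfolding quad_def by (rule sum.swap)
  finally show ?thesis .
qed

text \<open>A test sequence may repeat indices or leave the range; the total weight
  \<open>c i\<close> falling on each index reduces it to the form on 0, ..., n.\<close>

lemma psd_of_quad:
  assumes herm: "\<And>i j. g j i = cnj (g i j)" and pos: "\<And>c. 0 \<le> Re (quad n g c c)"
  shows "psd (\<lambda>p q. if p \<le> n \<and> q \<le> n then g p q else 0)"
  unfolding psd_def
proof (intro conjI allI)
  show "(if q \<le> n \<and> p \<le> n then g q p else 0) = cnj (if p \<le> n \<and> q \<le> n then g p q else 0)" for p q
    using herm[of q p] by simp
  fix N :: nat and p and z :: "nat \<Rightarrow> complex"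
  define c where "c i = (\<Sum>a<N. if p a = i then z a else 0)" for i :: nat
  define T where "T a b i j = (if p a = i then z a else 0) * cnj (if p b = j then z b else 0) * g i j" for a b i j
  have "(\<Sum>a<N. \<Sum>b<N. z a * cnj (z b) * (if p a \<le> n \<and> p b \<le> n then g (p a) (p b) else 0))
      = (\<Sum>a<N. \<Sum>b<N. \<Sum>i\<le>n. \<Sum>j\<le>n. T a b i j)"
  proof (intro sum.cong refl)
    fix a b
    have "(\<Sum>j\<le>n. T a b i j) = (if p b \<le> n \<and> i = p a then z a * cnj (z b) * g i (p b) else 0)" for i
    proof -
      have "(\<Sum>j\<le>n. T a b i j) = (\<Sum>j\<le>n. if j = p b then (if i = p a then z a * cnj (z b) * g i (p b) else 0) else 0)"
        by (intro sum.cong) (auto simp: T_def)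
      then show ?thesis by simp
    qed
    then have "(\<Sum>i\<le>n. \<Sum>j\<le>n. T a b i j) = (\<Sum>i\<le>n. if i = p a then (if p b \<le> n then z a * cnj (z b) * g i (p b) else 0) else 0)"
      by (auto intro: sum.cong)
    then show "z a * cnj (z b) * (if p a \<le> n \<and> p b \<le> n then g (p a) (p b) else 0) = (\<Sum>i\<le>n. \<Sum>j\<le>n. T a b i j)"
      by simp
  qed
  also have "\<dots> = (\<Sum>a<N. \<Sum>i\<le>n. \<Sum>b<N. \<Sum>j\<le>n. T a b i j)"
    by (rule sum.cong[OF refl], rule sum.swap)
  also have "\<dots> = (\<Sum>i\<le>n. \<Sum>a<N. \<Sum>j\<le>n. \<Sum>b<N. T a b i j)"
    by (subst sum.swap) (rule sum.cong[OF refl], rule sum.cong[OF refl], rule sum.swap)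
  also have "\<dots> = (\<Sum>i\<le>n. \<Sum>j\<le>n. \<Sum>a<N. \<Sum>b<N. T a b i j)"
    by (rule sum.cong[OF refl], rule sum.swap)
  also have "\<dots> = quad n g c c"
    unfolding quad_def c_def T_def cnj_sum unfolding sum_product unfolding sum_distrib_right ..
  finally show "0 \<le> Re (\<Sum>a<N. \<Sum>b<N. z a * cnj (z b) * (if p a \<le> n \<and> p b \<le> n then g (p a) (p b) else 0))"
    using pos[of c] by simp
qed

lemma csubspace_finite_combinations:
  "csubspace (range (\<lambda>c. \<Sum>i\<in>I. scaleC (c i) (v i :: 'h::chilbert)))"
  unfolding csubspace_def subspace_def
proof (intro conjI ballI allI)
  let ?R = "range (\<lambda>c. \<Sum>i\<in>I. scaleC (c i) (v i))"
  have scale: "scaleC s x \<in> ?R" if "x \<in> ?R" for s x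
  proof -
    from that obtain c where "x = (\<Sum>i\<in>I. scaleC (c i) (v i))" by (rule rangeE)
    then have "scaleC s x = (\<Sum>i\<in>I. scaleC (s * c i) (v i))" by (simp add: scaleC.sum_right scaleC_scaleC)
    then show ?thesis by (rule range_eqI[where x = "\<lambda>i. s * c i"])
  qed
  show "scaleC s x \<in> ?R" if "x \<in> ?R" for s x using scale that .
  show "s *\<^sub>R x \<in> ?R" if "x \<in> ?R" for s x using scale that by (simp only: scaleR_scaleC)
  show "0 \<in> ?R" by (rule range_eqI[where x = "\<lambda>_. 0"]) simp
  show "x + y \<in> ?R" if "x \<in> ?R" "y \<in> ?R" for x y
  proof -
    from that(1) obtain c where c: "x = (\<Sum>i\<in>I. scaleC (c i) (v i))" by (rule rangeE)
    from that(2) obtain c' where "y = (\<Sum>i\<in>I. scaleC (c' i) (v i))" by (rule rangeE)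
    with c have "x + y = (\<Sum>i\<in>I. scaleC (c i + c' i) (v i))" by (simp add: sum.distrib scaleC_add_left)
    then show ?thesis by (rule range_eqI[where x = "\<lambda>i. c i + c' i"])
  qed
qed

lemma combination_member:
  assumes "finite I" "i \<in> I" shows "v i \<in> range (\<lambda>c. \<Sum>i\<in>I. scaleC (c i) (v i :: 'h::chilbert))"
proof -
  have "(\<Sum>j\<in>I. scaleC (if j = i then 1 else 0) (v j)) = (\<Sum>j\<in>I. if j = i then v j else 0)"
    by (intro sum.cong) (auto simp: scaleC_one)
  also have "\<dots> = v i" using assms by simp
  finally show ?thesis by (intro range_eqI[where x = "\<lambda>j. if j = i then 1 else 0"]) simp
qed

text \<open>Lower bounds on norms of combinations give a positive distance of each vector to the closed
  span of the others, hence a dual family.\<close>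

lemma dual_family:
  fixes v :: "nat \<Rightarrow> 'h::chilbert"
  assumes \<epsilon>: "\<epsilon> > 0" and lower: "\<And>c. \<epsilon> * (\<Sum>i\<le>n. (cmod (c i))\<^sup>2) \<le> (norm (\<Sum>i\<le>n. scaleC (c i) (v i)))\<^sup>2"
  obtains d where "biorthogonal n v d"
    "\<And>i. i \<le> n \<Longrightarrow> d i \<in> closure (range (\<lambda>c. \<Sum>i\<le>n. scaleC (c i) (v i)))"
proof -
  let ?M = "closure (range (\<lambda>c. \<Sum>i\<le>n. scaleC (c i) (v i)))"
  have M: "csubspace ?M" by (intro csubspace_closure csubspace_finite_combinations)
  have vM: "v i \<in> ?M" if "i \<le> n" for i
    using combination_member[of "{..n}" i v] that closure_subset by fastforce
  have "\<exists>d. d \<in> ?M \<and> (\<forall>j\<le>n. cinner (v j) d = (if j = i then 1 else 0))" if i: "i \<le> n" for i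
  proof -
    define M' where "M' = range (\<lambda>c. \<Sum>j\<in>{..n} - {i}. scaleC (c j) (v j))"
    have M'M: "closure M' \<subseteq> ?M"
    proof (rule closure_mono, unfold M'_def, safe)
      fix c
      have "(\<Sum>j\<in>{..n} - {i}. scaleC (c j) (v j)) = (\<Sum>j\<le>n. scaleC (if j = i then 0 else c j) (v j))"
        by (rule sum.mono_neutral_cong_left) auto
      then show "(\<Sum>j\<in>{..n} - {i}. scaleC (c j) (v j)) \<in> range (\<lambda>c. \<Sum>i\<le>n. scaleC (c i) (v i))"
        by (rule range_eqI[where x = "\<lambda>j. if j = i then 0 else c j"])
    qed
    have "csubspace (closure M')" unfolding M'_def by (intro csubspace_closure csubspace_finite_combinations)
    from orthogonal_decomposition[OF this closed_closure, of "v i"]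
    obtain p where p: "p \<in> closure M'" "\<And>y. y \<in> closure M' \<Longrightarrow> cinner (v i - p) y = 0" by blast
    have "\<epsilon> \<le> (norm (v i - y))\<^sup>2" if "y \<in> M'" for y
    proof -
      from \<open>y \<in> M'\<close>[unfolded M'_def] obtain c where c: "y = (\<Sum>j\<in>{..n} - {i}. scaleC (c j) (v j))" by (rule rangeE)
      \<comment> \<open>This writes v i - y as a combination whose own coefficient at
        \<open>i\<close> is 1, so its squared norm is at least \<epsilon>.\<close>
      define c' where "c' j = (if j = i then 1 else - c j)" for j
      have "(\<Sum>j\<le>n. scaleC (c' j) (v j)) = v i + (\<Sum>j\<in>{..n} - {i}. scaleC (c' j) (v j))"
        using i by (simp add: sum.remove[of "{..n}" i] c'_def scaleC_one)
      also have "(\<Sum>j\<in>{..n} - {i}. scaleC (c' j) (v j)) = - y"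
        unfolding c sum_negf[symmetric] by (intro sum.cong refl) (simp add: c'_def scaleC.minus_left)
      finally have "\<epsilon> * (\<Sum>j\<le>n. (cmod (c' j))\<^sup>2) \<le> (norm (v i - y))\<^sup>2" using lower[of c'] by simp
      moreover have "1 \<le> (\<Sum>j\<le>n. (cmod (c' j))\<^sup>2)"
        using member_le_sum[of i "{..n}" "\<lambda>j. (cmod (c' j))\<^sup>2"] i by (simp add: c'_def)
      then have "\<epsilon> * 1 \<le> \<epsilon> * (\<Sum>j\<le>n. (cmod (c' j))\<^sup>2)" using \<epsilon> by (intro mult_left_mono) auto
      ultimately show ?thesis by simp
    qed
    then have "M' \<subseteq> {y. \<epsilon> \<le> (norm (v i - y))\<^sup>2}" by blast
    then have "closure M' \<subseteq> {y. \<epsilon> \<le> (norm (v i - y))\<^sup>2}"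
      by (rule closure_minimal) (intro closed_Collect_le continuous_intros)
    then have "\<epsilon> \<le> (norm (v i - p))\<^sup>2" using p(1) by blast
    then have r: "norm (v i - p) > 0" using \<epsilon> by (cases "v i = p") auto
    \<comment> \<open>Normalized by the inner product of \<open>v i\<close> with
      \<open>v i - p\<close>, which is the squared norm of \<open>v i - p\<close>.\<close>
    define d where "d = scaleC (of_real (1 / (norm (v i - p))\<^sup>2)) (v i - p)"
    have "d \<in> ?M"
      using M vM[OF i] M'M p(1) subspace_diff[of ?M "v i" p] by (auto simp: d_def csubspace_def)
    moreover have "cinner (v j) d = (if j = i then 1 else 0)" if "j \<le> n" for j
    proof (cases "j = i")
      case True
      have "cinner (v i - p) (v i) = cinner (v i - p) (v i - p)" using p by (simp add: cinner.diff_right[of "v i - p"])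
      then have "cinner (v i - p) (v i) = of_real ((norm (v i - p))\<^sup>2)" by (simp only: cinner_self_norm)
      then have "cinner (v i) (v i - p) = of_real ((norm (v i - p))\<^sup>2)"
        by (metis cinner_commute complex_cnj_complex_of_real)
      then show ?thesis using True r by (simp add: d_def cinner_scaleC_right flip: of_real_power)
    next
      case False
      then have "v j \<in> M'" unfolding M'_def using that by (intro combination_member) auto
      then have "cinner (v i - p) (v j) = 0" using p(2) closure_subset by blast
      then have "cinner (v j) (v i - p) = 0" by (metis cinner_commute complex_cnj_zero)
      then show ?thesis using False by (simp add: d_def cinner_scaleC_right)
    qed
    ultimately show ?thesis by blast
  qed
  then have "\<forall>i. \<exists>d. i \<le> n \<longrightarrow> d \<in> ?M \<and> (\<forall>j\<le>n. cinner (v j) d = (if j = i then 1 else 0))" by blast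
  from choice[OF this] obtain d where
    d: "\<And>i. i \<le> n \<Longrightarrow> d i \<in> ?M \<and> (\<forall>j\<le>n. cinner (v j) (d i) = (if j = i then 1 else 0))" by blast
  show ?thesis by (rule that[of d]) (auto simp: biorthogonal_def d)
qed

text \<open>Since the dual vectors lie in the closed span M of the \<open>v i\<close>, the operator
  maps M to itself and acts as the scalar \<open>a 0\<close> on its complement. The numerical range
  is then controlled by the two blocks, by density on M and by \<open>a 0\<close> off it. The margin
  \<eta> confines it to a closed smaller ellipse, so its closure stays in the open one.\<close>

lemma numerical_range_diag_op:
  fixes v d :: "nat \<Rightarrow> 'h::chilbert"
  assumes \<delta>: "0 < \<delta>" "\<delta> < 1" and bi: "biorthogonal n v d"
    and dM: "\<And>i. i \<le> n \<Longrightarrow> d i \<in> closure (range (\<lambda>c. \<Sum>i\<le>n. scaleC (c i) (v i)))"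
    and \<eta>: "0 < \<eta>" "cmod (skew \<delta> (a 0)) \<le> 1 - \<delta>\<^sup>2 - \<eta>"
    and W: "\<And>c. cmod (skew \<delta> (cinner (\<Sum>i\<le>n. scaleC (a i * c i) (v i)) (\<Sum>i\<le>n. scaleC (c i) (v i))))
      \<le> (1 - \<delta>\<^sup>2 - \<eta>) * (norm (\<Sum>i\<le>n. scaleC (c i) (v i)))\<^sup>2"
  shows "closure (numerical_range (diag_op n v d a)) \<subseteq> G_delta \<delta>"
proof -
  interpret biorthogonal n v d by (rule bi)
  let ?T = "diag_op n v d a"
  define \<rho> where "\<rho> = 1 - \<delta>\<^sup>2 - \<eta>"
  define M0 where "M0 = range (\<lambda>c. \<Sum>i\<le>n. scaleC (c i) (v i))"
  have M: "csubspace (closure M0)" unfolding M0_def by (intro csubspace_closure csubspace_finite_combinations)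
  have subM: "subspace (closure M0)" "\<And>c x. x \<in> closure M0 \<Longrightarrow> scaleC c x \<in> closure M0"
    using M by (auto simp: csubspace_def)
  have blT: "bounded_linear ?T" using bounded_clinear_diag_op by (simp add: bounded_clinear_op_def)
  have T_scale: "?T (scaleC c x) = scaleC c (?T x)" for c x
    using bounded_clinear_diag_op[of a] by (simp add: bounded_clinear_op_def)
  have T0: "?T (\<Sum>i\<le>n. scaleC (c i) (v i)) = (\<Sum>i\<le>n. scaleC (a i * c i) (v i))" for c
    by (simp add: linear_sum[OF bounded_linear.linear[OF blT]] T_scale diag_op_eigen scaleC_scaleC mult.commute)
  have "M0 \<subseteq> {x. cmod (skew \<delta> (cinner (?T x) x)) \<le> \<rho> * (norm x)\<^sup>2}"
    using W by (auto simp: M0_def T0 \<rho>_def)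
  then have "closure M0 \<subseteq> {x. cmod (skew \<delta> (cinner (?T x) x)) \<le> \<rho> * (norm x)\<^sup>2}"
    by (rule closure_minimal)
      (intro closed_Collect_le continuous_intros cinner.continuous_on linear_continuous_on[OF blT]
        bounded_linear.continuous_on[OF bounded_linear_skew])
  then have onM: "cmod (skew \<delta> (cinner (?T x) x)) \<le> \<rho> * (norm x)\<^sup>2" if "x \<in> closure M0" for x
    using that by blast
  have vM: "v i \<in> closure M0" if "i \<le> n" for i
    using combination_member[of "{..n}" i v] that closure_subset unfolding M0_def by fastforce
  have bound: "cmod (skew \<delta> (cinner (?T x) x)) \<le> \<rho>" if x: "norm x = 1" for x
  proof -
    obtain p where p: "p \<in> closure M0" "\<And>y. y \<in> closure M0 \<Longrightarrow> cinner (x - p) y = 0"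
      using orthogonal_decomposition[OF M closed_closure, of x] by blast
    define q where "q = x - p"
    have Tq: "?T q = scaleC (a 0) q"
      using p(2) dM unfolding M0_def by (simp add: diag_op_def q_def)
    have "(\<Sum>i\<le>n. scaleC ((a i - a 0) * cinner p (d i)) (v i)) \<in> closure M0"
      by (intro subspace_sum[OF subM(1)] subM(2) vM) auto
    then have Tp: "?T p \<in> closure M0"
      unfolding diag_op_def by (intro subspace_add[OF subM(1)] subM(2) p(1))
    have qp: "cinner q p = 0" "cinner p q = 0" "cinner q (?T p) = 0" "cinner (?T p) q = 0"
      using p(2)[OF p(1)] p(2)[OF Tp] unfolding q_def by (metis cinner_commute complex_cnj_zero)+
    have xpq: "x = p + q" by (simp add: q_def)
    have "?T x = ?T p + scaleC (a 0) q" unfolding xpq by (simp add: linear_simps[OF blT] Tq)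
    then have "cinner (?T x) x = cinner (?T p) p + a 0 * of_real ((norm q)\<^sup>2)"
      by (simp add: xpq cinner_add_left cinner_add_right cinner_scaleC_left qp cinner_self_norm)
    then have "skew \<delta> (cinner (?T x) x) = skew \<delta> (cinner (?T p) p) + skew \<delta> (a 0) * of_real ((norm q)\<^sup>2)"
      by (simp add: skew_def algebra_simps)
    then have "cmod (skew \<delta> (cinner (?T x) x)) \<le> cmod (skew \<delta> (cinner (?T p) p)) + cmod (skew \<delta> (a 0)) * (norm q)\<^sup>2"
      using norm_triangle_ineq[of "skew \<delta> (cinner (?T p) p)" "skew \<delta> (a 0) * of_real ((norm q)\<^sup>2)"]
      by (simp add: norm_mult norm_power)
    also have "\<dots> \<le> \<rho> * (norm p)\<^sup>2 + \<rho> * (norm q)\<^sup>2"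
      using onM[OF p(1)] \<eta>(2) by (intro add_mono mult_right_mono) (auto simp: \<rho>_def)
    also have "\<dots> = \<rho> * (norm x)\<^sup>2"
      unfolding xpq norm_add_sq by (simp add: qp algebra_simps)
    finally show ?thesis using x by simp
  qed
  have "numerical_range ?T \<subseteq> {z. cmod (skew \<delta> z) \<le> \<rho>}"
    unfolding numerical_range_def using bound by auto
  then have "closure (numerical_range ?T) \<subseteq> {z. cmod (skew \<delta> z) \<le> \<rho>}"
    by (rule closure_minimal)
      (intro closed_Collect_le continuous_intros linear_continuous_on[OF bounded_linear_skew])
  also have "\<dots> \<subseteq> G_delta \<delta>"
    using \<eta>(1) by (auto simp: G_delta_iff[OF \<delta>] \<rho>_def)
  finally show ?thesis .
qed

lemma quad_bound: "cmod (quad n g c c) \<le> (\<Sum>i\<le>n. \<Sum>j\<le>n. cmod (g i j)) * (\<Sum>i\<le>n. (cmod (c i))\<^sup>2)"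
proof -
  define S where "S = (\<Sum>i\<le>n. (cmod (c i))\<^sup>2)"
  have S: "cmod (c i) \<le> sqrt S" if "i \<le> n" for i
    using member_le_sum[of i "{..n}" "\<lambda>j. (cmod (c j))\<^sup>2"] that by (intro real_le_rsqrt) (auto simp: S_def)
  have S0: "S \<ge> 0" unfolding S_def by (rule sum_nonneg) simp
  have "cmod (quad n g c c) \<le> (\<Sum>i\<le>n. \<Sum>j\<le>n. cmod (c i * cnj (c j) * g i j))"
    unfolding quad_def by (intro order_trans[OF norm_sum] sum_mono order_refl)
  also have "\<dots> \<le> (\<Sum>i\<le>n. \<Sum>j\<le>n. cmod (g i j) * S)"
  proof (intro sum_mono)
    fix i j assume "i \<in> {..n}" "j \<in> {..n}"
    then have "cmod (c i) * cmod (c j) \<le> sqrt S * sqrt S" using S0 by (intro mult_mono S) auto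
    then have "cmod (c i) * cmod (c j) \<le> S" using S0 by simp
    then show "cmod (c i * cnj (c j) * g i j) \<le> cmod (g i j) * S"
      by (simp add: norm_mult mult.commute[of "cmod (g i j)"] mult_right_mono)
  qed
  finally show ?thesis by (simp only: S_def sum_distrib_right)
qed

lemma quad_add_diag:
  "quad n (\<lambda>i j. g i j + (if i = j then of_real \<epsilon> else 0)) c c' = quad n g c c' + of_real \<epsilon> * (\<Sum>i\<le>n. c i * cnj (c' i))"
proof -
  have "(\<Sum>j\<le>n. c i * cnj (c' j) * (g i j + (if i = j then of_real \<epsilon> else 0)))
     = (\<Sum>j\<le>n. c i * cnj (c' j) * g i j) + of_real \<epsilon> * (c i * cnj (c' i))" if "i \<le> n" for i
  proof -
    have "(\<Sum>j\<le>n. c i * cnj (c' j) * (if i = j then of_real \<epsilon> else 0)) = (\<Sum>j\<le>n. if j = i then of_real \<epsilon> * (c i * cnj (c' i)) else 0)"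
      by (intro sum.cong) auto
    then show ?thesis using that by (simp add: distrib_left sum.distrib)
  qed
  then have "quad n (\<lambda>i j. g i j + (if i = j then of_real \<epsilon> else 0)) c c'
     = (\<Sum>i\<le>n. (\<Sum>j\<le>n. c i * cnj (c' j) * g i j) + of_real \<epsilon> * (c i * cnj (c' i)))"
    unfolding quad_def by (intro sum.cong) auto
  then show ?thesis by (simp add: quad_def sum.distrib sum_distrib_left)
qed

text \<open>The perturbed matrix g + \<epsilon> I is realized by vectors that are independent with a
  quantitative bound, so the diagonal operator with eigenvalues \<open>l i\<close> exists, and its
  numerical range has room to spare. Contractivity of the function of this operator on the sum of
  the \<open>v i\<close> is the claim up to a multiple of \<epsilon>.\<close>

lemma contractive_gram:
  fixes e :: "nat \<Rightarrow> 'h::chilbert"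
  assumes \<delta>: "0 < \<delta>" "\<delta> < 1" and e: "orthonormal e"
    and f: "f holomorphic_on G_delta \<delta>"
    and contr: "\<forall>T::'h \<Rightarrow> 'h. bounded_clinear_op T \<and> closure (numerical_range T) \<subseteq> G_delta \<delta>
            \<longrightarrow> onorm (dunford f (G_delta \<delta>) T) \<le> 1"
    and l: "\<And>i. l i \<in> G_delta \<delta>"
    and herm: "\<And>i j. g j i = cnj (g i j)"
    and W: "\<And>c. cmod (skew \<delta> (quad n g (\<lambda>i. l i * c i) c)) \<le> (1 - \<delta>\<^sup>2) * Re (quad n g c c)"
  shows "Re (quad n g (\<lambda>i. f (l i)) (\<lambda>i. f (l i))) \<le> Re (quad n g (\<lambda>_. 1) (\<lambda>_. 1))"
proof -
  define \<kappa> where "\<kappa> = 1 - \<delta>\<^sup>2"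
  have \<kappa>: "\<kappa> > 0" using \<delta> by (simp add: \<kappa>_def power_less_one_iff)
  define S where "S c = (\<Sum>i\<le>n. (cmod (c i))\<^sup>2)" for c :: "nat \<Rightarrow> complex"
  have S0: "S c \<ge> 0" for c unfolding S_def by (rule sum_nonneg) simp
  \<comment> \<open>Positivity of \<open>g\<close> is contained in \<open>W\<close>, whose left-hand
    side is nonnegative.\<close>
  have pos: "0 \<le> Re (quad n g c c)" for c
    using order_trans[OF norm_ge_zero W[of c]] \<kappa> by (simp add: \<kappa>_def[symmetric] zero_le_mult_iff)
  have key: "Re (quad n g (\<lambda>i. f (l i)) (\<lambda>i. f (l i))) \<le> Re (quad n g (\<lambda>_. 1) (\<lambda>_. 1)) + \<epsilon> * (real n + 1)"
    if \<epsilon>: "\<epsilon> > 0" for \<epsilon> :: real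
  proof -
    define g' where "g' i j = g i j + (if i = j then of_real \<epsilon> else 0)" for i j
    have g': "quad n g' c c' = quad n g c c' + of_real \<epsilon> * (\<Sum>i\<le>n. c i * cnj (c' i))" for c c'
      unfolding g'_def by (rule quad_add_diag)
    have sq: "(\<Sum>i\<le>n. c i * cnj (c i)) = of_real (S c)" for c
      unfolding S_def by (simp only: complex_norm_square[symmetric] of_real_sum)
    have Re_g': "Re (quad n g' c c) = Re (quad n g c c) + \<epsilon> * S c" for c
      unfolding g' sq by simp
    have "psd (\<lambda>p q. if p \<le> n \<and> q \<le> n then g' p q else 0)"
    proof (rule psd_of_quad)
      show "g' j i = cnj (g' i j)" for i j using herm[of j i] by (simp add: g'_def)
      show "0 \<le> Re (quad n g' c c)" for c using pos[of c] S0[of c] \<epsilon> by (simp add: Re_g')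
    qed
    from psd_realization_nat[OF e this] obtain v :: "nat \<Rightarrow> 'h" where
      v: "\<And>p q. cinner (v p) (v q) = (if p \<le> n \<and> q \<le> n then g' p q else 0)" by blast
    have cin: "cinner (\<Sum>i\<le>n. scaleC (c i) (v i)) (\<Sum>i\<le>n. scaleC (c' i) (v i)) = quad n g' c c'" for c c'
    proof -
      have "cinner (\<Sum>i\<le>n. scaleC (c i) (v i)) (\<Sum>i\<le>n. scaleC (c' i) (v i))
         = (\<Sum>j\<le>n. \<Sum>i\<le>n. c i * cnj (c' j) * cinner (v i) (v j))"
        by (simp only: cinner.sum_left cinner.sum_right cinner_scaleC_left cinner_scaleC_right
            sum_distrib_left) (simp add: mult_ac)
      also have "\<dots> = (\<Sum>i\<le>n. \<Sum>j\<le>n. c i * cnj (c' j) * cinner (v i) (v j))" by (rule sum.swap)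
      also have "\<dots> = quad n g' c c'" unfolding quad_def by (intro sum.cong) (auto simp: v)
      finally show ?thesis .
    qed
    have nrm: "(norm (\<Sum>i\<le>n. scaleC (c i) (v i)))\<^sup>2 = Re (quad n g c c) + \<epsilon> * S c" for c
      unfolding Re_cinner_self[symmetric] cin by (rule Re_g')
    have "\<epsilon> * (\<Sum>i\<le>n. (cmod (c i))\<^sup>2) \<le> (norm (\<Sum>i\<le>n. scaleC (c i) (v i)))\<^sup>2" for c
      unfolding nrm using pos[of c] by (simp add: S_def)
    from dual_family[OF \<epsilon> this] obtain d where bi: "biorthogonal n v d"
      and dM: "\<And>i. i \<le> n \<Longrightarrow> d i \<in> closure (range (\<lambda>c. \<Sum>i\<le>n. scaleC (c i) (v i)))" by metis
    interpret biorthogonal n v d by (rule bi)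
    define \<eta> where "\<eta> = Min ((\<lambda>i. \<kappa> - cmod (skew \<delta> (l i))) ` {..n})"
    have \<eta>: "\<eta> > 0" "\<And>i. i \<le> n \<Longrightarrow> cmod (skew \<delta> (l i)) \<le> \<kappa> - \<eta>"
    proof -
      show "\<eta> > 0" unfolding \<eta>_def using l G_delta_iff[OF \<delta>] by (simp add: \<kappa>_def)
      show "cmod (skew \<delta> (l i)) \<le> \<kappa> - \<eta>" if "i \<le> n" for i
      proof -
        have "\<eta> \<le> \<kappa> - cmod (skew \<delta> (l i))" unfolding \<eta>_def using that by (intro Min_le) auto
        then show ?thesis by simp
      qed
    qed
    define C where "C = (\<Sum>i\<le>n. \<Sum>j\<le>n. cmod (g i j))"
    have C0: "C \<ge> 0" unfolding C_def by (intro sum_nonneg) simp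
    \<comment> \<open>Only the \<epsilon>-part of the form has the margin \<eta>. The total form is
      at most (C + \<epsilon>) S, so this \<eta>' is what is left relative to the whole
      norm.\<close>
    define \<eta>' where "\<eta>' = \<epsilon> * \<eta> / (C + \<epsilon>)"
    have \<eta>': "0 < \<eta>'" "\<eta>' \<le> \<eta>" using \<eta>(1) \<epsilon> C0 by (auto simp: \<eta>'_def field_simps)
    have T: "closure (numerical_range (diag_op n v d l)) \<subseteq> G_delta \<delta>"
    proof (rule numerical_range_diag_op[OF \<delta> bi dM \<eta>'(1)])
      show "cmod (skew \<delta> (l 0)) \<le> 1 - \<delta>\<^sup>2 - \<eta>'" using \<eta>(2)[of 0] \<eta>'(2) by (simp add: \<kappa>_def)
      fix c :: "nat \<Rightarrow> complex"
      have "skew \<delta> (quad n g' (\<lambda>i. l i * c i) c)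
         = skew \<delta> (quad n g (\<lambda>i. l i * c i) c) + of_real \<epsilon> * (\<Sum>i\<le>n. skew \<delta> (l i) * of_real ((cmod (c i))\<^sup>2))"
      proof -
        have "(\<Sum>i\<le>n. l i * c i * cnj (c i)) = (\<Sum>i\<le>n. l i * of_real ((cmod (c i))\<^sup>2))"
          by (simp only: complex_norm_square mult.assoc)
        then show ?thesis
          unfolding g' skew_def by (simp add: algebra_simps sum_subtractf sum_distrib_left)
      qed
      then have "cmod (skew \<delta> (quad n g' (\<lambda>i. l i * c i) c))
         \<le> \<kappa> * Re (quad n g c c) + \<epsilon> * cmod (\<Sum>i\<le>n. skew \<delta> (l i) * of_real ((cmod (c i))\<^sup>2))"
        using W[of c] \<epsilon> norm_triangle_ineq[of "skew \<delta> (quad n g (\<lambda>i. l i * c i) c)"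
            "of_real \<epsilon> * (\<Sum>i\<le>n. skew \<delta> (l i) * of_real ((cmod (c i))\<^sup>2))"]
        by (simp add: norm_mult \<kappa>_def)
      also have "cmod (\<Sum>i\<le>n. skew \<delta> (l i) * of_real ((cmod (c i))\<^sup>2)) \<le> (\<Sum>i\<le>n. (\<kappa> - \<eta>) * (cmod (c i))\<^sup>2)"
        by (intro order_trans[OF norm_sum] sum_mono) (simp add: norm_mult norm_power mult_right_mono \<eta>(2))
      also have "(\<Sum>i\<le>n. (\<kappa> - \<eta>) * (cmod (c i))\<^sup>2) = (\<kappa> - \<eta>) * S c"
        by (simp add: S_def sum_distrib_left)
      finally have le: "cmod (skew \<delta> (quad n g' (\<lambda>i. l i * c i) c)) \<le> \<kappa> * Re (quad n g c c) + \<epsilon> * ((\<kappa> - \<eta>) * S c)"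
        using \<epsilon> by simp
      have "Re (quad n g c c) \<le> C * S c"
        using order_trans[OF complex_Re_le_cmod quad_bound[of n g c]] by (simp add: C_def S_def)
      then have "\<eta>' * (Re (quad n g c c) + \<epsilon> * S c) \<le> \<eta>' * ((C + \<epsilon>) * S c)"
        using \<eta>'(1) by (intro mult_left_mono) (auto simp: distrib_right)
      also have "\<dots> = \<epsilon> * \<eta> * S c" using C0 \<epsilon> by (simp add: \<eta>'_def)
      finally have "cmod (skew \<delta> (quad n g' (\<lambda>i. l i * c i) c)) \<le> (\<kappa> - \<eta>') * (Re (quad n g c c) + \<epsilon> * S c)"
        using le by (simp add: algebra_simps)
      then show "cmod (skew \<delta> (cinner (\<Sum>i\<le>n. scaleC (l i * c i) (v i)) (\<Sum>i\<le>n. scaleC (c i) (v i))))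
        \<le> (1 - \<delta>\<^sup>2 - \<eta>') * (norm (\<Sum>i\<le>n. scaleC (c i) (v i)))\<^sup>2"
        unfolding cin nrm \<kappa>_def .
    qed
    have D: "dunford f (G_delta \<delta>) (diag_op n v d l) = diag_op n v d (\<lambda>i. f (l i))"
      using l by (intro dunford_diag_op_G_delta[OF \<delta> f]) auto
    have bl: "bounded_linear (diag_op n v d (\<lambda>i. f (l i)))"
      using bounded_clinear_diag_op by (simp add: bounded_clinear_op_def)
    have on: "onorm (diag_op n v d (\<lambda>i. f (l i))) \<le> 1"
      using contr T bounded_clinear_diag_op unfolding D[symmetric] by blast
    \<comment> \<open>The coefficients of \<open>x\<close> are 1 and those of its image are
      \<open>f (l i)\<close>, which are the two forms being compared.\<close>
    define x where "x = (\<Sum>i\<le>n. scaleC 1 (v i))"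
    have fx: "diag_op n v d (\<lambda>i. f (l i)) x = (\<Sum>i\<le>n. scaleC (f (l i)) (v i))"
      by (simp add: x_def linear_sum[OF bounded_linear.linear[OF bl]] scaleC_one diag_op_eigen)
    have "norm (diag_op n v d (\<lambda>i. f (l i)) x) \<le> onorm (diag_op n v d (\<lambda>i. f (l i))) * norm x"
      by (rule onorm[OF bl])
    also have "\<dots> \<le> 1 * norm x" using on by (intro mult_right_mono) auto
    finally have "norm (\<Sum>i\<le>n. scaleC (f (l i)) (v i)) \<le> norm x" by (simp add: fx)
    then have "(norm (\<Sum>i\<le>n. scaleC (f (l i)) (v i)))\<^sup>2 \<le> (norm (\<Sum>i\<le>n. scaleC 1 (v i)))\<^sup>2"
      unfolding x_def by (intro power_mono) auto
    then show ?thesis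
      unfolding nrm using S0[of "\<lambda>i. f (l i)"] \<epsilon> by (simp add: S_def[of "\<lambda>_. 1"]) (smt (verit) mult_nonneg_nonneg)
  qed
  show ?thesis
  proof (rule field_le_epsilon)
    fix \<epsilon> :: real assume "\<epsilon> > 0"
    then have "\<epsilon> / (real n + 1) > 0" by simp
    from key[OF this] show "Re (quad n g (\<lambda>i. f (l i)) (\<lambda>i. f (l i))) \<le> Re (quad n g (\<lambda>_. 1) (\<lambda>_. 1)) + \<epsilon>" by simp
  qed
qed

section \<open>Toeplitz kernels and the model\<close>

text \<open>\<open>B k i j\<close> stands for \<open>cinner (U^k (a i)) (a j)\<close>, where \<open>U\<close> is unitary; \<open>toeplitz_pencil\<close>
  is the right-hand side of the model equation in these terms.\<close>

definition toeplitz_psd :: "(int \<Rightarrow> nat \<Rightarrow> nat \<Rightarrow> complex) \<Rightarrow> bool" where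
  "toeplitz_psd B \<longleftrightarrow> psd (\<lambda>p q. B (fst p - fst q) (snd p) (snd q))"

definition toeplitz_pencil ::
    "real \<Rightarrow> (nat \<Rightarrow> complex) \<Rightarrow> (int \<Rightarrow> nat \<Rightarrow> nat \<Rightarrow> complex) \<Rightarrow> nat \<Rightarrow> nat \<Rightarrow> complex" where
  "toeplitz_pencil \<delta> l B i j = (2 - 2 * (of_real \<delta>)\<^sup>2) * B 0 i j
     - (cnj (l j) - of_real \<delta> * l i) * B 1 i j - (l i - of_real \<delta> * cnj (l j)) * B (-1) i j"

lemma toeplitz_psd_herm: "toeplitz_psd B \<Longrightarrow> B (- k) j i = cnj (B k i j)"
  unfolding toeplitz_psd_def by (drule psd_herm[where p = "(k, i)" and q = "(0, j)"]) simp

lemma toeplitz_pencil_herm: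
  assumes "toeplitz_psd B"
  shows "toeplitz_pencil \<delta> l B j i = cnj (toeplitz_pencil \<delta> l B i j)"
  using toeplitz_psd_herm[OF assms, of 0 j i] toeplitz_psd_herm[OF assms, of 1 j i]
    toeplitz_psd_herm[OF assms, of "-1" j i]
  by (simp add: toeplitz_pencil_def)

section \<open>The cone of Toeplitz-positive kernels\<close>

lemma toeplitz_psd_add:
  assumes "toeplitz_psd B" "toeplitz_psd B'"
  shows "toeplitz_psd (\<lambda>k i j. B k i j + B' k i j)"
  unfolding toeplitz_psd_def psd_def
proof (intro conjI allI)
  note A = assms[unfolded toeplitz_psd_def]
  show "B (fst q - fst p) (snd q) (snd p) + B' (fst q - fst p) (snd q) (snd p)
     = cnj (B (fst p - fst q) (snd p) (snd q) + B' (fst p - fst q) (snd p) (snd q))" for p q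
    using psd_herm[OF A(1), of q p] psd_herm[OF A(2), of q p] by simp
  show "0 \<le> Re (\<Sum>a<n. \<Sum>b<n. z a * cnj (z b) * (B (fst (p a) - fst (p b)) (snd (p a)) (snd (p b))
      + B' (fst (p a) - fst (p b)) (snd (p a)) (snd (p b))))" for n :: nat and p z
    using psd_pos[OF A(1), where n = n and z = z and p = p] psd_pos[OF A(2), where n = n and z = z and p = p]
    by (simp add: distrib_left sum.distrib)
qed

lemma toeplitz_psd_scale:
  assumes "toeplitz_psd B" "s \<ge> 0"
  shows "toeplitz_psd (\<lambda>k i j. of_real s * B k i j)"
  unfolding toeplitz_psd_def psd_def
proof (intro conjI allI)
  note A = assms(1)[unfolded toeplitz_psd_def]
  show "of_real s * B (fst q - fst p) (snd q) (snd p) = cnj (of_real s * B (fst p - fst q) (snd p) (snd q))" for p q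
    using psd_herm[OF A, of q p] by simp
  show "0 \<le> Re (\<Sum>a<n. \<Sum>b<n. z a * cnj (z b) * (of_real s * B (fst (p a) - fst (p b)) (snd (p a)) (snd (p b))))"
    for n :: nat and p z
  proof -
    have "(\<Sum>a<n. \<Sum>b<n. z a * cnj (z b) * (of_real s * B (fst (p a) - fst (p b)) (snd (p a)) (snd (p b))))
      = of_real s * (\<Sum>a<n. \<Sum>b<n. z a * cnj (z b) * B (fst (p a) - fst (p b)) (snd (p a)) (snd (p b)))"
      by (simp add: sum_distrib_left mult.left_commute)
    then show ?thesis
      using mult_nonneg_nonneg[OF assms(2) psd_pos[OF A, where n = n and z = z and p = p]] by simp
  qed
qed

lemma toeplitz_psd_zero: "toeplitz_psd (\<lambda>k i j. 0)"
  by (simp add: toeplitz_psd_def psd_def)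

text \<open>The kernel of the scalar unitary \<omega> in dimension one, with the numbers
  \<open>c i\<close> as vectors. Positivity of the separating functional on these kernels is what
  yields the numerical range condition.\<close>

lemma toeplitz_psd_rank_one:
  assumes \<omega>: "cmod \<omega> = 1"
  shows "toeplitz_psd (\<lambda>k i j. \<omega> powi k * (c i * cnj (c j)))"
proof -
  have "\<omega> \<noteq> 0" using \<omega> by auto
  then have diff: "\<omega> powi (k - m) = \<omega> powi k * cnj (\<omega> powi m)" for k m
    using divide_conv_cnj[of "\<omega> powi m" "\<omega> powi k"] \<omega> by (simp add: power_int_diff norm_power_int)
  show ?thesis
    unfolding toeplitz_psd_def psd_def diff
  proof (intro conjI allI)
    fix n :: nat and p :: "nat \<Rightarrow> int \<times> nat" and z :: "nat \<Rightarrow> complex"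
    define X where "X = (\<Sum>a<n. z a * \<omega> powi (fst (p a)) * c (snd (p a)))"
    have "(\<Sum>a<n. \<Sum>b<n. z a * cnj (z b) * (\<omega> powi fst (p a) * cnj (\<omega> powi fst (p b)) * (c (snd (p a)) * cnj (c (snd (p b))))))
      = X * cnj X"
      unfolding X_def cnj_sum sum_product by (simp add: mult_ac)
    then show "0 \<le> Re (\<Sum>a<n. \<Sum>b<n. z a * cnj (z b) * (\<omega> powi fst (p a) * cnj (\<omega> powi fst (p b)) * (c (snd (p a)) * cnj (c (snd (p b))))))"
      by simp
  qed simp
qed

text \<open>Cuts an approximate kernel down to the finitely many points where it is controlled, so
  that bounds hold at all indices.\<close>

lemma toeplitz_psd_restrict:
  assumes "toeplitz_psd B"
  shows "toeplitz_psd (\<lambda>k i j. if i \<in> I \<and> j \<in> I then B k i j else 0)"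
  unfolding toeplitz_psd_def psd_def
proof (intro conjI allI)
  note A = assms[unfolded toeplitz_psd_def]
  show "(if snd q \<in> I \<and> snd p \<in> I then B (fst q - fst p) (snd q) (snd p) else 0)
     = cnj (if snd p \<in> I \<and> snd q \<in> I then B (fst p - fst q) (snd p) (snd q) else 0)" for p q
    using psd_herm[OF A, of q p] by auto
  show "0 \<le> Re (\<Sum>a<n. \<Sum>b<n. z a * cnj (z b) * (if snd (p a) \<in> I \<and> snd (p b) \<in> I
       then B (fst (p a) - fst (p b)) (snd (p a)) (snd (p b)) else 0))" for n :: nat and p z
  proof -
    define w where "w a = (if snd (p a) \<in> I then z a else 0)" for a
    have "(\<Sum>a<n. \<Sum>b<n. z a * cnj (z b) * (if snd (p a) \<in> I \<and> snd (p b) \<in> I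
       then B (fst (p a) - fst (p b)) (snd (p a)) (snd (p b)) else 0))
      = (\<Sum>a<n. \<Sum>b<n. w a * cnj (w b) * B (fst (p a) - fst (p b)) (snd (p a)) (snd (p b)))"
      by (intro sum.cong refl) (auto simp: w_def)
    then show ?thesis using psd_pos[OF A, where n = n and z = w and p = p] by simp
  qed
qed

text \<open>Diagonal entries at (k, i) depend only on \<open>i\<close>, so Cauchy-Schwarz bounds all
  powers \<open>k\<close> at once.\<close>

lemma toeplitz_psd_entry_bound:
  assumes "toeplitz_psd B"
  shows "(cmod (B k i j))\<^sup>2 \<le> Re (B 0 i i) * Re (B 0 j j)" and "0 \<le> Re (B 0 i i)"
  using psd_entry_bound[OF assms[unfolded toeplitz_psd_def], of "(k, i)" "(0, j)"]
    psd_diag(2)[OF assms[unfolded toeplitz_psd_def], of "(0, i)"] by simp_all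

text \<open>Kernel form of the coercivity estimate; |B 1 i i| at most B 0 i i replaces the fact that
  \<open>U\<close> has norm 1.\<close>

lemma toeplitz_pencil_coercive:
  assumes B: "toeplitz_psd B"
  shows "2 * (1 - \<delta>\<^sup>2 - cmod (skew \<delta> (l i))) * Re (B 0 i i) \<le> Re (toeplitz_pencil \<delta> l B i i)"
proof -
  define s where "s = skew \<delta> (l i)"
  have real: "B 0 i i = of_real (Re (B 0 i i))"
    using psd_diag(1)[OF B[unfolded toeplitz_psd_def], of "(0, i)"] by simp
  have "toeplitz_pencil \<delta> l B i i = (2 - 2 * (of_real \<delta>)\<^sup>2) * B 0 i i - s * B 1 i i - cnj (s * B 1 i i)"
    using toeplitz_psd_herm[OF B, of 1 i i] by (simp add: toeplitz_pencil_def s_def skew_def)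
  also have "Re \<dots> = 2 * (1 - \<delta>\<^sup>2) * Re (B 0 i i) - 2 * Re (s * B 1 i i)"
    by (subst real) (simp add: algebra_simps flip: of_real_power)
  finally have "Re (toeplitz_pencil \<delta> l B i i) = 2 * (1 - \<delta>\<^sup>2) * Re (B 0 i i) - 2 * Re (s * B 1 i i)" .
  moreover have "cmod (B 1 i i) \<le> Re (B 0 i i)"
    by (rule power2_le_imp_le)
      (use toeplitz_psd_entry_bound(1)[OF B, of 1 i i] toeplitz_psd_entry_bound(2)[OF B, of i]
        in \<open>simp_all add: power2_eq_square\<close>)
  then have "Re (s * B 1 i i) \<le> cmod s * Re (B 0 i i)"
    by (intro order_trans[OF complex_Re_le_cmod]) (simp add: norm_mult mult_left_mono)
  ultimately show ?thesis by (simp add: s_def algebra_simps)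
qed

lemma finite_model_approximation:
  fixes e :: "nat \<Rightarrow> 'h::chilbert"
  assumes \<delta>: "0 < \<delta>" "\<delta> < 1" and e: "orthonormal e"
    and f: "f holomorphic_on G_delta \<delta>"
    and contr: "\<forall>T::'h \<Rightarrow> 'h. bounded_clinear_op T \<and> closure (numerical_range T) \<subseteq> G_delta \<delta>
            \<longrightarrow> onorm (dunford f (G_delta \<delta>) T) \<le> 1"
    and l: "\<And>i. l i \<in> G_delta \<delta>" and \<epsilon>: "\<epsilon> > 0"
  obtains B where "toeplitz_psd B"
    "\<And>i j. i \<le> n \<Longrightarrow> j \<le> n \<Longrightarrow> cmod (toeplitz_pencil \<delta> l B i j - (1 - cnj (f (l j)) * f (l i))) < \<epsilon>"
proof -
  \<comment> \<open>Embeds the matrices isometrically into \<open>'h\<close>, one orthonormal vector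
    per entry, so that cone separation in \<open>'h\<close> applies and entries are recovered as
    inner products.\<close>
  define E where "E A = (\<Sum>i\<le>n. \<Sum>j\<le>n. scaleC (A i j) (e (prod_encode (i, j))))" for A :: "nat \<Rightarrow> nat \<Rightarrow> complex"
  have E_cinner: "cinner (E A) L = (\<Sum>i\<le>n. \<Sum>j\<le>n. A i j * cinner (e (prod_encode (i, j))) L)" for A L
    by (simp add: E_def cinner.sum_left cinner_scaleC_left)
  have E_entry: "cinner (E A) (e (prod_encode (p, q))) = A p q" if "p \<le> n" "q \<le> n" for A p q
  proof -
    have "cinner (E A) (e (prod_encode (p, q))) = (\<Sum>i\<le>n. \<Sum>j\<le>n. if j = q then (if i = p then A i j else 0) else 0)"
      unfolding E_cinner using e by (intro sum.cong refl) (auto simp: orthonormal_def prod_encode_eq)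
    then show ?thesis using that by simp
  qed
  have norm_e: "norm (e k) = 1" for k using e by (intro norm_eq_1_chilbert) (simp add: orthonormal_def)
  define K where "K = {E (toeplitz_pencil \<delta> l B) |B. toeplitz_psd B}"
  define R where "R i j = 1 - cnj (f (l j)) * f (l i)" for i j
  have "E R \<in> closure K"
  proof (rule ccontr)
    assume not: "E R \<notin> closure K"
    have Kadd: "x + y \<in> K" if "x \<in> K" "y \<in> K" for x y
    proof -
      from that(1)[unfolded K_def] that(2)[unfolded K_def]
      obtain B B' where B: "toeplitz_psd B" "toeplitz_psd B'"
        "x = E (toeplitz_pencil \<delta> l B)" "y = E (toeplitz_pencil \<delta> l B')"
        by (elim CollectE exE conjE) (rule that)
      have "x + y = E (toeplitz_pencil \<delta> l (\<lambda>k i j. B k i j + B' k i j))"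
        unfolding B E_def sum.distrib[symmetric] scaleC_add_left[symmetric]
        by (intro sum.cong refl arg_cong[where f = "\<lambda>s. scaleC s _"]) (simp add: toeplitz_pencil_def algebra_simps)
      then show ?thesis using toeplitz_psd_add[OF B(1,2)] unfolding K_def by blast
    qed
    have Kscale: "s *\<^sub>R x \<in> K" if "x \<in> K" "s \<ge> 0" for x s
    proof -
      from that(1)[unfolded K_def] obtain B where B: "toeplitz_psd B" "x = E (toeplitz_pencil \<delta> l B)"
        by (elim CollectE exE conjE) (rule that)
      have "s *\<^sub>R x = E (toeplitz_pencil \<delta> l (\<lambda>k i j. of_real s * B k i j))"
        unfolding B E_def scaleR_scaleC scaleC.sum_right scaleC_scaleC
        by (intro sum.cong refl arg_cong[where f = "\<lambda>s. scaleC s _"]) (simp add: toeplitz_pencil_def algebra_simps)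
      then show ?thesis using toeplitz_psd_scale[OF B(1) that(2)] unfolding K_def by blast
    qed
    have "E (toeplitz_pencil \<delta> l (\<lambda>k i j. 0)) = 0" by (simp add: E_def toeplitz_pencil_def)
    then have K0: "0 \<in> K" unfolding K_def using toeplitz_psd_zero by (metis (mono_tags, lifting) mem_Collect_eq)
    from separate_cone[OF Kadd Kscale K0 not] obtain L where
      L: "\<And>y. y \<in> K \<Longrightarrow> 0 \<le> Re (cinner y L)" "Re (cinner (E R) L) < 0" by blast
    define h where "h i j = cinner (e (prod_encode (i, j))) L" for i j
    \<comment> \<open>The Hermitian part of the functional; it gives the same real pairing with
      Hermitian matrices, and all matrices paired with it are Hermitian.\<close>
    define g where "g i j = (h i j + cnj (h j i)) / 2" for i j
    have herm: "g j i = cnj (g i j)" for i j by (simp add: g_def)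
    have EL: "Re (cinner (E A) L) = Re (\<Sum>i\<le>n. \<Sum>j\<le>n. A i j * g i j)" if A: "\<And>i j. A j i = cnj (A i j)" for A
    proof -
      define Y where "Y = (\<Sum>i\<le>n. \<Sum>j\<le>n. A i j * h i j)"
      have "cnj Y = (\<Sum>i\<le>n. \<Sum>j\<le>n. A j i * cnj (h i j))" by (simp add: Y_def A[symmetric])
      also have "\<dots> = (\<Sum>i\<le>n. \<Sum>j\<le>n. A i j * cnj (h j i))" by (rule sum.swap)
      finally have "(\<Sum>i\<le>n. \<Sum>j\<le>n. A i j * g i j) = (Y + cnj Y) / 2"
        by (simp add: Y_def g_def distrib_left sum.distrib flip: sum_divide_distrib)
      then have "Re (\<Sum>i\<le>n. \<Sum>j\<le>n. A i j * g i j) = Re ((Y + cnj Y) / 2)" by (rule arg_cong)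
      also have "\<dots> = Re Y" by simp
      finally show ?thesis by (simp only: E_cinner Y_def h_def)
    qed
    have "cmod (skew \<delta> (quad n g (\<lambda>i. l i * c i) c)) \<le> (1 - \<delta>\<^sup>2) * Re (quad n g c c)" for c
    proof -
      define x where "x = quad n g (\<lambda>i. l i * c i) c"
      define s where "s = skew \<delta> x"
      \<comment> \<open>The phase is aligned with \<open>s\<close>, so that the single kernel built
        from it gives the bound on the modulus and not merely on a real part.\<close>
      obtain \<omega> where \<omega>: "cmod \<omega> = 1" "\<omega> * s = of_real (cmod s)"
      proof (cases "s = 0")
        case False
        have "cnj s / of_real (cmod s) * s = of_real (cmod s)"
          using False complex_norm_square[of s] by (simp add: mult.commute[of "cnj s"] power2_eq_square flip: complex_norm_square)
        then show ?thesis using False by (intro that[of "cnj s / of_real (cmod s)"]) (auto simp: norm_divide)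
      qed (use that[of 1] in simp)
      define B where "B = (\<lambda>k i j. \<omega> powi k * (c i * cnj (c j)))"
      have B: "toeplitz_psd B" unfolding B_def by (rule toeplitz_psd_rank_one[OF \<omega>(1)])
      have cx: "cnj x = quad n g c (\<lambda>i. l i * c i)" unfolding x_def by (rule cnj_quad) (rule herm)
      have inv: "\<omega> powi (-1) = cnj \<omega>"
        using divide_conv_cnj[OF \<omega>(1), of 1] by (simp add: power_int_minus inverse_eq_divide)
      have "toeplitz_pencil \<delta> l B i j * g i j = (2 - 2 * (of_real \<delta>)\<^sup>2) * (c i * cnj (c j) * g i j)
         - \<omega> * (c i * cnj (l j * c j) * g i j - of_real \<delta> * (l i * c i * cnj (c j) * g i j))
         - cnj \<omega> * (l i * c i * cnj (c j) * g i j - of_real \<delta> * (c i * cnj (l j * c j) * g i j))" for i j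
        unfolding toeplitz_pencil_def B_def inv by (simp add: algebra_simps)
      then have "(\<Sum>i\<le>n. \<Sum>j\<le>n. toeplitz_pencil \<delta> l B i j * g i j)
         = (2 - 2 * (of_real \<delta>)\<^sup>2) * quad n g c c - \<omega> * (cnj x - of_real \<delta> * x) - cnj \<omega> * (x - of_real \<delta> * cnj x)"
        unfolding cx unfolding x_def quad_def by (simp add: sum_subtractf sum_distrib_left[symmetric])
      also have "\<dots> = of_real (2 * (1 - \<delta>\<^sup>2)) * quad n g c c - \<omega> * s - cnj (\<omega> * s)"
        by (simp add: s_def skew_def algebra_simps)
      also have "Re \<dots> = 2 * (1 - \<delta>\<^sup>2) * Re (quad n g c c) - 2 * cmod s"
        unfolding \<omega>(2) by simp
      finally have "Re (\<Sum>i\<le>n. \<Sum>j\<le>n. toeplitz_pencil \<delta> l B i j * g i j) = 2 * (1 - \<delta>\<^sup>2) * Re (quad n g c c) - 2 * cmod s" .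
      moreover have "0 \<le> Re (cinner (E (toeplitz_pencil \<delta> l B)) L)" using L(1) B unfolding K_def by blast
      then have "0 \<le> Re (\<Sum>i\<le>n. \<Sum>j\<le>n. toeplitz_pencil \<delta> l B i j * g i j)"
        unfolding EL[OF toeplitz_pencil_herm[OF B]] .
      ultimately have "cmod s \<le> (1 - \<delta>\<^sup>2) * Re (quad n g c c)" by linarith
      then show ?thesis unfolding s_def x_def .
    qed
    from contractive_gram[OF \<delta> e f contr l herm this]
    have "Re (quad n g (\<lambda>i. f (l i)) (\<lambda>i. f (l i))) \<le> Re (quad n g (\<lambda>_. 1) (\<lambda>_. 1))" .
    \<comment> \<open>The pairing with the target kernel is precisely the difference shown
      nonnegative by \<open>contractive_gram\<close>, against the strict negativity of the
      functional there.\<close>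
    moreover have "(\<Sum>i\<le>n. \<Sum>j\<le>n. R i j * g i j) = quad n g (\<lambda>_. 1) (\<lambda>_. 1) - quad n g (\<lambda>i. f (l i)) (\<lambda>i. f (l i))"
      unfolding quad_def sum_subtractf[symmetric] by (intro sum.cong refl) (simp add: R_def algebra_simps)
    moreover have "Re (cinner (E R) L) = Re (\<Sum>i\<le>n. \<Sum>j\<le>n. R i j * g i j)"
      by (rule EL) (simp add: R_def mult.commute)
    ultimately have "0 \<le> Re (cinner (E R) L)" by simp
    then show False using L(2) by simp
  qed
  then obtain y where "y \<in> K" "dist y (E R) < \<epsilon>" using \<epsilon> closure_approachable by blast
  then obtain B where B: "toeplitz_psd B" "norm (E (toeplitz_pencil \<delta> l B) - E R) < \<epsilon>"
    unfolding K_def dist_norm by blast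
  have "cmod (toeplitz_pencil \<delta> l B i j - (1 - cnj (f (l j)) * f (l i))) < \<epsilon>" if "i \<le> n" "j \<le> n" for i j
  proof -
    have "cinner (E (toeplitz_pencil \<delta> l B) - E R) (e (prod_encode (i, j))) = toeplitz_pencil \<delta> l B i j - R i j"
      by (simp add: cinner.diff_left E_entry that)
    then have "cmod (toeplitz_pencil \<delta> l B i j - R i j) \<le> norm (E (toeplitz_pencil \<delta> l B) - E R) * norm (e (prod_encode (i, j)))"
      using cinner_cauchy_schwarz by metis
    then show ?thesis using B(2) by (simp add: norm_e R_def)
  qed
  then show ?thesis using that B(1) by blast
qed

text \<open>Each positivity test involves finitely many entries, so it survives pointwise
  limits.\<close>

lemma toeplitz_limit:
  assumes psd: "\<And>n :: nat. toeplitz_psd (X n)" and lim: "\<And>k i j. (\<lambda>n. X n k i j) \<longlonglongrightarrow> B k i j"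
  shows "toeplitz_psd B"
proof -
  note A = psd[unfolded toeplitz_psd_def]
  have "B (fst q - fst p) (snd q) (snd p) = cnj (B (fst p - fst q) (snd p) (snd q))" for p q
  proof (rule LIMSEQ_unique[OF lim])
    have "X n (fst q - fst p) (snd q) (snd p) = cnj (X n (fst p - fst q) (snd p) (snd q))" for n
      by (rule psd_herm[OF A])
    then have eq: "(\<lambda>n. X n (fst q - fst p) (snd q) (snd p)) = (\<lambda>n. cnj (X n (fst p - fst q) (snd p) (snd q)))"
      by (rule ext)
    show "(\<lambda>n. X n (fst q - fst p) (snd q) (snd p)) \<longlonglongrightarrow> cnj (B (fst p - fst q) (snd p) (snd q))"
      unfolding eq by (rule tendsto_cnj[OF lim])
  qed
  moreover have "0 \<le> Re (\<Sum>a<m. \<Sum>b<m. z a * cnj (z b) * B (fst (p a) - fst (p b)) (snd (p a)) (snd (p b)))"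
    for m :: nat and p z
  proof (rule tendsto_lowerbound)
    show "(\<lambda>n. Re (\<Sum>a<m. \<Sum>b<m. z a * cnj (z b) * X n (fst (p a) - fst (p b)) (snd (p a)) (snd (p b))))
      \<longlonglongrightarrow> Re (\<Sum>a<m. \<Sum>b<m. z a * cnj (z b) * B (fst (p a) - fst (p b)) (snd (p a)) (snd (p b)))"
      by (intro tendsto_intros lim)
    show "\<forall>\<^sub>F n in sequentially. 0 \<le> Re (\<Sum>a<m. \<Sum>b<m. z a * cnj (z b) * X n (fst (p a) - fst (p b)) (snd (p a)) (snd (p b)))"
      by (intro always_eventually allI psd_pos[OF A])
  qed simp
  ultimately show ?thesis unfolding toeplitz_psd_def psd_def by (intro conjI allI)
qed

text \<open>The n-th kernel is accurate to 1/(n+1) on the first n+1 points. Its entries are bounded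
  independently of n, so a diagonal subsequence converges, and the error vanishes at every fixed
  pair of points.\<close>

lemma countable_model:
  fixes e :: "nat \<Rightarrow> 'h::chilbert"
  assumes \<delta>: "0 < \<delta>" "\<delta> < 1" and e: "orthonormal e"
    and f: "f holomorphic_on G_delta \<delta>"
    and contr: "\<forall>T::'h \<Rightarrow> 'h. bounded_clinear_op T \<and> closure (numerical_range T) \<subseteq> G_delta \<delta>
            \<longrightarrow> onorm (dunford f (G_delta \<delta>) T) \<le> 1"
    and l: "\<And>i. l i \<in> G_delta \<delta>"
  obtains B where "toeplitz_psd B" "\<And>i j. toeplitz_pencil \<delta> l B i j = 1 - cnj (f (l j)) * f (l i)"
proof -
  have "\<exists>B. toeplitz_psd B \<and> (\<forall>i\<le>n. \<forall>j\<le>n.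
      cmod (toeplitz_pencil \<delta> l B i j - (1 - cnj (f (l j)) * f (l i))) < 1 / Suc n)" for n
  proof -
    have pos: "1 / real (Suc n) > 0" by simp
    obtain B where "toeplitz_psd B" "\<And>i j. i \<le> n \<Longrightarrow> j \<le> n \<Longrightarrow>
        cmod (toeplitz_pencil \<delta> l B i j - (1 - cnj (f (l j)) * f (l i))) < 1 / Suc n"
      by (rule finite_model_approximation[where l = l and n = n, OF \<delta> e f contr l pos]) (rule that)
    then show ?thesis by (intro exI[of _ B]) simp
  qed
  then have "\<forall>n. \<exists>B. toeplitz_psd B \<and> (\<forall>i\<le>n. \<forall>j\<le>n.
      cmod (toeplitz_pencil \<delta> l B i j - (1 - cnj (f (l j)) * f (l i))) < 1 / Suc n)" by blast
  from choice[OF this] obtain B0 where B0: "\<And>n. toeplitz_psd (B0 n)"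
    "\<And>n i j. i \<le> n \<Longrightarrow> j \<le> n \<Longrightarrow> cmod (toeplitz_pencil \<delta> l (B0 n) i j - (1 - cnj (f (l j)) * f (l i))) < 1 / Suc n"
    by blast
  define X where "X n k i j = (if i \<in> {..n} \<and> j \<in> {..n} then B0 n k i j else 0)" for n k i j
  have X: "toeplitz_psd (X n)" for n
    using toeplitz_psd_restrict[OF B0(1)[of n], of "{..n}"] unfolding X_def[abs_def] by simp
  \<comment> \<open>The diagonal of the pencil is at most 2, namely 1 from the target and 1 from the
    error; coercivity carries the same factor 2.\<close>
  define b where "b i = 1 / (1 - \<delta>\<^sup>2 - cmod (skew \<delta> (l i)))" for i
  have b: "b i > 0" for i using l[of i] G_delta_iff[OF \<delta>] by (simp add: b_def)
  have diag: "Re (X n 0 i i) \<le> b i" for n i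
  proof (cases "i \<le> n")
    case True
    have "Re (toeplitz_pencil \<delta> l (B0 n) i i) - Re (1 - cnj (f (l i)) * f (l i)) \<le> 1 / Suc n"
      using complex_Re_le_cmod[of "toeplitz_pencil \<delta> l (B0 n) i i - (1 - cnj (f (l i)) * f (l i))"] B0(2)[OF True True]
      by (simp del: of_nat_Suc)
    moreover have "1 / real (Suc n) \<le> 1" by simp
    moreover have "Re (1 - cnj (f (l i)) * f (l i)) \<le> 1" by simp
    ultimately have "Re (toeplitz_pencil \<delta> l (B0 n) i i) \<le> 2" by linarith
    then have "(1 - \<delta>\<^sup>2 - cmod (skew \<delta> (l i))) * Re (B0 n 0 i i) \<le> 1"
      using toeplitz_pencil_coercive[OF B0(1)[of n], of \<delta> l i] by (simp add: algebra_simps)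
    then show ?thesis using True b[of i] by (simp add: X_def b_def field_simps)
  qed (use b[of i] in \<open>simp add: X_def\<close>)
  have bound: "cmod (X n k i j) \<le> sqrt (b i * b j)" for n k i j
  proof (rule real_le_rsqrt)
    have "(cmod (X n k i j))\<^sup>2 \<le> Re (X n 0 i i) * Re (X n 0 j j)" by (rule toeplitz_psd_entry_bound(1)[OF X])
    also have "\<dots> \<le> b i * b j"
      using b[of i] by (intro mult_mono diag toeplitz_psd_entry_bound(2)[OF X]) simp
    finally show "(cmod (X n k i j))\<^sup>2 \<le> b i * b j" .
  qed
  \<comment> \<open>Dividing by the entrywise bounds puts all entries into the unit disc, so one
    uniform bound serves for extracting the subsequence.\<close>
  define F where "F n p = (case p of (k, i, j) \<Rightarrow> X n k i j / of_real (sqrt (b i * b j)))" for n :: nat and p :: "int \<times> nat \<times> nat"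
  have F1: "cmod (F n p) \<le> 1" for n p
  proof -
    obtain k i j where p: "p = (k, i, j)" by (cases p)
    have "sqrt (b i * b j) > 0" using b by simp
    then show ?thesis using bound[of n k i j] by (simp add: F_def p norm_divide divide_le_eq)
  qed
  obtain r where r: "strict_mono (r :: nat \<Rightarrow> nat)" "\<And>p. \<exists>y. (\<lambda>n. F (r n) p) \<longlonglongrightarrow> y"
    by (rule function_convergent_subsequence[of "UNIV :: (int \<times> nat \<times> nat) set" F 1])
      (use F1 in auto)
  from r(2) obtain Y where Y: "\<And>p. (\<lambda>n. F (r n) p) \<longlonglongrightarrow> Y p" by metis
  define B where "B k i j = of_real (sqrt (b i * b j)) * Y (k, i, j)" for k i j
  have lim: "(\<lambda>n. X (r n) k i j) \<longlonglongrightarrow> B k i j" for k i j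
  proof -
    have "sqrt (b i * b j) \<noteq> 0" using b[of i] b[of j] by simp
    then have "X (r n) k i j = of_real (sqrt (b i * b j)) * F (r n) (k, i, j)" for n by (simp add: F_def)
    then show ?thesis unfolding B_def by (simp only:) (intro tendsto_intros Y)
  qed
  have "toeplitz_pencil \<delta> l B i j = 1 - cnj (f (l j)) * f (l i)" for i j
  proof -
    have 1: "(\<lambda>n. toeplitz_pencil \<delta> l (X (r n)) i j) \<longlonglongrightarrow> toeplitz_pencil \<delta> l B i j"
      unfolding toeplitz_pencil_def by (intro tendsto_intros lim)
    have "(\<lambda>n. toeplitz_pencil \<delta> l (X n) i j - (1 - cnj (f (l j)) * f (l i))) \<longlonglongrightarrow> 0"
    proof (rule Lim_null_comparison)
      show "(\<lambda>n. 1 / real (Suc n)) \<longlonglongrightarrow> 0" by (rule LIMSEQ_Suc[OF lim_1_over_n])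
      show "\<forall>\<^sub>F n in sequentially. cmod (toeplitz_pencil \<delta> l (X n) i j - (1 - cnj (f (l j)) * f (l i))) \<le> 1 / real (Suc n)"
        using eventually_ge_at_top[of "max i j"]
      proof eventually_elim
        case (elim n)
        then have "i \<le> n" "j \<le> n" by auto
        moreover from this have "toeplitz_pencil \<delta> l (X n) i j = toeplitz_pencil \<delta> l (B0 n) i j"
          by (simp add: toeplitz_pencil_def X_def)
        ultimately show ?case using B0(2)[of i n j] by simp
      qed
    qed
    then have "(\<lambda>n. toeplitz_pencil \<delta> l (X n) i j) \<longlonglongrightarrow> 1 - cnj (f (l j)) * f (l i)" by (simp add: LIM_zero_iff)
    from LIMSEQ_subseq_LIMSEQ[OF this r(1)] 1 show ?thesis by (simp add: o_def LIMSEQ_unique)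
  qed
  then show ?thesis using that toeplitz_limit[of "\<lambda>n. X (r n)", OF X lim] by blast
qed

theorem theorem3p5:
  fixes \<delta> :: real and f :: "complex \<Rightarrow> complex"
  assumes "0 < \<delta>" and "\<delta> < 1"
    and "infinite_dim_chilbert TYPE('h::chilbert)"
    and "f holomorphic_on G_delta \<delta>"
    and "\<forall>T::'h \<Rightarrow> 'h. bounded_clinear_op T \<and> closure (numerical_range T) \<subseteq> G_delta \<delta>
            \<longrightarrow> onorm (dunford f (G_delta \<delta>) T) \<le> 1"
  shows "\<exists>(U::'h \<Rightarrow> 'h) (u::complex \<Rightarrow> 'h). unitary_op U \<and> vholomorphic_on u (G_delta \<delta>) \<and>
           (\<forall>l\<in>G_delta \<delta>. \<forall>m\<in>G_delta \<delta>.
              1 - cnj (f m) * f l =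
              cinner (scaleC (2 - 2 * (of_real \<delta>)\<^sup>2) (u l)
                      - scaleC (cnj m - of_real \<delta> * l) (U (u l))
                      - scaleC (l - of_real \<delta> * cnj m) (cadjoint U (u l)))
                     (u m))"
proof -
  note \<delta> = assms(1,2) and f = assms(4)
  obtain e :: "nat \<Rightarrow> 'h" where e: "orthonormal e" using orthonormal_sequence[OF assms(3)] by blast
  obtain D where D: "countable D" "D \<subseteq> G_delta \<delta>" "G_delta \<delta> \<subseteq> closure D"
    using separable[of "G_delta \<delta>"] by blast
  have "0 \<in> G_delta \<delta>" by (simp add: G_delta_def)
  then have "D \<noteq> {}" using D(3) by auto
  define lam where "lam = from_nat_into D"
  have lam: "range lam = D" using D(1) \<open>D \<noteq> {}\<close> by (simp add: lam_def range_from_nat_into)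
  have lamG: "lam i \<in> G_delta \<delta>" for i using lam D(2) by blast
  obtain B where B: "toeplitz_psd B" "\<And>i j. toeplitz_pencil \<delta> lam B i j = 1 - cnj (f (lam j)) * f (lam i)"
    by (rule countable_model[where l = lam, OF \<delta> e f assms(5) lamG]) (rule that)
  obtain v :: "int \<times> nat \<Rightarrow> 'h" where
    v: "\<And>p q. cinner (v p) (v q) = B (fst p - fst q) (snd p) (snd q)"
    using psd_realization[OF e B(1)[unfolded toeplitz_psd_def]] by blast
  \<comment> \<open>The shift of the power index. A Toeplitz kernel sees only differences of powers,
    so the Gram matrix is unchanged, and over the integers the shift permutes the family.\<close>
  define w where "w p = v (fst p + 1, snd p)" for p
  have "cinner (v p) (v q) = cinner (w p) (w q)" for p q by (simp add: v w_def)
  moreover have "range v = range w"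
  proof (intro equalityI subsetI)
    fix x assume "x \<in> range v"
    then obtain p where "x = v p" by blast
    then have "x = w (fst p - 1, snd p)" by (simp add: w_def)
    then show "x \<in> range w" by blast
  qed (auto simp: w_def)
  ultimately obtain U where U: "unitary_op U" "\<And>x. U (cadjoint U x) = x" "\<And>x. cadjoint U (U x) = x"
    "\<And>x y. cinner (U x) (U y) = cinner x y" "\<And>p. U (v p) = w p"
    by (rule unitary_of_equal_gram) (rule that)
  interpret unitary_pencil \<delta> U "cadjoint U"
    by unfold_locales (use \<delta> U in auto)
  define a where "a i = v (0, i)" for i
  have Ua: "U (a i) = v (1, i)" for i by (simp add: a_def U w_def)
  \<comment> \<open>Together with \<open>Ua\<close> this identifies the powers 1 and -1, which with
    power 0 are the only ones in the pencil.\<close>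
  have Va: "cadjoint U (a i) = v (-1, i)" for i
    using U(3)[of "v (-1, i)"] by (simp add: a_def U(5) w_def)
  have E: "cinner (pencil (lam i) (lam j) (a i)) (a j) = 1 - cnj (f (lam j)) * f (lam i)" for i j
    unfolding cinner_pencil_expand Ua Va unfolding a_def v
    using B(2)[of i j] by (simp add: toeplitz_pencil_def)
  have "range lam \<subseteq> G_delta \<delta>" "G_delta \<delta> \<subseteq> closure (range lam)"
    using D lam by simp_all
  note dense = solution_from_dense[where lam = lam and a = a, OF this holomorphic_on_imp_continuous_on[OF f] E]
  obtain u where u: "\<And>l m. l \<in> G_delta \<delta> \<Longrightarrow> m \<in> G_delta \<delta> \<Longrightarrow>
    cinner (pencil l m (u l)) (u m) = 1 - cnj (f m) * f l"
    by (rule dense) (rule that)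
  have "vholomorphic_on u (G_delta \<delta>)" by (rule holomorphic_solution[OF u])
  with U(1) u show ?thesis unfolding pencil_def by (intro exI[of _ U] exI[of _ u]) simp
qed

end
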